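(* Let $f\in L^2(\mathbb{R}^2)$ and suppose that for some $\omega>0$, $$\omega\,\langle g,f\rangle_{L^2}=Q(g,f,f,f,f,f)\qquad\text{for all } g\in L^2(\mathbb{R}^2).$$ Then there exists $\mu>0$ such that $$e^{\mu|\xi|^4}\widehat f\in L^2(\mathbb{R}^2).$$ Furthermore, $f$ can be extended to be complex analytic on $\mathbb{C}^2$.
   Context: For $u\in L^2(\mathbb{R}^2)$ (complex-valued) let $\mathscr{F}u(\xi)=\widehat u(\xi)=\int_{\mathbb{R}^2}e^{-ix\cdot\xi}u(x)\,dx$ be the Fourier transform, and for $t\in\mathbb{R}$ define $e^{it\Delta^2}u:=\mathscr{F}^{-1}\big(e^{it|\xi|^4}\mathscr{F}u(\xi)\big)$. It is known that $\|e^{it\Delta^2}u\|_{L^6_{t,x}(\mathbb{R}^3)}\lesssim\|u\|_{L^2(\mathbb{R}^2)}$. The inner product is $\langle f,g\rangle_{L^2}:=\int_{\mathbb{R}^2}\overline{f(x)}\,g(x)\,dx$. For $f_1,\dots,f_6\in L^2(\mathbb{R}^2)$, $$Q(f_1,\dots,f_6):=\int_{\mathbb{R}^3}\prod_{k=1}^3\overline{e^{it\Delta^2}f_k(x)}\;e^{it\Delta^2}f_{k+3}(x)\,dx\,dt .$$ "$f$ can be extended to be complex analytic on $\mathbb{C}^2$" means that $f$ agrees almost everywhere on $\mathbb{R}^2$ with the restriction of a function holomorphic on all of $\mathbb{C}^2$. *)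

theory Defs
  imports "HOL-Analysis.Analysis"
begin

text \<open>
  Elements of \<open>L\<^sup>2\<close> are represented by Borel functions; every class of almost everywhere
  equal Lebesgue measurable functions has a Borel representative. The operators below that
  are determined only up to null sets pick some representative.
\<close>

definition L2 :: "('a::euclidean_space \<Rightarrow> complex) set" where
  "L2 = {u. u \<in> borel_measurable lborel \<and> integrable lborel (\<lambda>x. (cmod (u x))\<^sup>2)}"

definition inner_L2 :: "('a::euclidean_space \<Rightarrow> complex) \<Rightarrow> ('a \<Rightarrow> complex) \<Rightarrow> complex" where
  "inner_L2 g f = (LINT x|lborel. cnj (g x) * f x)"

definition fourier_integral :: "('a::euclidean_space \<Rightarrow> complex) \<Rightarrow> 'a \<Rightarrow> complex" where
  "fourier_integral u \<xi> = (LINT x|lborel. exp (- (\<i> * complex_of_real (x \<bullet> \<xi>))) * u x)"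

text \<open>
  For \<open>u\<close> in \<open>L\<^sup>2\<close> the integral need not converge absolutely; by Plancherel's theorem the
  transform is the limit in \<open>L\<^sup>2\<close> of the transforms of the truncations of \<open>u\<close> to balls,
  which are integrable.
\<close>

definition fourier_L2 :: "('a::euclidean_space \<Rightarrow> complex) \<Rightarrow> 'a \<Rightarrow> complex" where
  "fourier_L2 u = (SOME h. h \<in> L2 \<and>
     (\<lambda>n. \<integral>\<^sup>+ \<xi>. ennreal ((cmod (fourier_integral
              (\<lambda>x. indicator (ball 0 (real n)) x * u x) \<xi> - h \<xi>))\<^sup>2) \<partial>lborel)
       \<longlonglongrightarrow> 0)"

definition inv_fourier_L2 :: "('a::euclidean_space \<Rightarrow> complex) \<Rightarrow> 'a \<Rightarrow> complex" where
  "inv_fourier_L2 h = (SOME u. u \<in> L2 \<and> (AE \<xi> in lborel. fourier_L2 u \<xi> = h \<xi>))"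

definition propagator :: "real \<Rightarrow> (real^2 \<Rightarrow> complex) \<Rightarrow> real^2 \<Rightarrow> complex" where
  "propagator t u =
     inv_fourier_L2 (\<lambda>\<xi>. exp (\<i> * complex_of_real (t * norm \<xi> ^ 4)) * fourier_L2 u \<xi>)"

text \<open>
  Choosing a representative separately for each time need not give a function that is
  measurable in \<open>(t, x)\<close>. The space-time integral therefore uses a jointly measurable
  representative, which exists and, by Fubini, is unique up to null sets.
\<close>

definition evolution :: "(real^2 \<Rightarrow> complex) \<Rightarrow> real \<times> (real^2) \<Rightarrow> complex" where
  "evolution u = (SOME U. U \<in> borel_measurable lborel \<and>
     (\<forall>t. AE x in lborel. U (t, x) = propagator t u x))"

definition Q :: "(real^2 \<Rightarrow> complex) \<Rightarrow> (real^2 \<Rightarrow> complex) \<Rightarrow> (real^2 \<Rightarrow> complex) \<Rightarrow>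
    (real^2 \<Rightarrow> complex) \<Rightarrow> (real^2 \<Rightarrow> complex) \<Rightarrow> (real^2 \<Rightarrow> complex) \<Rightarrow> complex" where
  "Q f1 f2 f3 f4 f5 f6 = (LINT p|lborel.
     (cnj (evolution f1 p) * evolution f4 p) *
     (cnj (evolution f2 p) * evolution f5 p) *
     (cnj (evolution f3 p) * evolution f6 p))"

text \<open>Holomorphy on all of \<open>\<complex>\<^sup>n\<close>: the Frechet derivative exists everywhere and is complex linear.\<close>

definition entire :: "(complex^'n \<Rightarrow> complex) \<Rightarrow> bool" where
  "entire F \<longleftrightarrow> (\<forall>z. \<exists>D. (F has_derivative D) (at z) \<and> (\<forall>c w. D (c *s w) = c * D w))"

definition extends_to_entire :: "(real^'n \<Rightarrow> complex) \<Rightarrow> bool" where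
  "extends_to_entire f \<longleftrightarrow>
     (\<exists>F. entire F \<and> (AE x in lborel. f x = F (\<chi> i. complex_of_real (x $ i))))"

end

theory Submission
  imports Defs "HOL-Probability.Probability" "HOL-Real_Asymp.Real_Asymp"
begin

text \<open>
  Inserting a Gaussian in space-time turns \<open>Q\<close> into a form in the Fourier transforms whose kernel
  approximates the delta function of \<open>\<Sum>p\<^sub>i - \<Sum>q\<^sub>i\<close> and \<open>\<Sum>|p\<^sub>i|\<^sup>4 - \<Sum>|q\<^sub>i|\<^sup>4\<close>.
  The form is bounded by Schur's test: for a fixed total momentum, the volume between two levels of
  \<open>\<Sum>|p\<^sub>i|\<^sup>4\<close> is at most a constant times their difference, because the energy is convex and
  grows like a fourth power around its minimum. This gives the Strichartz estimate, and the
  constant becomes small if one momentum is high and the other two are low.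

  Since \<open>|p\<^sub>1|\<^sup>4 \<le> \<Sum>|q\<^sub>i|\<^sup>4\<close> on the support, a subadditive increasing weight of \<open>|p\<^sub>1|\<^sup>4\<close>
  can be distributed over the \<open>q\<^sub>i\<close>. Testing the equation with the high frequency part of \<open>f\<close>
  times the squared weight \<open>exp (min (\<mu> |\<xi>|\<^sup>4) R)\<close> yields an inequality for the weighted norm of the
  high frequency part that traps it near \<open>0\<close>, uniformly in \<open>R\<close>. Entire extension follows by
  differentiating the inverse Fourier integral.
\<close>

section \<open>Square integrable functions\<close>

text \<open>No measure on the resonant set is built. The Gaussian kernels conserve energy only
  approximately, while the weight can be moved only across a bounded energy defect. Every time
  kernel is therefore cut off to defects below 1, where the move costs at most a factor e; the
  remainder has mass at most \<open>\<sigma>\<^sup>2\<close> and disappears as the Gaussian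
  concentrates. This is why the form estimates are demanded uniformly over kernels.

  The weight is capped at \<open>exp R\<close> because finiteness of the full weighted norm is the
  claim itself. The trapping inequality needs two small factors, and both come from the gap between
  the thresholds s and \<open>s\<^sup>2\<close>. A momentum above \<open>s\<^sup>2\<close> either
  meets two momenta below s, where the level sets gain a power of s, or meets one above s, where f
  has little mass. On the other side three momenta below s carry too little energy, so one of them
  lies above s as well. Hence a norm of at most 2 \<eta> is at most \<eta>. Raising R by ln 2 at
  most doubles the weight, so the continuity argument in R becomes an induction.\<close>

definition l2norm :: "('a::euclidean_space \<Rightarrow> complex) \<Rightarrow> real" where
  "l2norm u = sqrt (LINT x|lborel. (cmod (u x))\<^sup>2)"

lemma L2_measurable [measurable_dest]: "u \<in> L2 \<Longrightarrow> u \<in> borel_measurable borel"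
  by (simp add: L2_def)

lemma L2_integrable: "u \<in> L2 \<Longrightarrow> integrable lborel (\<lambda>x. (cmod (u x))\<^sup>2)"
  by (simp add: L2_def)

lemma l2norm_nonneg [simp]: "0 \<le> l2norm u"
  by (simp add: l2norm_def)

lemma l2norm_sq: "(l2norm u)\<^sup>2 = (LINT x|lborel. (cmod (u x))\<^sup>2)"
  by (simp add: l2norm_def)

lemma L2_iff:
  "u \<in> L2 \<longleftrightarrow> u \<in> borel_measurable borel \<and> (\<integral>\<^sup>+x. ennreal ((cmod (u x))\<^sup>2) \<partial>lborel) < \<infinity>"
  unfolding L2_def integrable_iff_bounded by auto

lemma nn_l2norm: "u \<in> L2 \<Longrightarrow> (\<integral>\<^sup>+x. ennreal ((cmod (u x))\<^sup>2) \<partial>lborel) = ennreal ((l2norm u)\<^sup>2)"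
  unfolding l2norm_sq by (intro nn_integral_eq_integral L2_integrable) auto

text \<open>Fatou's lemma delivers bounds on extended nonnegative integrals; this converts such a
  bound into membership and a norm estimate at once.\<close>

lemma L2_I_nn:
  assumes "u \<in> borel_measurable borel" "(\<integral>\<^sup>+x. ennreal ((cmod (u x))\<^sup>2) \<partial>lborel) \<le> ennreal (c\<^sup>2)" "0 \<le> c"
  shows "u \<in> L2" "l2norm u \<le> c"
proof -
  show *: "u \<in> L2" unfolding L2_iff using assms by (auto intro: le_less_trans)
  have "(l2norm u)\<^sup>2 \<le> c\<^sup>2" using assms nn_l2norm[OF *] by simp
  then show "l2norm u \<le> c" using assms(3) by (rule power2_le_imp_le)
qed

lemma L2_mono:
  assumes "v \<in> L2" "u \<in> borel_measurable borel" "\<And>x. cmod (u x) \<le> C * cmod (v x)" "0 \<le> C"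
  shows "u \<in> L2" "l2norm u \<le> C * l2norm v"
proof -
  have v[measurable]: "v \<in> borel_measurable borel" using assms by auto
  have "(\<integral>\<^sup>+x. ennreal ((cmod (u x))\<^sup>2) \<partial>lborel) \<le> (\<integral>\<^sup>+x. ennreal (C\<^sup>2) * ennreal ((cmod (v x))\<^sup>2) \<partial>lborel)"
    using assms(3) by (intro nn_integral_mono) (auto simp flip: ennreal_mult power_mult_distrib intro!: power_mono)
  also have "\<dots> = ennreal ((C * l2norm v)\<^sup>2)"
    by (subst nn_integral_cmult) (auto simp: nn_l2norm assms(1) power_mult_distrib simp flip: ennreal_mult)
  finally show "u \<in> L2" "l2norm u \<le> C * l2norm v"
    using L2_I_nn[of u "C * l2norm v"] assms by auto
qed

lemma L2_cong_AE:
  assumes "u \<in> L2" "v \<in> borel_measurable borel" "AE x in lborel. u x = v x"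
  shows "v \<in> L2"
proof -
  have "(\<integral>\<^sup>+x. ennreal ((cmod (u x))\<^sup>2) \<partial>lborel) = (\<integral>\<^sup>+x. ennreal ((cmod (v x))\<^sup>2) \<partial>lborel)"
    by (intro nn_integral_cong_AE) (use assms in auto)
  then show ?thesis using assms by (auto simp: L2_iff)
qed

lemma l2norm_cong_AE:
  assumes "u \<in> borel_measurable borel" "v \<in> borel_measurable borel" "AE x in lborel. u x = v x"
  shows "l2norm u = l2norm v"
  unfolding l2norm_def by (intro arg_cong[where f=sqrt] integral_cong_AE) (use assms in auto)

lemma L2_cmult [simp]: "u \<in> L2 \<Longrightarrow> (\<lambda>x. c * u x) \<in> L2"
  by (rule L2_mono(1)[where v=u and C="cmod c"]) (auto simp: norm_mult)

lemma l2norm_cmult: "l2norm (\<lambda>x. c * u x) = cmod c * l2norm u"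
  by (simp add: l2norm_def norm_mult power_mult_distrib real_sqrt_mult)

lemma measurable_cnj_comp [measurable (raw)]:
  "u \<in> borel_measurable M \<Longrightarrow> (\<lambda>x. cnj (u x)) \<in> borel_measurable M"
  using measurable_compose[of u M borel cnj borel] borel_measurable_continuous_onI[OF continuous_on_cnj[OF continuous_on_id]]
  by simp

lemma L2_cnj [simp]: "u \<in> L2 \<Longrightarrow> (\<lambda>x. cnj (u x)) \<in> L2"
  by (rule L2_mono(1)[where v=u and C=1]) auto

lemma l2norm_cnj [simp]: "l2norm (\<lambda>x. cnj (u x)) = l2norm u"
  by (simp add: l2norm_def)

lemma L2_indicator:
  assumes "u \<in> L2" "A \<in> sets borel"
  shows "(\<lambda>x. indicator A x * u x) \<in> L2" "l2norm (\<lambda>x. indicator A x * u x) \<le> l2norm u"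
  using L2_mono[where u="\<lambda>x. indicator A x * u x" and v=u and C=1] assms
  by (auto simp: norm_mult indicator_def)

lemma L2_add [simp]:
  assumes u: "u \<in> L2" and v: "v \<in> L2" shows "(\<lambda>x. u x + v x) \<in> L2"
proof -
  have [measurable]: "u \<in> borel_measurable borel" "v \<in> borel_measurable borel" using assms by auto
  have b: "(cmod (u x + v x))\<^sup>2 \<le> 2 * (cmod (u x))\<^sup>2 + 2 * (cmod (v x))\<^sup>2" for x
  proof -
    have "(cmod (u x + v x))\<^sup>2 \<le> (cmod (u x) + cmod (v x))\<^sup>2" by (intro power_mono norm_triangle_ineq) auto
    also have "\<dots> \<le> 2 * (cmod (u x))\<^sup>2 + 2 * (cmod (v x))\<^sup>2"
      using sum_squares_bound[of "cmod (u x)" "cmod (v x)"] by (simp add: power2_sum)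
    finally show ?thesis .
  qed
  have "integrable lborel (\<lambda>x. (cmod (u x + v x))\<^sup>2)"
    by (rule Bochner_Integration.integrable_bound[where f="\<lambda>x. 2 * (cmod (u x))\<^sup>2 + 2 * (cmod (v x))\<^sup>2"])
       (use L2_integrable[OF u] L2_integrable[OF v] b in auto)
  then show ?thesis by (simp add: L2_def)
qed

lemma L2_diff [simp]: "u \<in> L2 \<Longrightarrow> v \<in> L2 \<Longrightarrow> (\<lambda>x. u x - v x) \<in> L2"
  using L2_add[OF _ L2_cmult[of v "-1"], of u] by simp

text \<open>Stated for the extended nonnegative integral, since integrability of the product is one
  of its consequences.\<close>

lemma L2_nn_CS:
  fixes u v :: "'a::euclidean_space \<Rightarrow> complex"
  assumes u: "u \<in> L2" and v: "v \<in> L2"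
  shows "(\<integral>\<^sup>+x. ennreal (cmod (u x * v x)) \<partial>lborel) \<le> ennreal (l2norm u * l2norm v)"
proof -
  have [measurable]: "u \<in> borel_measurable borel" "v \<in> borel_measurable borel" using assms by auto
  let ?I = "\<integral>\<^sup>+x. ennreal (cmod (u x * v x)) \<partial>lborel"
  have "?I\<^sup>2 = (\<integral>\<^sup>+x. ennreal (cmod (u x)) * ennreal (cmod (v x)) \<partial>lborel)\<^sup>2"
    by (simp add: norm_mult ennreal_mult)
  also have "\<dots> \<le> (\<integral>\<^sup>+x. (ennreal (cmod (u x)))\<^sup>2 \<partial>lborel) * (\<integral>\<^sup>+x. (ennreal (cmod (v x)))\<^sup>2 \<partial>lborel)"
    by (rule Cauchy_Schwarz_nn_integral) auto
  also have "\<dots> = ennreal ((l2norm u * l2norm v)\<^sup>2)"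
    by (simp add: ennreal_power nn_l2norm u v power_mult_distrib ennreal_mult)
  finally have *: "?I\<^sup>2 \<le> ennreal ((l2norm u * l2norm v)\<^sup>2)" .
  then have "?I < \<infinity>"
    by (metis ennreal_less_top infinity_ennreal_def le_less_trans power_eq_top_ennreal top.not_eq_extremum zero_neq_numeral)
  then obtain r where r: "0 \<le> r" "?I = ennreal r" by (cases ?I) auto
  have "r\<^sup>2 \<le> (l2norm u * l2norm v)\<^sup>2" using * r by (simp add: ennreal_power)
  then have "r \<le> l2norm u * l2norm v" by (rule power2_le_imp_le) simp
  then show ?thesis using r by (simp add: ennreal_leI)
qed

lemma L2_mult_integrable:
  fixes u v :: "'a::euclidean_space \<Rightarrow> complex"
  assumes u: "u \<in> L2" and v: "v \<in> L2"
  shows "integrable lborel (\<lambda>x. u x * v x)"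
  unfolding integrable_iff_bounded using L2_nn_CS[OF u v] assms by (auto intro: le_less_trans)

lemma L2_CS:
  fixes u v :: "'a::euclidean_space \<Rightarrow> complex"
  assumes u: "u \<in> L2" and v: "v \<in> L2"
  shows "cmod (LINT x|lborel. u x * v x) \<le> l2norm u * l2norm v"
proof -
  have "ennreal (cmod (LINT x|lborel. u x * v x)) \<le> (\<integral>\<^sup>+x. ennreal (cmod (u x * v x)) \<partial>lborel)"
    by (rule integral_norm_bound_ennreal[OF L2_mult_integrable[OF u v]])
  also have "\<dots> \<le> ennreal (l2norm u * l2norm v)" by (rule L2_nn_CS[OF u v])
  finally show ?thesis by (simp add: ennreal_le_iff)
qed

lemma l2norm_sq_complex:
  "complex_of_real ((l2norm u)\<^sup>2) = (LINT x|lborel. cnj (u x) * u x)"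
  unfolding l2norm_sq integral_complex_of_real[symmetric]
  by (intro Bochner_Integration.integral_cong) (auto simp: complex_norm_square mult.commute simp del: of_real_power)

lemma inner_L2_add_sq:
  fixes u v :: "'a::euclidean_space \<Rightarrow> complex"
  assumes u: "u \<in> L2" and v: "v \<in> L2"
  shows "(l2norm (\<lambda>x. u x + v x))\<^sup>2 = (l2norm u)\<^sup>2 + 2 * Re (inner_L2 u v) + (l2norm v)\<^sup>2"
proof -
  have i: "integrable lborel (\<lambda>x. cnj (a x) * b x)" if "a \<in> L2" "b \<in> L2" for a b :: "'a \<Rightarrow> complex"
    by (intro L2_mult_integrable L2_cnj that)
  have "complex_of_real ((l2norm (\<lambda>x. u x + v x))\<^sup>2) = (LINT x|lborel. (cnj (u x) * u x + cnj (u x) * v x) + (cnj (v x) * u x + cnj (v x) * v x))"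
    unfolding l2norm_sq_complex by (intro Bochner_Integration.integral_cong) (auto simp: algebra_simps)
  also have "\<dots> = (of_real ((l2norm u)\<^sup>2) + inner_L2 u v) + (inner_L2 v u + of_real ((l2norm v)\<^sup>2))"
    using i[OF u u] i[OF u v] i[OF v u] i[OF v v] by (simp add: inner_L2_def l2norm_sq_complex del: of_real_power)
  also have "inner_L2 v u = cnj (inner_L2 u v)"
    unfolding inner_L2_def by (subst Bochner_Integration.integral_cnj[symmetric]) (simp add: mult.commute)
  finally have "Re (complex_of_real ((l2norm (\<lambda>x. u x + v x))\<^sup>2)) = Re ((of_real ((l2norm u)\<^sup>2) + inner_L2 u v) + (cnj (inner_L2 u v) + of_real ((l2norm v)\<^sup>2)))" by simp
  then show ?thesis by simp
qed

lemma l2norm_triangle: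
  fixes u v :: "'a::euclidean_space \<Rightarrow> complex"
  assumes u: "u \<in> L2" and v: "v \<in> L2"
  shows "l2norm (\<lambda>x. u x + v x) \<le> l2norm u + l2norm v"
proof -
  have "Re (inner_L2 u v) \<le> l2norm u * l2norm v"
    using L2_CS[OF L2_cnj[OF u] v] complex_Re_le_cmod[of "inner_L2 u v"] by (simp add: inner_L2_def)
  then have "(l2norm (\<lambda>x. u x + v x))\<^sup>2 \<le> (l2norm u + l2norm v)\<^sup>2"
    unfolding inner_L2_add_sq[OF u v] by (simp add: power2_sum)
  then show ?thesis by (rule power2_le_imp_le) simp
qed

lemma l2norm_minus_commute: "l2norm (\<lambda>x. u x - v x) = l2norm (\<lambda>x. v x - u x)"
  by (simp add: l2norm_def norm_minus_commute)

lemma l2norm_triangle_diff: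
  fixes u v w :: "'a::euclidean_space \<Rightarrow> complex"
  assumes "u \<in> L2" "v \<in> L2" "w \<in> L2"
  shows "l2norm (\<lambda>x. u x - w x) \<le> l2norm (\<lambda>x. u x - v x) + l2norm (\<lambda>x. v x - w x)"
  using l2norm_triangle[of "\<lambda>x. u x - v x" "\<lambda>x. v x - w x"] assms by simp

lemma l2norm_diff_ge:
  fixes u v :: "'a::euclidean_space \<Rightarrow> complex"
  assumes "u \<in> L2" "v \<in> L2"
  shows "\<bar>l2norm u - l2norm v\<bar> \<le> l2norm (\<lambda>x. u x - v x)"
  using l2norm_triangle[of "\<lambda>x. u x - v x" v] l2norm_triangle[of "\<lambda>x. v x - u x" u] assms l2norm_minus_commute[of u v]
  by (simp add: abs_le_iff)

lemma l2norm_0_imp_AE: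
  fixes u v :: "'a::euclidean_space \<Rightarrow> complex"
  assumes "u \<in> L2" "v \<in> L2" "l2norm (\<lambda>x. u x - v x) \<le> 0"
  shows "AE x in lborel. u x = v x"
proof -
  have d: "(\<lambda>x. u x - v x) \<in> L2" using assms by simp
  have "(\<integral>\<^sup>+x. ennreal ((cmod (u x - v x))\<^sup>2) \<partial>lborel) = 0"
    unfolding nn_l2norm[OF d] using assms by (simp add: order_antisym[OF assms(3)])
  moreover have [measurable]: "u \<in> borel_measurable borel" "v \<in> borel_measurable borel" using assms by auto
  ultimately show ?thesis by (subst (asm) nn_integral_0_iff_AE) auto
qed

section \<open>Convergence in mean, almost everywhere convergence and completeness\<close>

lemma l2norm_tendsto:
  fixes u :: "'a::euclidean_space \<Rightarrow> complex"
  assumes "\<And>n. U n \<in> L2" "u \<in> L2" "(\<lambda>n::nat. l2norm (\<lambda>x. U n x - u x)) \<longlonglongrightarrow> 0"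
  shows "(\<lambda>n. l2norm (U n)) \<longlonglongrightarrow> l2norm u"
proof (rule Lim_null[THEN iffD2], rule Lim_null_comparison[OF _ assms(3)])
  show "\<forall>\<^sub>F n in sequentially. norm (l2norm (U n) - l2norm u) \<le> l2norm (\<lambda>x. U n x - u x)"
    using l2norm_diff_ge[OF assms(1) assms(2)] by auto
qed

lemma L2_tendsto_integral_mult:
  fixes u v :: "'a::euclidean_space \<Rightarrow> complex"
  assumes U: "\<And>n. U n \<in> L2" "u \<in> L2" "(\<lambda>n::nat. l2norm (\<lambda>x. U n x - u x)) \<longlonglongrightarrow> 0"
  assumes V: "\<And>n. V n \<in> L2" "v \<in> L2" "(\<lambda>n::nat. l2norm (\<lambda>x. V n x - v x)) \<longlonglongrightarrow> 0"
  shows "(\<lambda>n. LINT x|lborel. U n x * V n x) \<longlonglongrightarrow> (LINT x|lborel. u x * v x)"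
proof (rule Lim_null[THEN iffD2], rule Lim_null_comparison)
  show "\<forall>\<^sub>F n in sequentially. norm ((LINT x|lborel. U n x * V n x) - (LINT x|lborel. u x * v x)) \<le>
    l2norm (\<lambda>x. U n x - u x) * l2norm (V n) + l2norm u * l2norm (\<lambda>x. V n x - v x)"
  proof (intro always_eventually allI)
    fix n
    have "(LINT x|lborel. U n x * V n x) - (LINT x|lborel. u x * v x) =
      (LINT x|lborel. (U n x - u x) * V n x) + (LINT x|lborel. u x * (V n x - v x))"
      using L2_mult_integrable[OF U(1) V(1), of n n] L2_mult_integrable[OF U(2) V(2)] L2_mult_integrable[OF U(2) V(1), of n]
      by (simp add: left_diff_distrib right_diff_distrib)
    then show "norm ((LINT x|lborel. U n x * V n x) - (LINT x|lborel. u x * v x)) \<le>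
       l2norm (\<lambda>x. U n x - u x) * l2norm (V n) + l2norm u * l2norm (\<lambda>x. V n x - v x)"
      using L2_CS[of "\<lambda>x. U n x - u x" "V n"] L2_CS[of u "\<lambda>x. V n x - v x"] U V
      by (simp add: norm_triangle_le)
  qed
  have "(\<lambda>n. l2norm (V n)) \<longlonglongrightarrow> l2norm v" by (rule l2norm_tendsto[OF V])
  then show "(\<lambda>n. l2norm (\<lambda>x. U n x - u x) * l2norm (V n) + l2norm u * l2norm (\<lambda>x. V n x - v x)) \<longlonglongrightarrow> 0"
    using U(3) V(3) by (auto intro!: tendsto_eq_intros)
qed

text \<open>The sum of the squared distances has a finite integral, so it is finite at almost every
  point and its terms tend to zero there.\<close>

lemma AE_tendsto_of_summable_L2:
  fixes u :: "'a::euclidean_space \<Rightarrow> complex"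
  assumes [measurable]: "\<And>n. U n \<in> borel_measurable borel" "u \<in> borel_measurable borel"
    and s: "(\<Sum>n. \<integral>\<^sup>+x. ennreal ((cmod (U n x - u x))\<^sup>2) \<partial>lborel) < \<infinity>"
  shows "AE x in lborel. (\<lambda>n::nat. U n x) \<longlonglongrightarrow> u x"
proof -
  have "(\<integral>\<^sup>+x. (\<Sum>n. ennreal ((cmod (U n x - u x))\<^sup>2)) \<partial>lborel) < \<infinity>"
    using s by (subst nn_integral_suminf) auto
  then have "AE x in lborel. (\<Sum>n. ennreal ((cmod (U n x - u x))\<^sup>2)) \<noteq> \<infinity>"
    by (intro nn_integral_PInf_AE) auto
  then show ?thesis
  proof eventually_elim
    case (elim x)
    have "summable (\<lambda>n. (cmod (U n x - u x))\<^sup>2)"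
      using elim by (intro summable_suminf_not_top) auto
    then have "(\<lambda>n. (cmod (U n x - u x))\<^sup>2) \<longlonglongrightarrow> 0" by (rule summable_LIMSEQ_zero)
    then have "(\<lambda>n. sqrt ((cmod (U n x - u x))\<^sup>2)) \<longlonglongrightarrow> sqrt 0" by (intro tendsto_real_sqrt)
    then have "(\<lambda>n. cmod (U n x - u x)) \<longlonglongrightarrow> 0" by simp
    then show ?case by (rule LIM_zero_cancel[OF tendsto_norm_zero_cancel])
  qed
qed

lemma exists_summable_subseq:
  fixes r :: "nat \<Rightarrow> real"
  assumes r: "r \<longlonglongrightarrow> 0" "\<And>n. 0 \<le> r n"
  shows "\<exists>s. strict_mono s \<and> (\<forall>k. r (s k) \<le> (1/2)^k)"
proof -
  have "\<exists>s. \<forall>k. (r (s k) \<le> (1/2)^k) \<and> s k < s (Suc k)"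
  proof (rule dependent_nat_choice)
    show "\<exists>x. r x \<le> (1/2)^0"
      using order_tendstoD(2)[OF r(1), of 1] by (auto simp: eventually_sequentially intro: less_imp_le)
    fix x n
    have "\<forall>\<^sub>F m in sequentially. r m < (1/2)^Suc n" by (rule order_tendstoD(2)[OF r(1)]) simp
    then obtain N where "\<And>m. m \<ge> N \<Longrightarrow> r m < (1/2)^Suc n" by (auto simp: eventually_sequentially)
    then show "\<exists>y. r y \<le> (1/2)^Suc n \<and> x < y" by (intro exI[of _ "max N (Suc x)"]) (auto intro: less_imp_le)
  qed
  then show ?thesis by (auto simp: strict_mono_Suc_iff)
qed

lemma AE_tendsto_of_L2_geometric:
  fixes u :: "'a::euclidean_space \<Rightarrow> complex"
  assumes U: "\<And>n. U n \<in> L2" and u: "u \<in> L2" and b: "\<And>n. l2norm (\<lambda>x. U n x - u x) \<le> c * (1/2)^n" 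
  shows "AE x in lborel. (\<lambda>n::nat. U n x) \<longlonglongrightarrow> u x"
proof (rule AE_tendsto_of_summable_L2)
  have "0 \<le> c" using order_trans[OF l2norm_nonneg b[of 0]] by simp
  have "(\<Sum>n. \<integral>\<^sup>+x. ennreal ((cmod (U n x - u x))\<^sup>2) \<partial>lborel) \<le> (\<Sum>n. ennreal (c\<^sup>2 * (1/4)^n))"
  proof (intro suminf_le summableI)
    fix n
    have "(l2norm (\<lambda>x. U n x - u x))\<^sup>2 \<le> (c * (1/2)^n)\<^sup>2" by (intro power_mono b) simp
    also have "\<dots> = c\<^sup>2 * (1/4)^n" by (simp add: power_mult_distrib power2_eq_square flip: power_mult_distrib)
    finally show "(\<integral>\<^sup>+x. ennreal ((cmod (U n x - u x))\<^sup>2) \<partial>lborel) \<le> ennreal (c\<^sup>2 * (1/4)^n)"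
      using nn_l2norm[of "\<lambda>x. U n x - u x"] U u by (simp add: ennreal_leI)
  qed
  also have "\<dots> = ennreal (\<Sum>n. c\<^sup>2 * (1/4)^n)"
    by (intro suminf_ennreal2 summable_mult summable_geometric) auto
  also have "\<dots> < \<infinity>" by simp
  finally show "(\<Sum>n. \<integral>\<^sup>+x. ennreal ((cmod (U n x - u x))\<^sup>2) \<partial>lborel) < \<infinity>" .
qed (use U u in auto)

text \<open>Fatou's lemma in the form used repeatedly below: an eventual bound for the approximants
  passes to their almost everywhere limit.\<close>

lemma nn_integral_le_of_tendsto:
  fixes f :: "nat \<Rightarrow> 'b \<Rightarrow> real"
  assumes [measurable]: "\<And>n. f n \<in> borel_measurable M"
    and lim: "AE x in M. (\<lambda>n. f n x) \<longlonglongrightarrow> g x"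
    and C: "\<forall>\<^sub>F n in sequentially. (\<integral>\<^sup>+x. ennreal (f n x) \<partial>M) \<le> C"
  shows "(\<integral>\<^sup>+x. ennreal (g x) \<partial>M) \<le> C"
proof -
  have "(\<integral>\<^sup>+x. ennreal (g x) \<partial>M) = (\<integral>\<^sup>+x. liminf (\<lambda>n. ennreal (f n x)) \<partial>M)"
    by (rule nn_integral_cong_AE, use lim in eventually_elim)
       (rule lim_imp_Liminf[OF trivial_limit_sequentially tendsto_ennrealI, symmetric])
  also have "\<dots> \<le> liminf (\<lambda>n. \<integral>\<^sup>+x. ennreal (f n x) \<partial>M)" by (rule nn_integral_liminf) measurable
  also have "\<dots> \<le> liminf (\<lambda>n. C)" by (rule Liminf_mono[OF C])
  finally show ?thesis by (simp only: Liminf_const[OF trivial_limit_sequentially])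
qed

text \<open>Riesz-Fischer with a rate. The limit is taken pointwise along a fast subsequence, and
  Fatou's lemma transfers the Cauchy rate r of the whole sequence to it.\<close>

lemma L2_complete:
  fixes V :: "nat \<Rightarrow> 'a::euclidean_space \<Rightarrow> complex"
  assumes V: "\<And>n. V n \<in> L2" and C: "\<And>m n. m \<le> n \<Longrightarrow> l2norm (\<lambda>x. V m x - V n x) \<le> r m" and r: "r \<longlonglongrightarrow> 0"
  shows "\<exists>h\<in>L2. \<forall>n. l2norm (\<lambda>x. V n x - h x) \<le> r n"
proof -
  have [measurable]: "V n \<in> borel_measurable borel" for n using V by auto
  have r0: "0 \<le> r n" for n using order_trans[OF l2norm_nonneg C[of n n]] by simp
  obtain s where s: "strict_mono s" "\<And>k. r (s k) \<le> (1/2)^k" using exists_summable_subseq[OF r r0] by blast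
  have inc: "s k \<le> s (Suc k)" for k using s(1) by (simp add: strict_mono_Suc_iff less_imp_le)
  \<comment> \<open>The factor \<open>2^k\<close> leaves the integrals summable, because the squared
    norms decay like \<open>(1/4)^k\<close>. Pointwise boundedness of these terms then already gives
    increments of size \<open>(1 / sqrt 2)^k\<close>, so the sequence converges absolutely.\<close>
  let ?D = "\<lambda>k x. 2^k * (cmod (V (s k) x - V (s (Suc k)) x))\<^sup>2"
  have "(\<integral>\<^sup>+x. (\<Sum>k. ennreal (?D k x)) \<partial>lborel) = (\<Sum>k. \<integral>\<^sup>+x. ennreal (?D k x) \<partial>lborel)"
    by (subst nn_integral_suminf) auto
  also have "\<dots> \<le> (\<Sum>k. ennreal ((1/2)^k))"
  proof (intro suminf_le summableI)
    fix k
    have "(\<integral>\<^sup>+x. ennreal (?D k x) \<partial>lborel) = ennreal (2^k * (l2norm (\<lambda>x. V (s k) x - V (s (Suc k)) x))\<^sup>2)"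
      using nn_l2norm[of "\<lambda>x. V (s k) x - V (s (Suc k)) x"] V
      by (simp add: ennreal_mult nn_integral_cmult)
    also have "\<dots> \<le> ennreal (2^k * ((1/2)^k)\<^sup>2)"
      using C[OF inc[of k]] s(2)[of k] by (intro ennreal_leI mult_left_mono power_mono) (auto intro: order_trans)
    also have "2^k * ((1/2::real)^k)\<^sup>2 = (1/2)^k" by (simp add: power2_eq_square power_one_over)
    finally show "(\<integral>\<^sup>+x. ennreal (?D k x) \<partial>lborel) \<le> ennreal ((1/2)^k)" .
  qed
  also have "\<dots> = ennreal (\<Sum>k. (1/2)^k)"
    by (intro suminf_ennreal2 summable_geometric) auto
  also have "\<dots> < \<infinity>" by simp
  finally have "AE x in lborel. (\<Sum>k. ennreal (?D k x)) \<noteq> \<infinity>"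
    by (intro nn_integral_PInf_AE) auto
  then have conv: "AE x in lborel. convergent (\<lambda>k. V (s k) x)"
  proof eventually_elim
    case (elim x)
    have "summable (\<lambda>k. ?D k x)" using elim by (intro summable_suminf_not_top) auto
    then have "Bseq (\<lambda>k. ?D k x)" by (intro convergent_imp_Bseq convergentI[where L=0] summable_LIMSEQ_zero)
    then obtain K where K: "K > 0" "\<And>k. ?D k x \<le> K" by (auto simp: Bseq_def)
    have "summable (\<lambda>k. V (s (Suc k)) x - V (s k) x)"
    proof (rule summable_comparison_test)
      show "summable (\<lambda>k. sqrt K * (1 / sqrt 2)^k)" by (intro summable_mult summable_geometric) auto
      have "norm (V (s (Suc k)) x - V (s k) x) \<le> sqrt K * (1 / sqrt 2)^k" for k
      proof (rule power2_le_imp_le)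
        have "((1 / sqrt 2)^k)\<^sup>2 = ((1 / sqrt 2)\<^sup>2)^k" by (simp only: power_mult[symmetric] mult.commute)
        then have "(sqrt K * (1 / sqrt 2)^k)\<^sup>2 = K / 2^k" using K
          by (simp add: power_mult_distrib power_divide del: power_one_over)
        then show "(norm (V (s (Suc k)) x - V (s k) x))\<^sup>2 \<le> (sqrt K * (1 / sqrt 2)^k)\<^sup>2"
          using K(2)[of k] by (simp only:) (simp add: field_simps norm_minus_commute)
      qed (use K in auto)
      then show "\<exists>N. \<forall>n\<ge>N. norm (V (s (Suc n)) x - V (s n) x) \<le> sqrt K * (1 / sqrt 2)^n" by blast
    qed
    then have "convergent (\<lambda>n. \<Sum>k<n. V (s (Suc k)) x - V (s k) x)" by (simp add: summable_iff_convergent)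
    then have "convergent (\<lambda>n. V (s n) x - V (s 0) x)" unfolding sum_lessThan_telescope[of "\<lambda>k. V (s k) x"] .
    from convergent_add[OF this convergent_const[of "V (s 0) x"]] show ?case by simp
  qed
  \<comment> \<open>The default 0 off the convergence set makes h a measurable function defined
    everywhere.\<close>
  define h where "h x = (if convergent (\<lambda>k. V (s k) x) then lim (\<lambda>k. V (s k) x) else 0)" for x
  have [measurable]: "h \<in> borel_measurable borel"
    unfolding h_def Cauchy_convergent_iff[symmetric] by measurable
  have lim: "AE x in lborel. (\<lambda>k. V (s k) x) \<longlonglongrightarrow> h x"
    using conv by eventually_elim (auto simp: h_def convergent_LIMSEQ_iff)
  have b: "(\<integral>\<^sup>+x. ennreal ((cmod (V n x - h x))\<^sup>2) \<partial>lborel) \<le> ennreal ((r n)\<^sup>2)" for n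
  proof (rule nn_integral_le_of_tendsto[where f="\<lambda>k x. (cmod (V n x - V (s k) x))\<^sup>2"])
    show "AE x in lborel. (\<lambda>k. (cmod (V n x - V (s k) x))\<^sup>2) \<longlonglongrightarrow> (cmod (V n x - h x))\<^sup>2"
      using lim by eventually_elim (intro tendsto_intros)
    show "\<forall>\<^sub>F k in sequentially. (\<integral>\<^sup>+x. ennreal ((cmod (V n x - V (s k) x))\<^sup>2) \<partial>lborel) \<le> ennreal ((r n)\<^sup>2)"
      using eventually_ge_at_top[of n]
    proof eventually_elim
      case (elim k)
      then have "n \<le> s k" using strict_mono_imp_increasing[OF s(1), of k] by simp
      then show ?case
        using nn_l2norm[of "\<lambda>x. V n x - V (s k) x"] V C[of n "s k"]
        by (simp add: ennreal_leI power_mono)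
    qed
  qed measurable
  have d: "(\<lambda>x. V n x - h x) \<in> L2" "l2norm (\<lambda>x. V n x - h x) \<le> r n" for n
    using L2_I_nn[OF _ b r0] by auto
  \<comment> \<open>So far only the differences \<open>V n - h\<close> are known to lie in
    \<open>L2\<close>; h is recovered from one of them.\<close>
  have "(\<lambda>x. V 0 x - (V 0 x - h x)) \<in> L2" by (intro L2_diff V d)
  then have "h \<in> L2" by simp
  then show ?thesis using d by blast
qed

section \<open>Gaussians and Plancherel's theorem\<close>

lemma borel_measurable_fst_snd [measurable (raw)]:
  fixes f :: "'c \<Rightarrow> 'a::second_countable_topology \<times> 'b::second_countable_topology"
  assumes f: "f \<in> borel_measurable M"
  shows "(\<lambda>x. fst (f x)) \<in> borel_measurable M" "(\<lambda>x. snd (f x)) \<in> borel_measurable M"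
  using measurable_compose[OF f borel_measurable_continuous_onI[OF continuous_on_fst[OF continuous_on_id]]]
    measurable_compose[OF f borel_measurable_continuous_onI[OF continuous_on_snd[OF continuous_on_id]]]
  by auto

lemma nn_integral_shift:
  fixes f :: "'a::euclidean_space \<Rightarrow> ennreal"
  assumes [measurable]: "f \<in> borel_measurable borel"
  shows "(\<integral>\<^sup>+x. f (t + x) \<partial>lborel) = (\<integral>\<^sup>+x. f x \<partial>lborel)"
  by (subst (2) lborel_distr_plus[of t, symmetric]) (simp add: nn_integral_distr)

lemma nn_integral_scale:
  fixes f :: "'a::euclidean_space \<Rightarrow> ennreal"
  assumes [measurable]: "f \<in> borel_measurable borel" and c: "c \<noteq> 0"
  shows "(\<integral>\<^sup>+x. f x \<partial>lborel) = ennreal (\<bar>c\<bar>^DIM('a)) * (\<integral>\<^sup>+x. f (t + c *\<^sub>R x) \<partial>lborel)"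
  by (subst lborel_affine[OF c, of t])
     (simp add: nn_integral_density nn_integral_distr nn_integral_cmult)

lemma nn_integral_reflect:
  fixes f :: "'a::euclidean_space \<Rightarrow> ennreal"
  assumes [measurable]: "f \<in> borel_measurable borel"
  shows "(\<integral>\<^sup>+x. f (t - x) \<partial>lborel) = (\<integral>\<^sup>+x. f x \<partial>lborel)"
  using nn_integral_scale[OF assms, of "-1" t] by simp

lemma integral_scale:
  fixes f :: "'a::euclidean_space \<Rightarrow> complex"
  assumes [measurable]: "f \<in> borel_measurable borel" and c: "c \<noteq> 0"
  shows "(LINT x|lborel. f x) = \<bar>c\<bar>^DIM('a) *\<^sub>R (LINT x|lborel. f (t + c *\<^sub>R x))"
  by (subst lborel_affine[OF c, of t])
     (simp add: integral_density integral_distr)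

lemma integrable_pair_mult:
  fixes f :: "'a \<Rightarrow> complex" and g :: "'b \<Rightarrow> complex"
  assumes "sigma_finite_measure M1" "sigma_finite_measure M2"
    and f: "integrable M1 f" and g: "integrable M2 g"
  shows "integrable (M1 \<Otimes>\<^sub>M M2) (\<lambda>(x,y). f x * g y)"
    and "(LINT p|(M1 \<Otimes>\<^sub>M M2). f (fst p) * g (snd p)) = (LINT x|M1. f x) * (LINT y|M2. g y)"
proof -
  interpret M1: sigma_finite_measure M1 by fact
  interpret M2: sigma_finite_measure M2 by fact
  interpret pair_sigma_finite M1 M2 ..
  have [measurable]: "f \<in> borel_measurable M1" "g \<in> borel_measurable M2" using f g by auto
  show *: "integrable (M1 \<Otimes>\<^sub>M M2) (\<lambda>(x,y). f x * g y)"
  proof (subst integrable_iff_bounded, intro conjI)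
    have "(\<integral>\<^sup>+p. ennreal (norm (case p of (x,y) \<Rightarrow> f x * g y)) \<partial>(M1 \<Otimes>\<^sub>M M2)) =
      (\<integral>\<^sup>+x. ennreal (norm (f x)) * (\<integral>\<^sup>+y. ennreal (norm (g y)) \<partial>M2) \<partial>M1)"
      by (subst M2.nn_integral_fst[symmetric])
         (auto simp: norm_mult ennreal_mult nn_integral_cmult split_beta)
    also have "\<dots> = (\<integral>\<^sup>+x. ennreal (norm (f x)) \<partial>M1) * (\<integral>\<^sup>+y. ennreal (norm (g y)) \<partial>M2)"
      by (simp add: nn_integral_multc)
    also have "\<dots> < \<infinity>" using f g by (simp add: integrable_iff_bounded ennreal_mult_less_top)
    finally show "(\<integral>\<^sup>+p. ennreal (norm (case p of (x,y) \<Rightarrow> f x * g y)) \<partial>(M1 \<Otimes>\<^sub>M M2)) < \<infinity>" .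
  qed measurable
  show "(LINT p|(M1 \<Otimes>\<^sub>M M2). f (fst p) * g (snd p)) = (LINT x|M1. f x) * (LINT y|M2. g y)"
    using integral_fst'[of "\<lambda>(x,y). f x * g y"] * by (simp add: case_prod_beta')
qed

lemma integral_lborel_prod_Basis:
  fixes f :: "'a::euclidean_space \<Rightarrow> real \<Rightarrow> complex"
  assumes i: "\<And>b. b \<in> Basis \<Longrightarrow> integrable lborel (f b)"
  shows "(LINT x|lborel. (\<Prod>b\<in>Basis. f b (x \<bullet> b))) = (\<Prod>b\<in>Basis. (LINT x|lborel. f b x))"
proof -
  interpret product_sigma_finite "\<lambda>b::'a. lborel :: real measure" ..
  have [measurable]: "\<And>b. b \<in> Basis \<Longrightarrow> f b \<in> borel_measurable borel" using i by auto
  have "(LINT x|lborel. (\<Prod>b\<in>Basis. f b (x \<bullet> b))) = (LINT x|(\<Pi>\<^sub>M b\<in>(Basis::'a set). lborel). (\<Prod>b\<in>Basis. f b (x b)))"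
    by (subst lborel_eq, subst integral_distr) (auto simp: inner_sum_left_Basis intro!: Bochner_Integration.integral_cong prod.cong)
  also have "\<dots> = (\<Prod>b\<in>Basis. (LINT x|lborel. f b x))"
    by (rule product_integral_prod[OF finite_Basis i])
  finally show ?thesis .
qed

section \<open>Gaussian densities and their Fourier transforms\<close>

definition gauss :: "real \<Rightarrow> 'a::euclidean_space \<Rightarrow> real" where
  "gauss \<sigma> x = (\<Prod>b\<in>Basis. normal_density 0 \<sigma> (x \<bullet> b))"

lemma gauss_nonneg [simp]: "0 \<le> gauss \<sigma> x"
  by (simp add: gauss_def prod_nonneg)

lemma gauss_measurable [measurable]: "gauss \<sigma> \<in> borel_measurable borel"
  unfolding gauss_def by measurable

lemma nn_integral_normal_density: "\<sigma> > 0 \<Longrightarrow> (\<integral>\<^sup>+x. ennreal (normal_density 0 \<sigma> x) \<partial>lborel) = 1"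
  using prob_space.emeasure_space_1[OF prob_space_normal_density[of \<sigma> 0]]
  by (simp add: emeasure_density)

lemma nn_integral_gauss: "\<sigma> > 0 \<Longrightarrow> (\<integral>\<^sup>+x. ennreal (gauss \<sigma> (x::'a::euclidean_space)) \<partial>lborel) = 1"
  using nn_integral_lborel_prod[of "\<lambda>_ x. ennreal (normal_density 0 \<sigma> x)"]
  by (simp add: gauss_def prod_ennreal nn_integral_normal_density)

lemma integrable_gauss: "\<sigma> > 0 \<Longrightarrow> integrable lborel (gauss \<sigma> :: 'a::euclidean_space \<Rightarrow> real)"
  by (simp add: integrable_iff_bounded nn_integral_gauss)

lemma integral_gauss: "\<sigma> > 0 \<Longrightarrow> (LINT x|lborel. gauss \<sigma> (x :: 'a::euclidean_space)) = 1"
  by (subst integral_eq_nn_integral) (auto simp: nn_integral_gauss)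

lemma gauss_exp: "\<sigma> > 0 \<Longrightarrow>
  gauss \<sigma> (x::'a::euclidean_space) = (1 / (sqrt (2*pi) * \<sigma>))^DIM('a) * exp (- (norm x)\<^sup>2 / (2 * \<sigma>\<^sup>2))"
  unfolding gauss_def normal_density_def
  by (simp add: prod.distrib exp_sum[symmetric] norm_eq_sqrt_inner euclidean_inner[of x x] power2_eq_square
       real_sqrt_mult power_divide sum_nonneg sum_divide_distrib[symmetric] sum_negf prod_dividef)

lemma gauss_even [simp]: "gauss \<sigma> (- x) = gauss \<sigma> x"
  by (simp add: gauss_def normal_density_def)

lemma gauss_minus_commute: "gauss \<sigma> (x - y) = gauss \<sigma> (y - x)"
  using gauss_even[of \<sigma> "x - y"] by simp

text \<open>Rescaling by n reduces the integral to the characteristic function of the standard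
  normal distribution. A damping factor of width n has a transform of width 1/n, so as the damping
  is removed the transform becomes an approximate identity.\<close>

lemma fourier_normal_1d:
  fixes x n :: real assumes n: "n > 0"
  shows "(LINT \<xi>|lborel. exp (\<i> * complex_of_real (x * \<xi>)) * complex_of_real (exp (- \<xi>\<^sup>2 / (2 * n\<^sup>2)))) =
    complex_of_real (2 * pi * normal_density 0 (1/n) x)"
    and "integrable lborel (\<lambda>\<xi>. complex_of_real (exp (- \<xi>\<^sup>2 / (2 * n\<^sup>2))))"
proof -
  have nd: "exp (- \<xi>\<^sup>2 / (2 * n\<^sup>2)) = (sqrt (2*pi) * n) * normal_density 0 n \<xi>" for \<xi>
    using n by (simp add: normal_density_def real_sqrt_mult)
  have "integrable lborel (normal_density 0 n)" using n by (rule integrable_normal_density)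
  then have i: "integrable lborel (\<lambda>\<xi>. (sqrt (2*pi) * n) * normal_density 0 n \<xi>)" by simp
  then show "integrable lborel (\<lambda>\<xi>. complex_of_real (exp (- \<xi>\<^sup>2 / (2 * n\<^sup>2))))"
    unfolding nd by (rule integrable_of_real)
  have "(LINT \<xi>|lborel. exp (\<i> * complex_of_real (x * \<xi>)) * complex_of_real (exp (- \<xi>\<^sup>2 / (2 * n\<^sup>2))))
    = n *\<^sub>R (LINT \<xi>|lborel. exp (\<i> * complex_of_real (x * (n * \<xi>))) * complex_of_real (exp (- (n*\<xi>)\<^sup>2 / (2 * n\<^sup>2))))"
    by (subst integral_scale[where c=n and t=0]) (use n in auto)
  also have "(\<lambda>\<xi>. exp (\<i> * complex_of_real (x * (n * \<xi>))) * complex_of_real (exp (- (n*\<xi>)\<^sup>2 / (2 * n\<^sup>2)))) =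
     (\<lambda>\<xi>. sqrt (2 * pi) *\<^sub>R (std_normal_density \<xi> *\<^sub>R iexp ((x * n) * \<xi>)))"
    using n by (auto simp: fun_eq_iff std_normal_density_def power_mult_distrib scaleR_conv_of_real mult_ac)
  also have "(LINT \<xi>|lborel. sqrt (2 * pi) *\<^sub>R (std_normal_density \<xi> *\<^sub>R iexp ((x * n) * \<xi>))) =
     sqrt (2 * pi) *\<^sub>R char std_normal_distribution (x * n)"
    unfolding char_def by (subst integral_scaleR_right, subst integral_density) (auto simp: normal_density_nonneg)
  also have "n *\<^sub>R \<dots> = complex_of_real (2 * pi * normal_density 0 (1/n) x)"
  proof -
    have "n * (sqrt (2*pi) * exp (- (x*n)\<^sup>2 / 2)) = 2 * pi * normal_density 0 (1/n) x"
      using n real_sqrt_pow2[of "2*pi"]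
      by (simp add: normal_density_def real_sqrt_mult real_sqrt_divide field_simps power2_eq_square del: real_sqrt_pow2)
    then show ?thesis
      by (simp add: char_std_normal_distribution scaleR_conv_of_real flip: of_real_mult)
  qed
  finally show "(LINT \<xi>|lborel. exp (\<i> * complex_of_real (x * \<xi>)) * complex_of_real (exp (- \<xi>\<^sup>2 / (2 * n\<^sup>2)))) =
    complex_of_real (2 * pi * normal_density 0 (1/n) x)" .
qed

lemma exp_norm_prod:
  "exp (- (norm (\<xi>::'a::euclidean_space))\<^sup>2 / (2 * n\<^sup>2)) = (\<Prod>b\<in>Basis. exp (- (\<xi>\<bullet>b)\<^sup>2 / (2 * n\<^sup>2)))"
  unfolding exp_sum[OF finite_Basis, symmetric] power2_norm_eq_inner euclidean_inner[of \<xi> \<xi>]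
  by (simp add: sum_divide_distrib sum_negf power2_eq_square)

lemma fourier_gauss:
  fixes x :: "'a::euclidean_space" assumes n: "n > 0"
  shows "(LINT \<xi>|lborel. exp (\<i> * complex_of_real (x \<bullet> \<xi>)) * complex_of_real (exp (- (norm \<xi>)\<^sup>2 / (2 * n\<^sup>2)))) =
    complex_of_real ((2 * pi)^DIM('a) * gauss (1/n) x)"
proof -
  have "(LINT \<xi>|lborel. exp (\<i> * complex_of_real (x \<bullet> \<xi>)) * complex_of_real (exp (- (norm \<xi>)\<^sup>2 / (2 * n\<^sup>2)))) =
    (LINT \<xi>|lborel. (\<Prod>b\<in>Basis. exp (\<i> * complex_of_real ((x\<bullet>b) * (\<xi>\<bullet>b))) * complex_of_real (exp (- (\<xi>\<bullet>b)\<^sup>2 / (2 * n\<^sup>2)))))"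
  proof -
    have "exp (\<i> * complex_of_real (x \<bullet> \<xi>)) = (\<Prod>b\<in>Basis. exp (\<i> * complex_of_real ((x\<bullet>b) * (\<xi>\<bullet>b))))" for \<xi>
      unfolding exp_sum[OF finite_Basis, symmetric] by (subst euclidean_inner) (simp add: sum_distrib_left)
    then show ?thesis unfolding exp_norm_prod of_real_prod prod.distrib by simp
  qed
  also have "\<dots> = (\<Prod>b\<in>Basis. (LINT \<xi>|lborel. exp (\<i> * complex_of_real ((x\<bullet>b) * \<xi>)) * complex_of_real (exp (- \<xi>\<^sup>2 / (2 * n\<^sup>2)))))"
  proof (rule integral_lborel_prod_Basis)
    fix b :: 'a
    show "integrable lborel (\<lambda>\<xi>. exp (\<i> * complex_of_real ((x\<bullet>b) * \<xi>)) * complex_of_real (exp (- \<xi>\<^sup>2 / (2 * n\<^sup>2))))"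
      by (rule Bochner_Integration.integrable_bound[OF fourier_normal_1d(2)[OF n]]) (auto simp: norm_mult)
  qed
  also have "\<dots> = (\<Prod>b\<in>Basis. complex_of_real (2 * pi * normal_density 0 (1/n) (x\<bullet>b)))"
    by (simp only: fourier_normal_1d(1)[OF n])
  also have "\<dots> = complex_of_real ((2 * pi)^DIM('a) * gauss (1/n) x)"
    unfolding of_real_prod[symmetric] by (simp add: prod.distrib gauss_def power_mult_distrib)
  finally show ?thesis .
qed

lemma integrable_exp_norm:
  assumes n: "n > 0"
  shows "integrable lborel (\<lambda>\<xi>::'a::euclidean_space. exp (- (norm \<xi>)\<^sup>2 / (2 * n\<^sup>2)))"
proof -
  have "integrable lborel (\<lambda>\<xi>::'a. (sqrt (2*pi) * n)^DIM('a) * gauss n \<xi>)"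
    by (intro integrable_mult_right integrable_gauss n)
  also have "(\<lambda>\<xi>::'a. (sqrt (2*pi) * n)^DIM('a) * gauss n \<xi>) = (\<lambda>\<xi>. exp (- (norm \<xi>)\<^sup>2 / (2 * n\<^sup>2)))"
  proof
    fix \<xi> :: 'a
    have *: "c^k * ((1/c)^k * e) = e" if "c \<noteq> 0" for c e :: real and k :: nat
      using that by (simp add: power_one_over)
    show "(sqrt (2*pi) * n)^DIM('a) * gauss n \<xi> = exp (- (norm \<xi>)\<^sup>2 / (2 * n\<^sup>2))"
      unfolding gauss_exp[OF n] by (rule *) (use n in auto)
  qed
  finally show ?thesis .
qed


section \<open>Fourier integrals and the Gaussian-regularised Plancherel identity\<close>

lemma measurable_fourier_integral [measurable (raw)]:
  fixes u :: "'a::euclidean_space \<Rightarrow> complex"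
  assumes [measurable]: "u \<in> borel_measurable borel"
  shows "fourier_integral u \<in> borel_measurable borel"
  unfolding fourier_integral_def by measurable

lemma integrable_fourier:
  fixes u :: "'a::euclidean_space \<Rightarrow> complex"
  assumes u: "integrable lborel u"
  shows "integrable lborel (\<lambda>x. exp (- (\<i> * complex_of_real (x \<bullet> \<xi>))) * u x)"
  by (rule Bochner_Integration.integrable_bound[OF u]) (use u in \<open>auto simp: norm_mult\<close>)

lemma fourier_integral_diff:
  fixes u v :: "'a::euclidean_space \<Rightarrow> complex"
  assumes "integrable lborel u" "integrable lborel v"
  shows "fourier_integral (\<lambda>x. u x - v x) \<xi> = fourier_integral u \<xi> - fourier_integral v \<xi>"
  using integrable_fourier[OF assms(1)] integrable_fourier[OF assms(2)]
  by (simp add: fourier_integral_def right_diff_distrib)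

text \<open>The squared norm of u with its diagonal smeared out to width 1/n;
  \<open>gauss_form_tendsto\<close> recovers \<open>(l2norm u)\<^sup>2\<close> from it.\<close>

definition gauss_form :: "nat \<Rightarrow> ('a::euclidean_space \<Rightarrow> complex) \<Rightarrow> complex" where
  "gauss_form n u = (LINT p|lborel. (u (fst p) * cnj (u (snd p))) * complex_of_real (gauss (1 / real n) (fst p - snd p)))"

lemma integrable_pair_cnj:
  fixes u :: "'a::euclidean_space \<Rightarrow> complex"
  assumes u: "integrable lborel u"
  shows "integrable lborel (\<lambda>p. u (fst p) * cnj (u (snd p)))"
  using integrable_pair_mult(1)[OF lborel.sigma_finite_measure_axioms lborel.sigma_finite_measure_axioms u
     Bochner_Integration.integrable_cnj[OF u]]
  by (simp add: lborel_prod case_prod_beta')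

text \<open>The squared modulus of the transform is a double integral over x and y. The damping
  makes the triple integral absolutely convergent, so the frequency may be integrated out first,
  which leaves the Gaussian in x - y.\<close>

lemma fourier_gauss_form:
  fixes u :: "'a::euclidean_space \<Rightarrow> complex"
  assumes u: "integrable lborel u" and n: "n > 0"
  shows "(LINT \<xi>|lborel. complex_of_real (exp (- (norm \<xi>)\<^sup>2 / (2 * (real n)\<^sup>2)) * (cmod (fourier_integral u \<xi>))\<^sup>2)) =
     (2 * pi)^DIM('a) * gauss_form n u"
    and "integrable lborel (\<lambda>\<xi>. exp (- (norm \<xi>)\<^sup>2 / (2 * (real n)\<^sup>2)) * (cmod (fourier_integral u \<xi>))\<^sup>2)"
proof -
  have [measurable]: "u \<in> borel_measurable borel" using u by auto
  let ?t = "\<lambda>\<xi>::'a. complex_of_real (exp (- (norm \<xi>)\<^sup>2 / (2 * (real n)\<^sup>2)))"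
  let ?U = "\<lambda>p. u (fst p) * cnj (u (snd p))"
  let ?F = "\<lambda>\<xi> p. exp (- (\<i> * complex_of_real ((fst p - snd p) \<bullet> \<xi>))) * (?t \<xi> * ?U p)"
  have it: "integrable lborel ?t" using n integrable_exp_norm[of "real n"] by (intro integrable_of_real) auto
  have iU: "integrable lborel ?U" by (rule integrable_pair_cnj[OF u])
  have "integrable (lborel \<Otimes>\<^sub>M lborel) (\<lambda>(\<xi>, p). ?t \<xi> * ?U p)"
    by (rule integrable_pair_mult(1)[OF lborel.sigma_finite_measure_axioms lborel.sigma_finite_measure_axioms it iU])
  then have iF: "integrable (lborel \<Otimes>\<^sub>M lborel) (\<lambda>(\<xi>, p). ?F \<xi> p)"
    by (rule Bochner_Integration.integrable_bound) (auto simp: norm_mult)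
  have sq: "complex_of_real ((cmod (fourier_integral u \<xi>))\<^sup>2) = (LINT p|lborel. exp (- (\<i> * complex_of_real ((fst p - snd p) \<bullet> \<xi>))) * ?U p)" for \<xi>
  proof -
    let ?e = "\<lambda>x. exp (- (\<i> * complex_of_real (x \<bullet> \<xi>))) * u x"
    have ie: "integrable lborel ?e" by (rule integrable_fourier[OF u])
    have "complex_of_real ((cmod (fourier_integral u \<xi>))\<^sup>2) = (LINT x|lborel. ?e x) * (LINT x|lborel. cnj (?e x))"
      unfolding complex_norm_square Bochner_Integration.integral_cnj fourier_integral_def ..
    also have "\<dots> = (LINT p|(lborel \<Otimes>\<^sub>M lborel). ?e (fst p) * cnj (?e (snd p)))"
      by (rule integrable_pair_mult(2)[OF lborel.sigma_finite_measure_axioms lborel.sigma_finite_measure_axioms ie, symmetric])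
         (rule Bochner_Integration.integrable_cnj[OF ie])
    also have "\<dots> = (LINT p|lborel. exp (- (\<i> * complex_of_real ((fst p - snd p) \<bullet> \<xi>))) * ?U p)"
    proof -
      have r: "(a * b) * (c * d) = (a * c) * (b * d)" for a b c d :: complex by simp
      have e: "exp (- (\<i> * complex_of_real a)) * cnj (exp (- (\<i> * complex_of_real b))) = exp (- (\<i> * complex_of_real (a - b)))" for a b
        unfolding exp_cnj exp_add[symmetric] by (simp add: algebra_simps)
      have "?e x * cnj (?e y) = exp (- (\<i> * complex_of_real ((x - y) \<bullet> \<xi>))) * (u x * cnj (u y))" for x y
        unfolding complex_cnj_mult inner_diff_left by (subst r) (simp only: e)
      then show ?thesis unfolding lborel_prod by (intro Bochner_Integration.integral_cong refl)
    qed
    finally show ?thesis .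
  qed
  have *: "complex_of_real (exp (- (norm \<xi>)\<^sup>2 / (2 * (real n)\<^sup>2)) * (cmod (fourier_integral u \<xi>))\<^sup>2) = (LINT p|lborel. ?F \<xi> p)" for \<xi>
  proof -
    have "complex_of_real (exp (- (norm \<xi>)\<^sup>2 / (2 * (real n)\<^sup>2)) * (cmod (fourier_integral u \<xi>))\<^sup>2)
      = ?t \<xi> * (LINT p|lborel. exp (- (\<i> * complex_of_real ((fst p - snd p) \<bullet> \<xi>))) * ?U p)"
      unfolding of_real_mult sq ..
    also have "\<dots> = (LINT p|lborel. ?t \<xi> * (exp (- (\<i> * complex_of_real ((fst p - snd p) \<bullet> \<xi>))) * ?U p))"
      by simp
    also have "\<dots> = (LINT p|lborel. ?F \<xi> p)" by (intro Bochner_Integration.integral_cong refl mult.left_commute)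
    finally show ?thesis .
  qed
  have "integrable lborel (\<lambda>\<xi>. LINT p|lborel. ?F \<xi> p)"
    using lborel_pair.integrable_fst'[OF iF] by simp
  then have "integrable lborel (\<lambda>\<xi>. complex_of_real (exp (- (norm \<xi>)\<^sup>2 / (2 * (real n)\<^sup>2)) * (cmod (fourier_integral u \<xi>))\<^sup>2))"
    unfolding * .
  then show "integrable lborel (\<lambda>\<xi>. exp (- (norm \<xi>)\<^sup>2 / (2 * (real n)\<^sup>2)) * (cmod (fourier_integral u \<xi>))\<^sup>2)"
    by (simp only: complex_of_real_integrable_eq)
  have "(LINT \<xi>|lborel. complex_of_real (exp (- (norm \<xi>)\<^sup>2 / (2 * (real n)\<^sup>2)) * (cmod (fourier_integral u \<xi>))\<^sup>2))
     = (LINT \<xi>|lborel. LINT p|lborel. ?F \<xi> p)" unfolding * ..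
  also have "\<dots> = (LINT p|lborel. LINT \<xi>|lborel. ?F \<xi> p)"
    by (rule lborel_pair.Fubini_integral[OF iF, symmetric])
  also have "\<dots> = (LINT p|lborel. (2 * pi)^DIM('a) * (?U p * complex_of_real (gauss (1 / real n) (fst p - snd p))))"
  proof (intro Bochner_Integration.integral_cong refl)
    fix p :: "'a \<times> 'a"
    have "(LINT \<xi>|lborel. ?F \<xi> p) = (LINT \<xi>|lborel. ?U p * (exp (\<i> * complex_of_real ((snd p - fst p) \<bullet> \<xi>)) * ?t \<xi>))"
      by (intro Bochner_Integration.integral_cong) (auto simp: inner_diff_left algebra_simps)
    also have "\<dots> = ?U p * (LINT \<xi>|lborel. exp (\<i> * complex_of_real ((snd p - fst p) \<bullet> \<xi>)) * ?t \<xi>)"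
      by simp
    also have "\<dots> = (2 * pi)^DIM('a) * (?U p * complex_of_real (gauss (1 / real n) (fst p - snd p)))"
      using n by (subst fourier_gauss) (auto simp: gauss_minus_commute[of _ "fst p"])
    finally show "(LINT \<xi>|lborel. ?F \<xi> p) = (2 * pi)^DIM('a) * (?U p * complex_of_real (gauss (1 / real n) (fst p - snd p)))" .
  qed
  also have "\<dots> = (2 * pi)^DIM('a) * gauss_form n u"
    unfolding gauss_form_def by simp
  finally show "(LINT \<xi>|lborel. complex_of_real (exp (- (norm \<xi>)\<^sup>2 / (2 * (real n)\<^sup>2)) * (cmod (fourier_integral u \<xi>))\<^sup>2)) =
     (2 * pi)^DIM('a) * gauss_form n u" .
qed

text \<open>Bound the product \<open>u x * u y\<close> by half the sum of squares; the kernel has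
  mass one in either variable, so the estimate does not depend on n.\<close>

lemma gauss_form_integrable_bound:
  fixes u :: "'a::euclidean_space \<Rightarrow> complex"
  assumes u: "u \<in> L2" and n: "n > 0"
  shows "integrable lborel (\<lambda>p. (u (fst p) * cnj (u (snd p))) * complex_of_real (gauss (1 / real n) (fst p - snd p)))"
    and "cmod (gauss_form n u) \<le> (l2norm u)\<^sup>2"
proof -
  have [measurable]: "u \<in> borel_measurable borel" using u by auto
  let ?g = "gauss (1 / real n) :: 'a \<Rightarrow> real"
  let ?F = "\<lambda>p. (u (fst p) * cnj (u (snd p))) * complex_of_real (?g (fst p - snd p))"
  have g1: "(\<integral>\<^sup>+y. ennreal (?g (x - y)) \<partial>lborel) = 1" for x
    using nn_integral_reflect[of "\<lambda>y. ennreal (?g y)" x] n by (simp add: nn_integral_gauss)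
  then have g2: "(\<integral>\<^sup>+y. ennreal (?g (y - x)) \<partial>lborel) = 1" for x by (subst gauss_minus_commute) auto
  let ?G = "\<lambda>p. ennreal ((cmod (u (fst p)))\<^sup>2 * ?g (fst p - snd p))"
  let ?H = "\<lambda>p. ennreal ((cmod (u (snd p)))\<^sup>2 * ?g (fst p - snd p))"
  have G: "(\<integral>\<^sup>+p. ?G p \<partial>lborel) = ennreal ((l2norm u)\<^sup>2)"
    unfolding lborel_prod[symmetric]
    by (subst lborel.nn_integral_fst[symmetric])
       (auto simp: ennreal_mult nn_integral_cmult g1 nn_l2norm[OF u] lborel_prod)
  have H: "(\<integral>\<^sup>+p. ?H p \<partial>lborel) = ennreal ((l2norm u)\<^sup>2)"
    unfolding lborel_prod[symmetric]
    by (subst lborel_pair.nn_integral_snd[symmetric])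
       (auto simp: ennreal_mult nn_integral_cmult g2 nn_l2norm[OF u] lborel_prod)
  have "(\<integral>\<^sup>+p. ennreal (norm (?F p)) \<partial>lborel) \<le> (\<integral>\<^sup>+p. ennreal (1/2) * (?G p + ?H p) \<partial>lborel)"
  proof (intro nn_integral_mono)
    fix p :: "'a \<times> 'a"
    have "norm (?F p) = (cmod (u (fst p)) * cmod (u (snd p))) * ?g (fst p - snd p)"
      by (simp add: norm_mult)
    also have "\<dots> \<le> (1/2 * ((cmod (u (fst p)))\<^sup>2 + (cmod (u (snd p)))\<^sup>2)) * ?g (fst p - snd p)"
      using sum_squares_bound[of "cmod (u (fst p))" "cmod (u (snd p))"]
      by (intro mult_right_mono) auto
    finally have "ennreal (norm (?F p)) \<le> ennreal (1/2 * ((cmod (u (fst p)))\<^sup>2 * ?g (fst p - snd p) + (cmod (u (snd p)))\<^sup>2 * ?g (fst p - snd p)))"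
      by (intro ennreal_leI) (simp add: algebra_simps)
    then show "ennreal (norm (?F p)) \<le> ennreal (1/2) * (?G p + ?H p)"
      by (subst (asm) ennreal_mult) (auto simp: ennreal_plus)
  qed
  also have "\<dots> = ennreal (1/2) * (ennreal ((l2norm u)\<^sup>2) + ennreal ((l2norm u)\<^sup>2))"
    by (subst nn_integral_cmult, simp, subst nn_integral_add) (auto simp: G H)
  also have "\<dots> = ennreal ((l2norm u)\<^sup>2)"
    using ennreal_mult'[of "1/2" "(l2norm u)\<^sup>2 + (l2norm u)\<^sup>2"] ennreal_plus[of "(l2norm u)\<^sup>2" "(l2norm u)\<^sup>2"]
    by (simp del: ennreal_plus ennreal_half)
  finally have *: "(\<integral>\<^sup>+p. ennreal (norm (?F p)) \<partial>lborel) \<le> ennreal ((l2norm u)\<^sup>2)" .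
  then show i: "integrable lborel ?F"
    by (intro integrableI_bounded) (auto intro: le_less_trans)
  have "ennreal (cmod (gauss_form n u)) \<le> ennreal ((l2norm u)\<^sup>2)"
    unfolding gauss_form_def by (rule order_trans[OF integral_norm_bound_ennreal[OF i] *])
  then show "cmod (gauss_form n u) \<le> (l2norm u)\<^sup>2" by (simp add: ennreal_le_iff)
qed

lemma exp_damping_tendsto: "(\<lambda>n. exp (- c / (2 * (real (Suc n))\<^sup>2))) \<longlonglongrightarrow> 1"
proof -
  have "(\<lambda>n. (- c / 2) * (inverse (real (Suc n)))\<^sup>2) \<longlonglongrightarrow> (- c / 2) * 0\<^sup>2"
    by (intro tendsto_intros LIMSEQ_inverse_real_of_nat)
  then have "(\<lambda>n. exp ((- c / 2) * (inverse (real (Suc n)))\<^sup>2)) \<longlonglongrightarrow> exp ((- c / 2) * 0\<^sup>2)"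
    by (rule tendsto_exp)
  moreover have "(- c / 2) * (inverse r)\<^sup>2 = - c / (2 * r\<^sup>2)" for r :: real
    by (cases "r = 0") (simp_all add: field_simps)
  moreover have "exp ((- c / 2) * 0\<^sup>2) = 1" by simp
  ultimately show ?thesis by (simp only:)
qed

lemma exp_damping_mult_tendsto:
  "(\<lambda>n. exp (- c / (2 * (real (Suc n))\<^sup>2)) * x) \<longlonglongrightarrow> (x::real)"
  using tendsto_mult[OF exp_damping_tendsto tendsto_const, of c x] by (simp only: mult_1_left)

text \<open>Removing the damping by Fatou's lemma gives only an inequality. That inequality supplies
  the dominating function which later turns it into an equality.\<close>

lemma bessel:
  fixes u :: "'a::euclidean_space \<Rightarrow> complex"
  assumes u: "u \<in> L2" and i: "integrable lborel u"
  shows "fourier_integral u \<in> L2" "l2norm (fourier_integral u) \<le> sqrt ((2*pi)^DIM('a)) * l2norm u"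
proof -
  have [measurable]: "u \<in> borel_measurable borel" using u by auto
  let ?\<theta> = "\<lambda>n \<xi>. exp (- (norm \<xi>)\<^sup>2 / (2 * (real (Suc n))\<^sup>2)) * (cmod (fourier_integral u \<xi>))\<^sup>2"
  have b: "(\<integral>\<^sup>+\<xi>. ennreal (?\<theta> n \<xi>) \<partial>lborel) \<le> ennreal ((2*pi)^DIM('a) * (l2norm u)\<^sup>2)" for n
  proof -
    note F = fourier_gauss_form[OF i, of "Suc n"]
    have "complex_of_real (LINT \<xi>|lborel. ?\<theta> n \<xi>) = (2 * pi)^DIM('a) * gauss_form (Suc n) u"
      using F(1) by (simp only: integral_complex_of_real[symmetric])
    from arg_cong[OF this, of cmod] have "\<bar>LINT \<xi>|lborel. ?\<theta> n \<xi>\<bar> = (2 * pi)^DIM('a) * cmod (gauss_form (Suc n) u)"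
      using abs_of_nonneg[of "(2 * pi)^DIM('a)"] by (simp only: norm_mult norm_of_real) simp
    also have "\<dots> \<le> (2*pi)^DIM('a) * (l2norm u)\<^sup>2"
      by (intro mult_left_mono gauss_form_integrable_bound u) auto
    finally have "(LINT \<xi>|lborel. ?\<theta> n \<xi>) \<le> (2*pi)^DIM('a) * (l2norm u)\<^sup>2" by simp
    then show ?thesis using F(2) by (subst nn_integral_eq_integral) (auto intro: ennreal_leI)
  qed
  have "(\<integral>\<^sup>+\<xi>. ennreal ((cmod (fourier_integral u \<xi>))\<^sup>2) \<partial>lborel) \<le> ennreal ((2*pi)^DIM('a) * (l2norm u)\<^sup>2)"
    by (rule nn_integral_le_of_tendsto[OF _ AE_I2[OF exp_damping_mult_tendsto] always_eventually[OF allI[OF b]]]) measurable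
  also have "\<dots> = ennreal ((sqrt ((2*pi)^DIM('a)) * l2norm u)\<^sup>2)"
    by (simp add: power_mult_distrib)
  finally have *: "(\<integral>\<^sup>+\<xi>. ennreal ((cmod (fourier_integral u \<xi>))\<^sup>2) \<partial>lborel) \<le> ennreal ((sqrt ((2*pi)^DIM('a)) * l2norm u)\<^sup>2)" .
  show "fourier_integral u \<in> L2" "l2norm (fourier_integral u) \<le> sqrt ((2*pi)^DIM('a)) * l2norm u"
    using L2_I_nn[OF _ *] by auto
qed

lemma gauss_rescale:
  assumes n: "n > 0"
  shows "(1 / real n)^DIM('a) * gauss (1 / real n) ((1 / real n) *\<^sub>R (z::'a::euclidean_space)) = gauss 1 z"
proof -
  have "(1 / real n)^DIM('a) * gauss (1 / real n) ((1 / real n) *\<^sub>R z) =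
     ((1 / real n) * (1 / (sqrt (2*pi) * (1 / real n))))^DIM('a) * exp (- (norm ((1 / real n) *\<^sub>R z))\<^sup>2 / (2 * (1 / real n)\<^sup>2))"
    using n by (subst gauss_exp) (auto simp only: power_mult_distrib mult.assoc of_nat_0_less_iff zero_less_divide_1_iff)
  also have "(1 / real n) * (1 / (sqrt (2*pi) * (1 / real n))) = 1 / (sqrt (2*pi) * 1)" using n by simp
  also have "(norm ((1 / real n) *\<^sub>R z))\<^sup>2 = (1 / real n)\<^sup>2 * (norm z)\<^sup>2" by (simp add: power_mult_distrib power_divide)
  also have "- ((1 / real n)\<^sup>2 * (norm z)\<^sup>2) / (2 * (1 / real n)\<^sup>2) = - (norm z)\<^sup>2 / (2 * 1\<^sup>2)" using n by (simp add: power_divide)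
  finally show ?thesis by (subst gauss_exp) auto
qed

text \<open>The substitution x = y + z/n moves n from the kernel into the argument of v. Continuity
  then gives the pointwise limit; boundedness of v dominates the integral in z, and its
  integrability the integral in y.\<close>

lemma gauss_form_tendsto:
  fixes v :: "'a::euclidean_space \<Rightarrow> complex"
  assumes v: "v \<in> L2" and i: "integrable lborel v" and c: "continuous_on UNIV v" and B: "\<And>x. cmod (v x) \<le> B"
  shows "(\<lambda>n. gauss_form (Suc n) v) \<longlonglongrightarrow> complex_of_real ((l2norm v)\<^sup>2)"
proof -
  have [measurable]: "v \<in> borel_measurable borel" using v by auto
  define \<phi> where "\<phi> n y = (LINT z|lborel. v (y + (1 / real n) *\<^sub>R z) * cnj (v y) * complex_of_real (gauss 1 z))" for n y
  have B0: "0 \<le> B" using order_trans[OF norm_ge_zero B] .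
  have ig: "integrable lborel (\<lambda>z::'a. B * B * gauss 1 z)" by (intro integrable_mult_right integrable_gauss) auto
  have eq: "gauss_form (Suc n) v = (LINT y|lborel. \<phi> (Suc n) y)" for n
  proof -
    let ?g = "gauss (1 / real (Suc n)) :: 'a \<Rightarrow> real"
    have I: "integrable (lborel \<Otimes>\<^sub>M lborel) (\<lambda>(x,y). (v x * cnj (v y)) * complex_of_real (?g (x - y)))"
      using gauss_form_integrable_bound(1)[OF v, of "Suc n"] by (simp add: lborel_prod case_prod_beta')
    have "gauss_form (Suc n) v = (LINT y|lborel. LINT x|lborel. (v x * cnj (v y)) * complex_of_real (?g (x - y)))"
      using lborel_pair.integral_snd[OF I] unfolding gauss_form_def lborel_prod case_prod_beta' by simp
    also have "\<dots> = (LINT y|lborel. \<phi> (Suc n) y)"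
    proof (intro Bochner_Integration.integral_cong refl)
      fix y
      have "(LINT x|lborel. (v x * cnj (v y)) * complex_of_real (?g (x - y))) =
        \<bar>1 / real (Suc n)\<bar>^DIM('a) *\<^sub>R (LINT z|lborel. (v (y + (1 / real (Suc n)) *\<^sub>R z) * cnj (v y)) * complex_of_real (?g ((1 / real (Suc n)) *\<^sub>R z)))"
        by (subst integral_scale[where c="1 / real (Suc n)" and t=y]) auto
      also have "\<dots> = (LINT z|lborel. \<bar>1 / real (Suc n)\<bar>^DIM('a) *\<^sub>R ((v (y + (1 / real (Suc n)) *\<^sub>R z) * cnj (v y)) * complex_of_real (?g ((1 / real (Suc n)) *\<^sub>R z))))"
        by (rule integral_scaleR_right[symmetric])
      also have "\<dots> = \<phi> (Suc n) y"
        unfolding \<phi>_def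
      proof (intro Bochner_Integration.integral_cong refl)
        fix z :: 'a
        have "\<bar>1 / real (Suc n)\<bar>^DIM('a) *\<^sub>R ((v (y + (1 / real (Suc n)) *\<^sub>R z) * cnj (v y)) * complex_of_real (?g ((1 / real (Suc n)) *\<^sub>R z)))
          = (v (y + (1 / real (Suc n)) *\<^sub>R z) * cnj (v y)) * complex_of_real ((1 / real (Suc n))^DIM('a) * ?g ((1 / real (Suc n)) *\<^sub>R z))"
          by (simp only: scaleR_conv_of_real of_real_mult abs_of_nonneg of_nat_0_le_iff zero_le_divide_1_iff mult.left_commute)
        then show "\<bar>1 / real (Suc n)\<bar>^DIM('a) *\<^sub>R ((v (y + (1 / real (Suc n)) *\<^sub>R z) * cnj (v y)) * complex_of_real (?g ((1 / real (Suc n)) *\<^sub>R z)))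
          = v (y + (1 / real (Suc n)) *\<^sub>R z) * cnj (v y) * complex_of_real (gauss 1 z)"
          using gauss_rescale[of "Suc n" z] by (simp only: zero_less_Suc)
      qed
      finally show "(LINT x|lborel. (v x * cnj (v y)) * complex_of_real (?g (x - y))) = \<phi> (Suc n) y" .
    qed
    finally show ?thesis .
  qed
  have vlim: "(\<lambda>n. v (y + (1 / real (Suc n)) *\<^sub>R z)) \<longlonglongrightarrow> v y" for y z
  proof -
    have "(\<lambda>n. y + inverse (real (Suc n)) *\<^sub>R z) \<longlonglongrightarrow> y + 0 *\<^sub>R z"
      by (intro tendsto_intros LIMSEQ_inverse_real_of_nat)
    then have "(\<lambda>n. y + (1 / real (Suc n)) *\<^sub>R z) \<longlonglongrightarrow> y" by (simp add: inverse_eq_divide)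
    then show ?thesis using c by (auto simp: continuous_on_eq_continuous_at intro: isCont_tendsto_compose)
  qed
  have lim\<phi>: "(\<lambda>n. \<phi> (Suc n) y) \<longlonglongrightarrow> cnj (v y) * v y" for y
  proof -
    have "(\<lambda>n. \<phi> (Suc n) y) \<longlonglongrightarrow> (LINT z|lborel. v y * cnj (v y) * complex_of_real (gauss 1 (z::'a)))"
      unfolding \<phi>_def
    proof (rule integral_dominated_convergence[OF _ _ ig])
      show "AE z in lborel. (\<lambda>n. v (y + (1 / real (Suc n)) *\<^sub>R z) * cnj (v y) * complex_of_real (gauss 1 z)) \<longlonglongrightarrow> v y * cnj (v y) * complex_of_real (gauss 1 z)"
        by (intro AE_I2 tendsto_intros vlim)
      show "AE z in lborel. norm (v (y + (1 / real (Suc n)) *\<^sub>R z) * cnj (v y) * complex_of_real (gauss 1 z)) \<le> B * B * gauss 1 z" for n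
        by (auto simp: norm_mult intro!: mult_right_mono mult_mono B B0)
    qed auto
    also have "(LINT z|lborel. v y * cnj (v y) * complex_of_real (gauss 1 (z::'a))) = v y * cnj (v y) * complex_of_real (LINT z|lborel. gauss 1 (z::'a))"
      by (simp only: integral_mult_right_zero integral_complex_of_real)
    finally show ?thesis by (simp add: integral_gauss mult.commute)
  qed
  have \<phi>m[measurable]: "\<phi> n \<in> borel_measurable borel" for n unfolding \<phi>_def by measurable
  have "(\<lambda>n. LINT y|lborel. \<phi> (Suc n) y) \<longlonglongrightarrow> (LINT y|lborel. cnj (v y) * v y)"
  proof (rule integral_dominated_convergence[where w="\<lambda>y. B * cmod (v y)"])
    show "integrable lborel (\<lambda>y. B * cmod (v y))" using i by simp
    show "AE y in lborel. norm (\<phi> (Suc n) y) \<le> B * cmod (v y)" for n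
    proof (intro AE_I2)
      fix y
      have ii: "integrable lborel (\<lambda>z::'a. B * cmod (v y) * gauss 1 z)" by (intro integrable_mult_right integrable_gauss) auto
      have bb: "norm (v (y + (1 / real (Suc n)) *\<^sub>R z) * cnj (v y) * complex_of_real (gauss 1 z)) \<le> B * cmod (v y) * gauss 1 z" for z
        by (auto simp: norm_mult intro!: mult_right_mono B)
      have "norm (\<phi> (Suc n) y) \<le> (LINT z|lborel. B * cmod (v y) * gauss 1 (z::'a))"
        unfolding \<phi>_def
        by (rule Bochner_Integration.integral_norm_bound_integral[OF _ ii bb], rule Bochner_Integration.integrable_bound[OF ii])
           (use bb B0 in \<open>auto simp: abs_mult intro: order_trans\<close>)
      then show "norm (\<phi> (Suc n) y) \<le> B * cmod (v y)" by (simp add: integral_gauss)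
    qed
  qed (use lim\<phi> in auto)
  then show ?thesis unfolding eq l2norm_sq_complex .
qed

section \<open>Density of bounded continuous integrable functions and Plancherel's theorem\<close>

lemma l2norm_dominated:
  fixes u :: "'a::euclidean_space \<Rightarrow> complex"
  assumes [measurable]: "\<And>n. U n \<in> borel_measurable borel" "u \<in> borel_measurable borel"
    and l: "AE x in lborel. (\<lambda>n::nat. U n x) \<longlonglongrightarrow> u x"
    and w: "integrable lborel w" "\<And>n. AE x in lborel. (cmod (U n x - u x))\<^sup>2 \<le> w x"
  shows "(\<lambda>n. l2norm (\<lambda>x. U n x - u x)) \<longlonglongrightarrow> 0"
proof -
  have "(\<lambda>n. LINT x|lborel. (cmod (U n x - u x))\<^sup>2) \<longlonglongrightarrow> (LINT (x::'a)|lborel. (0::real))"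
  proof (rule integral_dominated_convergence[where w=w])
    show "AE x in lborel. (\<lambda>n. (cmod (U n x - u x))\<^sup>2) \<longlonglongrightarrow> 0"
      using l
    proof eventually_elim
      case (elim x)
      have "(\<lambda>n. (cmod (U n x - u x))\<^sup>2) \<longlonglongrightarrow> (cmod (u x - u x))\<^sup>2"
        by (intro tendsto_intros elim)
      then show ?case by simp
    qed
  qed (use w in auto)
  then have "(\<lambda>n. sqrt (LINT x|lborel. (cmod (U n x - u x))\<^sup>2)) \<longlonglongrightarrow> sqrt 0"
    by (intro tendsto_real_sqrt) simp
  then show ?thesis by (simp add: l2norm_def)
qed

lemma L2_indicator_finite:
  assumes "A \<in> sets borel" "emeasure lborel A < \<infinity>"
  shows "(\<lambda>x::'a::euclidean_space. indicator A x :: complex) \<in> L2"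
proof -
  have "(\<lambda>x. ennreal ((cmod (indicator A x))\<^sup>2)) = indicator A"
    by (auto simp: indicator_def)
  then show ?thesis using assms by (simp add: L2_iff)
qed

lemma L2_bounded_support:
  assumes [measurable]: "v \<in> borel_measurable borel" and B: "\<And>x. cmod (v x) \<le> B" and R: "\<And>x. norm x > R \<Longrightarrow> v x = 0"
  shows "(v :: 'a::euclidean_space \<Rightarrow> complex) \<in> L2" "integrable lborel v"
proof -
  have c: "(\<lambda>x::'a. indicator (cball 0 R) x :: complex) \<in> L2"
    by (intro L2_indicator_finite emeasure_lborel_cball_finite) auto
  have "cmod (v x) \<le> B * cmod (indicator (cball 0 R) x)" for x
    using B[of x] R[of x] by (cases "norm x \<le> R") (auto simp: indicator_def dist_norm)
  then show v: "v \<in> L2" using order_trans[OF norm_ge_zero B] by (intro L2_mono(1)[OF c]) auto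
  have "integrable lborel (\<lambda>x. v x * indicator (cball 0 R) x)" by (rule L2_mult_integrable[OF v c])
  also have "(\<lambda>x. v x * indicator (cball 0 R) x) = v"
    using R by (auto simp: fun_eq_iff indicator_def dist_norm not_le)
  finally show "integrable lborel v" .
qed

lemma L2_approx_bounded:
  fixes u :: "'a::euclidean_space \<Rightarrow> complex"
  assumes u: "u \<in> L2" and e: "e > 0"
  obtains v and N :: nat where "v \<in> borel_measurable borel" "\<And>x. cmod (v x) \<le> real N" "\<And>x. norm x > real N \<Longrightarrow> v x = 0"
    "l2norm (\<lambda>x. v x - u x) < e"
proof -
  have [measurable]: "u \<in> borel_measurable borel" using u by auto
  define U where "U n x = (if norm x \<le> real n \<and> cmod (u x) \<le> real n then u x else 0)" for n x
  have [measurable]: "U n \<in> borel_measurable borel" for n unfolding U_def by measurable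
  have "(\<lambda>n. l2norm (\<lambda>x. U n x - u x)) \<longlonglongrightarrow> 0"
  proof (rule l2norm_dominated)
    show "AE x in lborel. (\<lambda>n. U n x) \<longlonglongrightarrow> u x"
    proof (intro AE_I2 tendsto_eventually)
      fix x
      obtain m where m: "max (norm x) (cmod (u x)) \<le> real m" using real_arch_simple by blast
      show "\<forall>\<^sub>F n in sequentially. U n x = u x"
        using eventually_ge_at_top[of m] by eventually_elim (use m in \<open>auto simp: U_def\<close>)
    qed
  qed (use L2_integrable[OF u] in \<open>auto simp: U_def\<close>)
  then have "\<forall>\<^sub>F n in sequentially. l2norm (\<lambda>x. U n x - u x) < e" using e by (rule order_tendstoD)
  then obtain N where N: "l2norm (\<lambda>x. U N x - u x) < e" by (auto simp: eventually_sequentially)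
  show ?thesis by (rule that[of "U N" N]) (use N in \<open>auto simp: U_def\<close>)
qed

text \<open>A measurable function is an almost everywhere limit of continuous ones. Clipping their
  values and cutting off their supports leaves the limit w unchanged, because w is bounded with
  bounded support, and makes the convergence dominated.\<close>

lemma L2_approx_continuous:
  fixes u :: "'a::euclidean_space \<Rightarrow> complex"
  assumes u: "u \<in> L2" and e: "e > 0"
  obtains v B where "v \<in> L2" "integrable lborel v" "continuous_on UNIV v" "\<And>x. cmod (v x) \<le> B"
    "l2norm (\<lambda>x. v x - u x) < e"
proof -
  obtain w and N0 :: nat where w0: "w \<in> borel_measurable borel" "\<And>x. cmod (w x) \<le> real N0" "\<And>x. norm x > real N0 \<Longrightarrow> w x = 0"
    "l2norm (\<lambda>x. w x - u x) < e/2"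
    by (rule L2_approx_bounded[OF u, of "e/2"]) (use e in auto)
  \<comment> \<open>The successor makes N positive, which keeps the denominator in \<open>cl\<close>
    away from zero.\<close>
  define N where "N = real (Suc N0)"
  have w: "w \<in> borel_measurable borel" "\<And>x. cmod (w x) \<le> N" "\<And>x. norm x > N \<Longrightarrow> w x = 0" and N: "N > 0"
    using w0 order_trans[OF w0(2), of N] by (auto simp: N_def)
  note [measurable] = w(1)
  have wL: "w \<in> L2" using w by (intro L2_bounded_support)
  have "w \<in> borel_measurable lebesgue" using w(1) by (simp add: measurable_completion)
  then have "w measurable_on UNIV" by (rule lebesgue_measurable_imp_measurable_on) simp
  then obtain S g where S: "negligible S" and g: "\<And>n. continuous_on UNIV (g n)" and lim: "\<And>x. x \<notin> S \<Longrightarrow> (\<lambda>n::nat. g n x) \<longlonglongrightarrow> w x"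
    unfolding measurable_on_def by auto
  \<comment> \<open>\<open>cl\<close> is the radial projection onto the disc of radius N, and
    \<open>ct\<close> below is a continuous plateau equal to 1 on the ball of radius N.\<close>
  define cl where "cl z = (N / max N (cmod z)) *\<^sub>R z" for z :: complex
  define ct where "ct x = max 0 (min 1 (N + 1 - norm x))" for x :: 'a
  define v where "v n x = ct x *\<^sub>R cl (g n x)" for n x
  have cl: "continuous_on UNIV cl" unfolding cl_def using N by (intro continuous_intros) auto
  have cl2: "cmod (cl z) \<le> N" for z using N by (auto simp: cl_def max_def field_simps)
  have cl3: "cmod z \<le> N \<Longrightarrow> cl z = z" for z using N by (simp add: cl_def max_def)
  have ctc: "continuous_on UNIV ct" unfolding ct_def by (intro continuous_intros)
  have ct: "0 \<le> ct x" "ct x \<le> 1" "norm x \<le> N \<Longrightarrow> ct x = 1" "norm x > N + 1 \<Longrightarrow> ct x = 0" for x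
    by (auto simp: ct_def)
  have vc: "continuous_on UNIV (v n)" for n
    unfolding v_def using g[of n] by (intro continuous_intros ctc continuous_on_compose2[OF cl]) auto
  then have [measurable]: "v n \<in> borel_measurable borel" for n by (rule borel_measurable_continuous_onI)
  have vb: "cmod (v n x) \<le> N" for n x
    using mult_mono[OF ct(2)[of x] cl2[of "g n x"]] ct(1)[of x] by (simp add: v_def)
  have vs: "v n x = 0" if "norm x > N + 1" for n x using ct(4)[OF that] by (simp add: v_def)
  have "(\<lambda>n. l2norm (\<lambda>x. v n x - w x)) \<longlonglongrightarrow> 0"
  proof (rule l2norm_dominated)
    have "S \<in> null_sets lebesgue" using S by (simp add: negligible_iff_null_sets)
    then have "AE x in lebesgue. x \<notin> S" by (rule AE_not_in)
    then have "AE x in lborel. x \<notin> S" by (simp add: AE_completion_iff)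
    then show "AE x in lborel. (\<lambda>n. v n x) \<longlonglongrightarrow> w x"
    proof eventually_elim
      case (elim x)
      have "isCont cl (w x)" using cl by (simp add: continuous_on_eq_continuous_at)
      then have "(\<lambda>n. cl (g n x)) \<longlonglongrightarrow> cl (w x)" by (rule isCont_tendsto_compose[OF _ lim[OF elim]])
      then have "(\<lambda>n. ct x *\<^sub>R cl (g n x)) \<longlonglongrightarrow> ct x *\<^sub>R cl (w x)" by (intro tendsto_intros)
      moreover have "ct x *\<^sub>R cl (w x) = w x"
        using w(2,3)[of x] ct(3)[of x] by (cases "norm x \<le> N") (auto simp: cl3)
      ultimately show ?case by (simp add: v_def)
    qed
    show "integrable lborel (\<lambda>x::'a. (2 * N)\<^sup>2 * indicator (cball 0 (N+1)) x :: real)"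
      by (intro integrable_mult_right integrable_real_indicator emeasure_lborel_cball_finite) auto
    show "AE x in lborel. (cmod (v n x - w x))\<^sup>2 \<le> (2 * N)\<^sup>2 * indicator (cball 0 (N+1)) x" for n
    proof (intro AE_I2)
      fix x
      have "cmod (v n x - w x) \<le> 2 * N" using norm_triangle_ineq4[of "v n x" "w x"] vb[of n x] w(2)[of x] by simp
      then have "(cmod (v n x - w x))\<^sup>2 \<le> (2 * N)\<^sup>2" by (intro power_mono) auto
      then show "(cmod (v n x - w x))\<^sup>2 \<le> (2 * N)\<^sup>2 * indicator (cball 0 (N+1)) x"
        using vs[of x n] w(3)[of x] by (cases "norm x \<le> N + 1") (auto simp: indicator_def dist_norm)
    qed
  qed (use w in auto)
  then have "\<forall>\<^sub>F n in sequentially. l2norm (\<lambda>x. v n x - w x) < e/2" using e by (intro order_tendstoD) auto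
  then obtain n where n: "l2norm (\<lambda>x. v n x - w x) < e/2" by (auto simp: eventually_sequentially)
  have vL: "v n \<in> L2"
    by (rule L2_bounded_support(1)[where v="v n" and B=N and R="N+1"]) (use vb vs in auto)
  have vI: "integrable lborel (v n)"
    by (rule L2_bounded_support(2)[where v="v n" and B=N and R="N+1"]) (use vb vs in auto)
  show ?thesis
  proof (rule that[of "v n", OF vL vI vc vb])
    show "l2norm (\<lambda>x. v n x - u x) < e"
      using l2norm_triangle_diff[OF vL wL u] n w0(4) by simp
  qed
qed

text \<open>By Bessel's inequality the squared transform is integrable and dominates its damped
  versions, so both sides of the regularised identity converge.\<close>

lemma plancherel_continuous:
  fixes v :: "'a::euclidean_space \<Rightarrow> complex"
  assumes v: "v \<in> L2" and i: "integrable lborel v" and c: "continuous_on UNIV v" and B: "\<And>x. cmod (v x) \<le> B"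
  shows "l2norm (fourier_integral v) = sqrt ((2*pi)^DIM('a)) * l2norm v"
proof -
  have [measurable]: "v \<in> borel_measurable borel" using v by auto
  let ?\<theta> = "\<lambda>n \<xi>. exp (- (norm \<xi>)\<^sup>2 / (2 * (real (Suc n))\<^sup>2)) * (cmod (fourier_integral v \<xi>))\<^sup>2"
  have "(\<lambda>n. LINT \<xi>|lborel. ?\<theta> n \<xi>) \<longlonglongrightarrow> (LINT \<xi>|lborel. (cmod (fourier_integral v \<xi>))\<^sup>2)"
  proof (rule integral_dominated_convergence)
    show "integrable lborel (\<lambda>\<xi>. (cmod (fourier_integral v \<xi>))\<^sup>2)" by (rule L2_integrable[OF bessel(1)[OF v i]])
    show "AE \<xi> in lborel. (\<lambda>n. ?\<theta> n \<xi>) \<longlonglongrightarrow> (cmod (fourier_integral v \<xi>))\<^sup>2"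
      by (intro AE_I2 exp_damping_mult_tendsto)
    show "AE \<xi> in lborel. norm (?\<theta> n \<xi>) \<le> (cmod (fourier_integral v \<xi>))\<^sup>2" for n
      by (auto intro!: mult_left_le_one_le)
  qed measurable
  then have 1: "(\<lambda>n. complex_of_real (LINT \<xi>|lborel. ?\<theta> n \<xi>)) \<longlonglongrightarrow> complex_of_real ((l2norm (fourier_integral v))\<^sup>2)"
    unfolding l2norm_sq by (rule tendsto_of_real)
  have 2: "complex_of_real (LINT \<xi>|lborel. ?\<theta> n \<xi>) = (2 * pi)^DIM('a) * gauss_form (Suc n) v" for n
    using fourier_gauss_form(1)[OF i, of "Suc n"] by (simp only: integral_complex_of_real[symmetric])
  have "(\<lambda>n. (2 * pi)^DIM('a) * gauss_form (Suc n) v) \<longlonglongrightarrow> (2 * pi)^DIM('a) * complex_of_real ((l2norm v)\<^sup>2)"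
    by (intro tendsto_intros gauss_form_tendsto[OF v i c B])
  from LIMSEQ_unique[OF this 1[unfolded 2]]
  have "complex_of_real ((2 * pi)^DIM('a) * (l2norm v)\<^sup>2) = complex_of_real ((l2norm (fourier_integral v))\<^sup>2)" by simp
  then have "(l2norm (fourier_integral v))\<^sup>2 = (2 * pi)^DIM('a) * (l2norm v)\<^sup>2" by (simp only: of_real_eq_iff)
  then have "sqrt ((l2norm (fourier_integral v))\<^sup>2) = sqrt ((2 * pi)^DIM('a) * (l2norm v)\<^sup>2)" by (simp only:)
  then show ?thesis by (simp add: real_sqrt_mult)
qed

text \<open>Both sides are Lipschitz in u for the \<open>L2\<close> distance, the left one by
  Bessel's inequality for the difference, so the identity extends from the dense class.\<close>

theorem plancherel:
  fixes u :: "'a::euclidean_space \<Rightarrow> complex"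
  assumes u: "u \<in> L2" and i: "integrable lborel u"
  shows "l2norm (fourier_integral u) = sqrt ((2*pi)^DIM('a)) * l2norm u"
proof -
  let ?c = "sqrt ((2*pi)^DIM('a))"
  have c: "?c \<ge> 0" by simp
  have "\<bar>l2norm (fourier_integral u) - ?c * l2norm u\<bar> \<le> 0 + e" if e: "e > 0" for e
  proof -
    have e': "e / (2 * ?c + 1) > 0" using e c by (simp add: add_nonneg_pos)
    obtain v B where v: "v \<in> L2" "integrable lborel v" "continuous_on UNIV v" "\<And>x. cmod (v x) \<le> B"
      "l2norm (\<lambda>x. v x - u x) < e / (2 * ?c + 1)" by (rule L2_approx_continuous[OF u e'], rule that)
    have d: "l2norm (fourier_integral (\<lambda>x. v x - u x)) \<le> ?c * l2norm (\<lambda>x. v x - u x)"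
      using u i v by (intro bessel) auto
    have "\<bar>l2norm (fourier_integral v) - l2norm (fourier_integral u)\<bar> \<le> ?c * l2norm (\<lambda>x. v x - u x)"
      using l2norm_diff_ge[OF bessel(1)[OF v(1,2)] bessel(1)[OF u i]] d
      by (simp add: fourier_integral_diff[OF v(2) i, symmetric])
    moreover have "\<bar>?c * l2norm v - ?c * l2norm u\<bar> \<le> ?c * l2norm (\<lambda>x. v x - u x)"
      using l2norm_diff_ge[OF v(1) u] c unfolding right_diff_distrib[symmetric] abs_mult by (simp add: mult_left_mono)
    ultimately have "\<bar>l2norm (fourier_integral u) - ?c * l2norm u\<bar> \<le> 2 * ?c * l2norm (\<lambda>x. v x - u x)"
      using plancherel_continuous[OF v(1-4)] by simp
    also have "\<dots> \<le> (2 * ?c + 1) * l2norm (\<lambda>x. v x - u x)" by (intro mult_right_mono) auto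
    also have "\<dots> \<le> e" using v(5) c by (simp add: field_simps add_nonneg_pos)
    finally show ?thesis by simp
  qed
  then have "\<bar>l2norm (fourier_integral u) - ?c * l2norm u\<bar> \<le> 0" by (rule field_le_epsilon)
  then show ?thesis by simp
qed


section \<open>The Fourier transform on L2\<close>

definition trunc :: "nat \<Rightarrow> ('a::euclidean_space \<Rightarrow> complex) \<Rightarrow> 'a \<Rightarrow> complex" where
  "trunc n u = (\<lambda>x. indicator (ball 0 (real n)) x * u x)"

lemma trunc_apply: "trunc n u x = (if norm x < real n then u x else 0)"
  by (simp add: trunc_def indicator_def dist_norm)

lemma trunc_L2 [simp]: "u \<in> L2 \<Longrightarrow> trunc n u \<in> L2"
  unfolding trunc_def by (intro L2_indicator) auto

lemma trunc_measurable [measurable (raw)]: "u \<in> borel_measurable borel \<Longrightarrow> trunc n u \<in> borel_measurable borel"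
  unfolding trunc_def by (intro borel_measurable_times borel_measurable_indicator) auto

lemma trunc_integrable [simp]:
  assumes u: "u \<in> L2" shows "integrable lborel (trunc n u)"
  unfolding trunc_def
  by (intro L2_mult_integrable L2_indicator_finite u emeasure_lborel_ball_finite) auto

lemma l2norm_mono:
  assumes "v \<in> L2" "u \<in> borel_measurable borel" "\<And>x. cmod (u x) \<le> cmod (v x)"
  shows "l2norm u \<le> l2norm v"
  using L2_mono(2)[OF assms(1,2), of 1] assms(3) by simp

lemma trunc_tendsto:
  fixes u :: "'a::euclidean_space \<Rightarrow> complex"
  assumes u: "u \<in> L2" shows "(\<lambda>n. l2norm (\<lambda>x. trunc n u x - u x)) \<longlonglongrightarrow> 0"
proof -
  have [measurable]: "u \<in> borel_measurable borel" using u by auto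
  show ?thesis
  proof (rule l2norm_dominated[OF _ _ _ L2_integrable[OF u]])
    show "AE x in lborel. (\<lambda>n. trunc n u x) \<longlonglongrightarrow> u x"
    proof (intro AE_I2 tendsto_eventually)
      fix x :: 'a
      obtain m :: nat where m: "norm x < real m" using reals_Archimedean2 by blast
      show "\<forall>\<^sub>F n in sequentially. trunc n u x = u x"
        using eventually_ge_at_top[of m] by eventually_elim (use m in \<open>auto simp: trunc_apply\<close>)
    qed
  qed (auto simp: trunc_apply)
qed

lemma trunc_diff_le:
  assumes u: "u \<in> L2" and mn: "m \<le> n"
  shows "l2norm (\<lambda>x. trunc m u x - trunc n u x) \<le> l2norm (\<lambda>x. trunc m u x - u x)"
  by (rule l2norm_mono[OF L2_diff[OF trunc_L2[OF u] u]]) (use u mn in \<open>auto simp: trunc_apply\<close>)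

abbreviation pconst :: "'a::euclidean_space itself \<Rightarrow> real" where
  "pconst _ \<equiv> (2 * pi) ^ DIM('a)"

text \<open>Plancherel's theorem turns the convergence of the truncations into a Cauchy rate for
  their transforms.\<close>

lemma fourier_L2_ex:
  fixes u :: "'a::euclidean_space \<Rightarrow> complex"
  assumes u: "u \<in> L2"
  shows "\<exists>h\<in>L2. (\<lambda>n. l2norm (\<lambda>\<xi>. fourier_integral (trunc n u) \<xi> - h \<xi>)) \<longlonglongrightarrow> 0"
proof -
  let ?r = "\<lambda>n. sqrt (pconst TYPE('a)) * l2norm (\<lambda>x. trunc n u x - u x)"
  have r: "?r \<longlonglongrightarrow> 0" using tendsto_mult[OF tendsto_const trunc_tendsto[OF u]] by simp
  have "\<exists>h\<in>L2. \<forall>n. l2norm (\<lambda>\<xi>. fourier_integral (trunc n u) \<xi> - h \<xi>) \<le> ?r n"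
  proof (rule L2_complete[OF _ _ r])
    show "fourier_integral (trunc n u) \<in> L2" for n using u by (intro bessel) auto
    fix m n :: nat assume mn: "m \<le> n"
    have "l2norm (\<lambda>\<xi>. fourier_integral (trunc m u) \<xi> - fourier_integral (trunc n u) \<xi>)
      = sqrt (pconst TYPE('a)) * l2norm (\<lambda>x. trunc m u x - trunc n u x)"
      using u by (simp add: fourier_integral_diff[symmetric] plancherel)
    also have "\<dots> \<le> ?r m" by (intro mult_left_mono trunc_diff_le u mn) auto
    finally show "l2norm (\<lambda>\<xi>. fourier_integral (trunc m u) \<xi> - fourier_integral (trunc n u) \<xi>) \<le> ?r m" .
  qed
  then obtain h where h: "h \<in> L2" "\<And>n. l2norm (\<lambda>\<xi>. fourier_integral (trunc n u) \<xi> - h \<xi>) \<le> ?r n" by blast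
  have "(\<lambda>n. l2norm (\<lambda>\<xi>. fourier_integral (trunc n u) \<xi> - h \<xi>)) \<longlonglongrightarrow> 0"
    by (rule tendsto_sandwich[OF _ _ tendsto_const r]) (use h(2) in auto)
  then show ?thesis using h(1) by blast
qed

lemma nn_tendsto_iff_l2norm:
  assumes "\<And>n::nat. U n \<in> L2"
  shows "(\<lambda>n. \<integral>\<^sup>+x. ennreal ((cmod (U n x))\<^sup>2) \<partial>lborel) \<longlonglongrightarrow> 0 \<longleftrightarrow> (\<lambda>n. l2norm (U n)) \<longlonglongrightarrow> 0"
proof -
  have "(\<lambda>n. ennreal ((l2norm (U n))\<^sup>2)) \<longlonglongrightarrow> 0 \<longleftrightarrow> (\<lambda>n. (l2norm (U n))\<^sup>2) \<longlonglongrightarrow> 0"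
    by (subst tendsto_ennreal_iff[of _ _ 0, simplified]) auto
  also have "\<dots> \<longleftrightarrow> (\<lambda>n. l2norm (U n)) \<longlonglongrightarrow> 0"
  proof
    assume "(\<lambda>n. (l2norm (U n))\<^sup>2) \<longlonglongrightarrow> 0"
    from tendsto_real_sqrt[OF this] show "(\<lambda>n. l2norm (U n)) \<longlonglongrightarrow> 0" by simp
  next
    assume "(\<lambda>n. l2norm (U n)) \<longlonglongrightarrow> 0"
    from tendsto_power[OF this, of 2] show "(\<lambda>n. (l2norm (U n))\<^sup>2) \<longlonglongrightarrow> 0" by simp
  qed
  finally show ?thesis by (simp add: nn_l2norm[OF assms])
qed

lemma fourier_L2:
  fixes u :: "'a::euclidean_space \<Rightarrow> complex"
  assumes u: "u \<in> L2"
  shows "fourier_L2 u \<in> L2" "(\<lambda>n. l2norm (\<lambda>\<xi>. fourier_integral (trunc n u) \<xi> - fourier_L2 u \<xi>)) \<longlonglongrightarrow> 0"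
proof -
  have F: "fourier_integral (trunc n u) \<in> L2" for n using u by (intro bessel) auto
  have *: "(\<lambda>n. \<integral>\<^sup>+ \<xi>. ennreal ((cmod (fourier_integral (trunc n u) \<xi> - h \<xi>))\<^sup>2) \<partial>lborel) \<longlonglongrightarrow> 0 \<longleftrightarrow>
     (\<lambda>n. l2norm (\<lambda>\<xi>. fourier_integral (trunc n u) \<xi> - h \<xi>)) \<longlonglongrightarrow> 0" if "h \<in> L2" for h
    using that F by (intro nn_tendsto_iff_l2norm) auto
  have "\<exists>h. h \<in> L2 \<and> (\<lambda>n. \<integral>\<^sup>+ \<xi>. ennreal ((cmod (fourier_integral (trunc n u) \<xi> - h \<xi>))\<^sup>2) \<partial>lborel) \<longlonglongrightarrow> 0"
    using fourier_L2_ex[OF u] * by blast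
  from someI_ex[OF this] have "fourier_L2 u \<in> L2 \<and> (\<lambda>n. \<integral>\<^sup>+ \<xi>. ennreal ((cmod (fourier_integral (trunc n u) \<xi> - fourier_L2 u \<xi>))\<^sup>2) \<partial>lborel) \<longlonglongrightarrow> 0"
    unfolding fourier_L2_def trunc_def .
  then show "fourier_L2 u \<in> L2" "(\<lambda>n. l2norm (\<lambda>\<xi>. fourier_integral (trunc n u) \<xi> - fourier_L2 u \<xi>)) \<longlonglongrightarrow> 0"
    using * by auto
qed

lemma L2_lim_unique:
  fixes a b :: "'a::euclidean_space \<Rightarrow> complex"
  assumes "\<And>n. U n \<in> L2" "a \<in> L2" "b \<in> L2"
    and "(\<lambda>n::nat. l2norm (\<lambda>x. U n x - a x)) \<longlonglongrightarrow> 0" "(\<lambda>n. l2norm (\<lambda>x. U n x - b x)) \<longlonglongrightarrow> 0"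
  shows "AE x in lborel. a x = b x"
proof (rule l2norm_0_imp_AE[OF assms(2,3)])
  have "(\<lambda>n. l2norm (\<lambda>x. U n x - a x) + l2norm (\<lambda>x. U n x - b x)) \<longlonglongrightarrow> 0"
    using tendsto_add[OF assms(4,5)] by simp
  then show "l2norm (\<lambda>x. a x - b x) \<le> 0"
  proof (rule tendsto_lowerbound)
    show "\<forall>\<^sub>F n in sequentially. l2norm (\<lambda>x. a x - b x) \<le> l2norm (\<lambda>x. U n x - a x) + l2norm (\<lambda>x. U n x - b x)"
    proof (intro always_eventually allI)
      fix n
      show "l2norm (\<lambda>x. a x - b x) \<le> l2norm (\<lambda>x. U n x - a x) + l2norm (\<lambda>x. U n x - b x)"
        using l2norm_triangle_diff[OF assms(2) assms(1)[of n] assms(3)] by (simp add: l2norm_minus_commute[of a])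
    qed
  qed simp
qed

lemma l2norm_fourier_L2:
  fixes u :: "'a::euclidean_space \<Rightarrow> complex"
  assumes u: "u \<in> L2"
  shows "l2norm (fourier_L2 u) = sqrt (pconst TYPE('a)) * l2norm u"
proof (rule LIMSEQ_unique)
  have F: "fourier_integral (trunc n u) \<in> L2" for n using u by (intro bessel) auto
  show "(\<lambda>n. l2norm (fourier_integral (trunc n u))) \<longlonglongrightarrow> l2norm (fourier_L2 u)"
    by (rule l2norm_tendsto[OF F fourier_L2[OF u]])
  have "(\<lambda>n. l2norm (trunc n u)) \<longlonglongrightarrow> l2norm u"
    by (rule l2norm_tendsto[OF _ u trunc_tendsto[OF u]]) (use u in simp)
  then have "(\<lambda>n. sqrt (pconst TYPE('a)) * l2norm (trunc n u)) \<longlonglongrightarrow> sqrt (pconst TYPE('a)) * l2norm u"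
    by (intro tendsto_intros)
  then show "(\<lambda>n. l2norm (fourier_integral (trunc n u))) \<longlonglongrightarrow> sqrt (pconst TYPE('a)) * l2norm u"
    using u by (simp add: plancherel)
qed

text \<open>The representative in \<open>fourier_L2\<close> is chosen separately for each argument,
  so linearity can be expected only almost everywhere.\<close>

lemma fourier_L2_diff:
  fixes u v :: "'a::euclidean_space \<Rightarrow> complex"
  assumes u: "u \<in> L2" and v: "v \<in> L2"
  shows "AE \<xi> in lborel. fourier_L2 (\<lambda>x. u x - v x) \<xi> = fourier_L2 u \<xi> - fourier_L2 v \<xi>"
proof (rule L2_lim_unique[where U="\<lambda>n. fourier_integral (trunc n (\<lambda>x. u x - v x))"])
  have uv: "(\<lambda>x. u x - v x) \<in> L2" using u v by simp
  show "fourier_integral (trunc n (\<lambda>x. u x - v x)) \<in> L2" for n using uv by (intro bessel) auto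
  show "fourier_L2 (\<lambda>x. u x - v x) \<in> L2" by (rule fourier_L2[OF uv])
  show "(\<lambda>\<xi>. fourier_L2 u \<xi> - fourier_L2 v \<xi>) \<in> L2" by (intro L2_diff fourier_L2 u v)
  show "(\<lambda>n. l2norm (\<lambda>\<xi>. fourier_integral (trunc n (\<lambda>x. u x - v x)) \<xi> - fourier_L2 (\<lambda>x. u x - v x) \<xi>)) \<longlonglongrightarrow> 0"
    by (rule fourier_L2[OF uv])
  have e: "fourier_integral (trunc n (\<lambda>x. u x - v x)) = (\<lambda>\<xi>. fourier_integral (trunc n u) \<xi> - fourier_integral (trunc n v) \<xi>)" for n
    unfolding fourier_integral_diff[OF trunc_integrable[OF u] trunc_integrable[OF v], symmetric]
    by (simp add: trunc_def right_diff_distrib)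
  have FU: "(\<lambda>\<xi>. fourier_integral (trunc n u) \<xi> - fourier_L2 u \<xi>) \<in> L2" if u: "u \<in> L2" for n and u :: "'a \<Rightarrow> complex"
    using that by (intro L2_diff bessel fourier_L2) auto
  have *: "l2norm (\<lambda>\<xi>. fourier_integral (trunc n (\<lambda>x. u x - v x)) \<xi> - (fourier_L2 u \<xi> - fourier_L2 v \<xi>))
    \<le> l2norm (\<lambda>\<xi>. fourier_integral (trunc n u) \<xi> - fourier_L2 u \<xi>) + l2norm (\<lambda>\<xi>. fourier_integral (trunc n v) \<xi> - fourier_L2 v \<xi>)" for n
    using l2norm_triangle[OF FU[OF u, of n] L2_cmult[OF FU[OF v, of n], of "-1"]] l2norm_cmult[of "-1" "\<lambda>\<xi>. fourier_integral (trunc n v) \<xi> - fourier_L2 v \<xi>"]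
    unfolding e by (simp add: algebra_simps)
  show "(\<lambda>n. l2norm (\<lambda>\<xi>. fourier_integral (trunc n (\<lambda>x. u x - v x)) \<xi> - (fourier_L2 u \<xi> - fourier_L2 v \<xi>))) \<longlonglongrightarrow> 0"
  proof (rule tendsto_sandwich[OF _ _ tendsto_const])
    show "(\<lambda>n. l2norm (\<lambda>\<xi>. fourier_integral (trunc n u) \<xi> - fourier_L2 u \<xi>) + l2norm (\<lambda>\<xi>. fourier_integral (trunc n v) \<xi> - fourier_L2 v \<xi>)) \<longlonglongrightarrow> 0"
      using tendsto_add[OF fourier_L2(2)[OF u] fourier_L2(2)[OF v]] by simp
  qed (use * in auto)
qed

text \<open>The equality is literal: the predicate from which \<open>fourier_L2\<close> chooses sees
  its argument only through integrals, so both choices are made from the same predicate.\<close>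

lemma fourier_L2_cong:
  assumes u: "u \<in> borel_measurable borel" and v: "v \<in> borel_measurable borel" and e: "AE x in lborel. u x = v x"
  shows "fourier_L2 u = fourier_L2 v"
proof -
  note [measurable] = u v
  have "fourier_integral (trunc n u) \<xi> = fourier_integral (trunc n v) \<xi>" for n \<xi>
    unfolding fourier_integral_def by (intro integral_cong_AE) (use e in \<open>auto simp: trunc_apply\<close>)
  then show ?thesis unfolding fourier_L2_def trunc_def by simp
qed

lemma fourier_L2_compact:
  fixes u :: "'a::euclidean_space \<Rightarrow> complex"
  assumes u: "u \<in> L2" and R: "\<And>x. norm x \<ge> real R \<Longrightarrow> u x = 0"
  shows "AE \<xi> in lborel. fourier_L2 u \<xi> = fourier_integral u \<xi>"
proof (rule L2_lim_unique[where U="\<lambda>n. fourier_integral (trunc n u)"])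
  have e: "trunc n u = u" if "n \<ge> R" for n using R that by (auto simp: trunc_apply fun_eq_iff)
  then have i: "integrable lborel u" using trunc_integrable[OF u, of R] by simp
  show "fourier_integral (trunc n u) \<in> L2" for n using u by (intro bessel) auto
  show "fourier_L2 u \<in> L2" by (rule fourier_L2[OF u])
  show "fourier_integral u \<in> L2" by (rule bessel[OF u i])
  show "(\<lambda>n. l2norm (\<lambda>\<xi>. fourier_integral (trunc n u) \<xi> - fourier_L2 u \<xi>)) \<longlonglongrightarrow> 0" by (rule fourier_L2[OF u])
  have "\<forall>\<^sub>F n in sequentially. l2norm (\<lambda>\<xi>. fourier_integral (trunc n u) \<xi> - fourier_integral u \<xi>) = 0"
    using eventually_ge_at_top[of R] by eventually_elim (simp add: e l2norm_def)
  then show "(\<lambda>n. l2norm (\<lambda>\<xi>. fourier_integral (trunc n u) \<xi> - fourier_integral u \<xi>)) \<longlonglongrightarrow> 0" by (rule tendsto_eventually)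
qed

section \<open>Duality, inversion and Parseval's identity\<close>

lemma fourier_integral_duality:
  fixes u v :: "'a::euclidean_space \<Rightarrow> complex"
  assumes u: "integrable lborel u" and v: "integrable lborel v"
  shows "(LINT \<xi>|lborel. fourier_integral u \<xi> * v \<xi>) = (LINT x|lborel. u x * fourier_integral v x)"
proof -
  have [measurable]: "u \<in> borel_measurable borel" "v \<in> borel_measurable borel" using u v by auto
  let ?F = "\<lambda>\<xi> x. exp (- (\<i> * complex_of_real (x \<bullet> \<xi>))) * (v \<xi> * u x)"
  have "integrable (lborel \<Otimes>\<^sub>M lborel) (\<lambda>(\<xi>, x). v \<xi> * u x)"
    by (rule integrable_pair_mult(1)[OF lborel.sigma_finite_measure_axioms lborel.sigma_finite_measure_axioms v u])
  then have I: "integrable (lborel \<Otimes>\<^sub>M lborel) (\<lambda>(\<xi>, x). ?F \<xi> x)"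
    by (rule Bochner_Integration.integrable_bound) (auto simp: norm_mult)
  have "(LINT \<xi>|lborel. fourier_integral u \<xi> * v \<xi>) = (LINT \<xi>|lborel. LINT x|lborel. ?F \<xi> x)"
  proof (intro Bochner_Integration.integral_cong refl)
    fix \<xi>
    have "fourier_integral u \<xi> * v \<xi> = (LINT x|lborel. exp (- (\<i> * complex_of_real (x \<bullet> \<xi>))) * u x * v \<xi>)"
      unfolding fourier_integral_def by simp
    also have "\<dots> = (LINT x|lborel. ?F \<xi> x)"
      by (intro Bochner_Integration.integral_cong refl) (simp only: mult_ac)
    finally show "fourier_integral u \<xi> * v \<xi> = (LINT x|lborel. ?F \<xi> x)" .
  qed
  also have "\<dots> = (LINT x|lborel. LINT \<xi>|lborel. ?F \<xi> x)" by (rule lborel_pair.Fubini_integral[OF I, symmetric])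
  also have "\<dots> = (LINT x|lborel. u x * fourier_integral v x)"
  proof (intro Bochner_Integration.integral_cong refl)
    fix x
    have "u x * fourier_integral v x = (LINT \<xi>|lborel. u x * (exp (- (\<i> * complex_of_real (\<xi> \<bullet> x))) * v \<xi>))"
      unfolding fourier_integral_def by simp
    also have "\<dots> = (LINT \<xi>|lborel. ?F \<xi> x)"
      by (intro Bochner_Integration.integral_cong refl) (simp only: mult_ac inner_commute)
    finally show "(LINT \<xi>|lborel. ?F \<xi> x) = u x * fourier_integral v x" by simp
  qed
  finally show ?thesis .
qed

lemma fourier_L2_duality:
  fixes u v :: "'a::euclidean_space \<Rightarrow> complex"
  assumes u: "u \<in> L2" and v: "v \<in> L2"
  shows "(LINT \<xi>|lborel. fourier_L2 u \<xi> * v \<xi>) = (LINT x|lborel. u x * fourier_L2 v x)"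
proof (rule LIMSEQ_unique)
  have F: "fourier_integral (trunc n u) \<in> L2" if "u \<in> L2" for n and u :: "'a \<Rightarrow> complex"
    using that by (intro bessel) auto
  show "(\<lambda>n. LINT \<xi>|lborel. fourier_integral (trunc n u) \<xi> * trunc n v \<xi>) \<longlonglongrightarrow> (LINT \<xi>|lborel. fourier_L2 u \<xi> * v \<xi>)"
    using u v by (intro L2_tendsto_integral_mult F fourier_L2 trunc_tendsto) auto
  have "(\<lambda>n. LINT x|lborel. trunc n u x * fourier_integral (trunc n v) x) \<longlonglongrightarrow> (LINT x|lborel. u x * fourier_L2 v x)"
    using u v by (intro L2_tendsto_integral_mult F fourier_L2 trunc_tendsto) auto
  then show "(\<lambda>n. LINT \<xi>|lborel. fourier_integral (trunc n u) \<xi> * trunc n v \<xi>) \<longlonglongrightarrow> (LINT x|lborel. u x * fourier_L2 v x)"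
    using u v by (simp add: fourier_integral_duality)
qed

text \<open>The inverse transform, written as the conjugate of the forward transform of the
  conjugate, so that its properties are inherited from \<open>fourier_L2\<close> without a second
  limiting procedure.\<close>

definition invf :: "('a::euclidean_space \<Rightarrow> complex) \<Rightarrow> 'a \<Rightarrow> complex" where
  "invf h = (\<lambda>x. complex_of_real (1 / pconst TYPE('a)) * cnj (fourier_L2 (\<lambda>\<xi>. cnj (h \<xi>)) x))"

lemma invf_L2 [simp]: "h \<in> L2 \<Longrightarrow> invf h \<in> L2"
  unfolding invf_def by (intro L2_cmult L2_cnj fourier_L2)

lemma l2norm_invf:
  fixes h :: "'a::euclidean_space \<Rightarrow> complex"
  assumes "h \<in> L2" shows "(l2norm (invf h))\<^sup>2 = (l2norm h)\<^sup>2 / pconst TYPE('a)"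
proof -
  have "(cmod (complex_of_real (1 / c)) * (sqrt c * l))\<^sup>2 = l\<^sup>2 / c" if "c > 0" for c l :: real
    using that by (simp add: power_mult_distrib norm_divide power_divide) (simp add: power2_eq_square)
  note this[of "pconst TYPE('a)" "l2norm h"]
  then show ?thesis
    unfolding invf_def l2norm_cmult l2norm_cnj l2norm_fourier_L2[OF L2_cnj[OF assms]] by (simp only: zero_less_power zero_less_mult_iff pi_gt_zero zero_less_numeral simp_thms)
qed

lemma inner_L2_fourier:
  fixes u v :: "'a::euclidean_space \<Rightarrow> complex"
  assumes u: "u \<in> L2" and v: "v \<in> L2"
  shows "inner_L2 (fourier_L2 u) v = complex_of_real (pconst TYPE('a)) * inner_L2 u (invf v)"
proof -
  have "inner_L2 (fourier_L2 u) v = cnj (LINT \<xi>|lborel. fourier_L2 u \<xi> * cnj (v \<xi>))"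
    unfolding inner_L2_def by (subst Bochner_Integration.integral_cnj[symmetric]) simp
  also have "\<dots> = cnj (LINT x|lborel. u x * fourier_L2 (\<lambda>\<xi>. cnj (v \<xi>)) x)"
    using u v by (simp add: fourier_L2_duality)
  also have "\<dots> = (LINT x|lborel. cnj (u x) * cnj (fourier_L2 (\<lambda>\<xi>. cnj (v \<xi>)) x))"
    by (subst Bochner_Integration.integral_cnj[symmetric]) simp
  also have "\<dots> = (LINT x|lborel. complex_of_real (pconst TYPE('a)) * (cnj (u x) * invf v x))"
    by (intro Bochner_Integration.integral_cong refl) (simp add: invf_def)
  also have "\<dots> = complex_of_real (pconst TYPE('a)) * inner_L2 u (invf v)"
    by (simp add: inner_L2_def)
  finally show ?thesis .
qed

text \<open>The hypothesis makes the expanded squared norm of a - b nonpositive. Inversion is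
  thereby reduced to identities between norms and inner products.\<close>

lemma L2_eq_of_inner:
  fixes a b :: "'a::euclidean_space \<Rightarrow> complex"
  assumes a: "a \<in> L2" and b: "b \<in> L2" and e: "(l2norm a)\<^sup>2 + (l2norm b)\<^sup>2 \<le> 2 * Re (inner_L2 a b)"
  shows "AE x in lborel. a x = b x"
proof (rule l2norm_0_imp_AE[OF a b])
  have mb: "(\<lambda>x. - 1 * b x) \<in> L2" by (rule L2_cmult[OF b])
  have "(l2norm (\<lambda>x. a x + - 1 * b x))\<^sup>2 = (l2norm a)\<^sup>2 + 2 * Re (inner_L2 a (\<lambda>x. - 1 * b x)) + (l2norm (\<lambda>x. - 1 * b x))\<^sup>2"
    by (rule inner_L2_add_sq[OF a mb])
  also have "l2norm (\<lambda>x. - 1 * b x) = l2norm b" by (subst l2norm_cmult) simp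
  also have "inner_L2 a (\<lambda>x. - 1 * b x) = - inner_L2 a b" by (simp add: inner_L2_def)
  finally have "(l2norm (\<lambda>x. a x - b x))\<^sup>2 \<le> 0" using e by simp
  then show "l2norm (\<lambda>x. a x - b x) \<le> 0" by simp
qed

lemma inner_L2_self: "inner_L2 u u = complex_of_real ((l2norm u)\<^sup>2)"
  by (simp only: l2norm_sq_complex inner_L2_def)

text \<open>Up to a constant \<open>invf\<close> is the adjoint of the transform and scales norms by
  a fixed factor. So the inner product of \<open>fourier_L2 (invf h)\<close> with h equals the
  squared norm of either of them, which forces equality. This is the surjectivity of the
  transform.\<close>

lemma fourier_invf:
  fixes h :: "'a::euclidean_space \<Rightarrow> complex"
  assumes h: "h \<in> L2"
  shows "AE \<xi> in lborel. fourier_L2 (invf h) \<xi> = h \<xi>"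
proof (rule L2_eq_of_inner)
  have i: "invf h \<in> L2" using h by simp
  show "fourier_L2 (invf h) \<in> L2" "h \<in> L2" using fourier_L2[OF i] h by auto
  have "inner_L2 (fourier_L2 (invf h)) h = complex_of_real (pconst TYPE('a) * (l2norm (invf h))\<^sup>2)"
    unfolding inner_L2_fourier[OF i h] inner_L2_self by simp
  then show "(l2norm (fourier_L2 (invf h)))\<^sup>2 + (l2norm h)\<^sup>2 \<le> 2 * Re (inner_L2 (fourier_L2 (invf h)) h)"
    by (simp only: l2norm_fourier_L2[OF i] Re_complex_of_real power_mult_distrib l2norm_invf[OF h]) simp
qed

lemma invf_fourier:
  fixes u :: "'a::euclidean_space \<Rightarrow> complex"
  assumes u: "u \<in> L2"
  shows "AE x in lborel. u x = invf (fourier_L2 u) x"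
proof (rule L2_eq_of_inner)
  have F: "fourier_L2 u \<in> L2" by (rule fourier_L2[OF u])
  show "u \<in> L2" "invf (fourier_L2 u) \<in> L2" using u F by auto
  have "complex_of_real (pconst TYPE('a)) * inner_L2 u (invf (fourier_L2 u)) = complex_of_real (pconst TYPE('a) * (l2norm u)\<^sup>2)"
    unfolding inner_L2_fourier[OF u F, symmetric] inner_L2_self
    by (simp only: l2norm_fourier_L2[OF u] power_mult_distrib) simp
  then have "inner_L2 u (invf (fourier_L2 u)) = complex_of_real ((l2norm u)\<^sup>2)" by simp
  then show "(l2norm u)\<^sup>2 + (l2norm (invf (fourier_L2 u)))\<^sup>2 \<le> 2 * Re (inner_L2 u (invf (fourier_L2 u)))"
    by (simp only: l2norm_invf[OF F] Re_complex_of_real l2norm_fourier_L2[OF u] power_mult_distrib) simp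
qed

lemma parseval:
  fixes u v :: "'a::euclidean_space \<Rightarrow> complex"
  assumes u: "u \<in> L2" and v: "v \<in> L2"
  shows "inner_L2 (fourier_L2 u) (fourier_L2 v) = complex_of_real (pconst TYPE('a)) * inner_L2 u v"
proof -
  have "inner_L2 u (invf (fourier_L2 v)) = inner_L2 u v"
    unfolding inner_L2_def
    by (intro integral_cong_AE) (use u v invf_fourier[OF v] L2_measurable[OF invf_L2[OF fourier_L2(1)[OF v]]] in auto)
  then show ?thesis using inner_L2_fourier[OF u fourier_L2(1)[OF v]] by simp
qed

lemma invf_cong:
  assumes "u \<in> borel_measurable borel" "v \<in> borel_measurable borel" "AE x in lborel. u x = v x"
  shows "invf u = invf v"
proof -
  have "fourier_L2 (\<lambda>\<xi>. cnj (u \<xi>)) = fourier_L2 (\<lambda>\<xi>. cnj (v \<xi>))"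
    by (rule fourier_L2_cong) (use assms in auto)
  then show ?thesis by (simp add: invf_def)
qed

text \<open>The choice is possible by surjectivity and unique up to null sets by injectivity, so the
  arbitrary representative may be replaced by \<open>invf h\<close>.\<close>

lemma inv_fourier_L2:
  assumes h: "h \<in> L2"
  shows "inv_fourier_L2 h \<in> L2" "AE \<xi> in lborel. fourier_L2 (inv_fourier_L2 h) \<xi> = h \<xi>"
    "AE x in lborel. inv_fourier_L2 h x = invf h x"
proof -
  have "\<exists>u. u \<in> L2 \<and> (AE \<xi> in lborel. fourier_L2 u \<xi> = h \<xi>)" using h fourier_invf[OF h] by (intro exI[of _ "invf h"]) auto
  from someI_ex[OF this] show *: "inv_fourier_L2 h \<in> L2" "AE \<xi> in lborel. fourier_L2 (inv_fourier_L2 h) \<xi> = h \<xi>"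
    unfolding inv_fourier_L2_def by auto
  have "invf (fourier_L2 (inv_fourier_L2 h)) = invf h"
    by (rule invf_cong) (use *(2) h fourier_L2(1)[OF *(1)] in auto)
  then show "AE x in lborel. inv_fourier_L2 h x = invf h x" using invf_fourier[OF *(1)] by simp
qed

lemma invf_diff:
  assumes a: "a \<in> L2" and b: "b \<in> L2"
  shows "AE x in lborel. invf (\<lambda>\<xi>. a \<xi> - b \<xi>) x = invf a x - invf b x"
  using fourier_L2_diff[OF L2_cnj[OF a] L2_cnj[OF b]]
  by eventually_elim (simp add: invf_def diff_divide_distrib)

lemma l2norm_invf_diff:
  fixes a b :: "'a::euclidean_space \<Rightarrow> complex"
  assumes a: "a \<in> L2" and b: "b \<in> L2"
  shows "(l2norm (\<lambda>x. invf a x - invf b x))\<^sup>2 = (l2norm (\<lambda>\<xi>. a \<xi> - b \<xi>))\<^sup>2 / pconst TYPE('a)"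
proof -
  have "l2norm (invf (\<lambda>\<xi>. a \<xi> - b \<xi>)) = l2norm (\<lambda>x. invf a x - invf b x)"
    by (rule l2norm_cong_AE[OF L2_measurable[OF invf_L2[OF L2_diff[OF a b]]]
        L2_measurable[OF L2_diff[OF invf_L2[OF a] invf_L2[OF b]]] invf_diff[OF a b]])
  then show ?thesis using l2norm_invf[of "\<lambda>\<xi>. a \<xi> - b \<xi>"] a b by simp
qed

lemma invf_compact:
  fixes h :: "'a::euclidean_space \<Rightarrow> complex"
  assumes h: "h \<in> L2" and R: "\<And>\<xi>. norm \<xi> \<ge> real R \<Longrightarrow> h \<xi> = 0"
  shows "AE x in lborel. invf h x = complex_of_real (1 / pconst TYPE('a)) * (LINT \<xi>|lborel. exp (\<i> * complex_of_real (x \<bullet> \<xi>)) * h \<xi>)"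
proof -
  have "AE x in lborel. fourier_L2 (\<lambda>\<xi>. cnj (h \<xi>)) x = fourier_integral (\<lambda>\<xi>. cnj (h \<xi>)) x"
    by (rule fourier_L2_compact[where R=R]) (use h R in auto)
  then show ?thesis
  proof eventually_elim
    case (elim x)
    have "cnj (fourier_integral (\<lambda>\<xi>. cnj (h \<xi>)) x) = (LINT \<xi>|lborel. exp (\<i> * complex_of_real (x \<bullet> \<xi>)) * h \<xi>)"
      unfolding fourier_integral_def
      by (subst Bochner_Integration.integral_cnj[symmetric]) (simp add: exp_cnj inner_commute)
    then show ?case by (simp only: invf_def elim)
  qed
qed

section \<open>The evolution as an almost everywhere limit\<close>

definition phase :: "real \<Rightarrow> (real^2 \<Rightarrow> complex) \<Rightarrow> real^2 \<Rightarrow> complex" where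
  "phase t h = (\<lambda>\<xi>. exp (\<i> * complex_of_real (t * norm \<xi> ^ 4)) * h \<xi>)"

lemma phase_L2 [simp]: "h \<in> L2 \<Longrightarrow> phase t h \<in> L2"
  unfolding phase_def by (rule L2_mono(1)[where v=h and C=1]) (auto simp: norm_mult)

text \<open>The solution with frequency profile H at y = (t, x), given by an explicit integral and
  hence measurable in both variables together.\<close>

definition evI :: "(real^2 \<Rightarrow> complex) \<Rightarrow> real \<times> (real^2) \<Rightarrow> complex" where
  "evI H y = complex_of_real (1 / (2 * pi)^2) *
     (LINT \<xi>|lborel. exp (\<i> * complex_of_real (snd y \<bullet> \<xi> + fst y * norm \<xi> ^ 4)) * H \<xi>)"

lemma evI_measurable:
  assumes [measurable]: "H \<in> borel_measurable borel"
  shows "evI H \<in> borel_measurable borel"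
proof -
  note borel_measurable_fst_snd[measurable del]
  have "evI H \<in> borel_measurable (borel \<Otimes>\<^sub>M borel)" unfolding evI_def by measurable
  then show ?thesis by (simp add: borel_prod)
qed

definition ev :: "nat \<Rightarrow> (real^2 \<Rightarrow> complex) \<Rightarrow> real \<times> (real^2) \<Rightarrow> complex" where
  "ev n h = evI (trunc n h)"

lemma ev_measurable [measurable]: "h \<in> borel_measurable borel \<Longrightarrow> ev n h \<in> borel_measurable borel"
  unfolding ev_def by (intro evI_measurable trunc_measurable)

lemma ev_phase:
  assumes h: "h \<in> L2"
  shows "AE x in lborel. ev n h (t, x) = invf (phase t (trunc n h)) x"
proof -
  have "AE x in lborel. invf (phase t (trunc n h)) x = complex_of_real (1 / pconst TYPE(real^2)) *
      (LINT \<xi>|lborel. exp (\<i> * complex_of_real (x \<bullet> \<xi>)) * phase t (trunc n h) \<xi>)"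
    by (rule invf_compact[OF phase_L2[OF trunc_L2[OF h]], where R=n]) (auto simp: phase_def trunc_apply)
  then show ?thesis
    by eventually_elim (simp add: ev_def evI_def phase_def distrib_left exp_add mult.assoc)
qed

lemma propagator_L2:
  assumes u: "u \<in> L2"
  shows "propagator t u \<in> L2" "AE x in lborel. propagator t u x = invf (phase t (fourier_L2 u)) x"
  using inv_fourier_L2[OF phase_L2[OF fourier_L2(1)[OF u]], of t]
  by (auto simp: propagator_def phase_def)

lemma ev_slice_measurable:
  assumes "h \<in> borel_measurable borel"
  shows "(\<lambda>x. ev n h (t, x)) \<in> borel_measurable borel"
  by (rule measurable_compose[OF _ ev_measurable[OF assms], of "\<lambda>x. (t, x)"]) (intro borel_measurable_Pair; simp)

lemma ev_L2:
  assumes h: "h \<in> L2"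
  shows "(\<lambda>x. ev n h (t, x)) \<in> L2"
proof (rule L2_cong_AE[OF invf_L2[OF phase_L2[OF trunc_L2[OF h]]]])
  show "(\<lambda>x. ev n h (t, x)) \<in> borel_measurable borel"
    by (rule ev_slice_measurable) (use h in auto)
  show "AE x in lborel. invf (phase t (trunc n h)) x = ev n h (t, x)"
    using ev_phase[OF h, of n t] by eventually_elim simp
qed

text \<open>The phase has modulus one and \<open>invf\<close> scales norms by a constant below 1, so
  the error bound is the same for every t. This uniformity lets a single subsequence serve all
  times.\<close>

lemma l2norm_ev_propagator:
  assumes u: "u \<in> L2"
  defines "h \<equiv> fourier_L2 u"
  shows "l2norm (\<lambda>x. ev n h (t, x) - propagator t u x) \<le> l2norm (\<lambda>\<xi>. trunc n h \<xi> - h \<xi>)"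
proof -
  have h: "h \<in> L2" unfolding h_def by (rule fourier_L2[OF u])
  let ?a = "phase t (trunc n h)" and ?b = "phase t h"
  have ab: "?a \<in> L2" "?b \<in> L2" using h by auto
  have "l2norm (\<lambda>x. ev n h (t, x) - propagator t u x) = l2norm (\<lambda>x. invf ?a x - invf ?b x)"
  proof (rule l2norm_cong_AE)
    show "(\<lambda>x. ev n h (t, x) - propagator t u x) \<in> borel_measurable borel"
      by (rule L2_measurable[OF L2_diff[OF ev_L2[OF h] propagator_L2(1)[OF u]]])
    show "(\<lambda>x. invf ?a x - invf ?b x) \<in> borel_measurable borel"
      by (rule L2_measurable[OF L2_diff[OF invf_L2[OF ab(1)] invf_L2[OF ab(2)]]])
    show "AE x in lborel. ev n h (t, x) - propagator t u x = invf ?a x - invf ?b x"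
      using ev_phase[OF h, of n t] propagator_L2(2)[OF u, of t] unfolding h_def by eventually_elim simp
  qed
  moreover have "l2norm (\<lambda>\<xi>. ?a \<xi> - ?b \<xi>) = l2norm (\<lambda>\<xi>. trunc n h \<xi> - h \<xi>)"
    unfolding l2norm_def phase_def by (simp add: right_diff_distrib[symmetric] norm_mult)
  ultimately have "(l2norm (\<lambda>x. ev n h (t, x) - propagator t u x))\<^sup>2 = (l2norm (\<lambda>\<xi>. trunc n h \<xi> - h \<xi>))\<^sup>2 / pconst TYPE(real^2)"
    using l2norm_invf_diff[OF ab] by simp
  also have "\<dots> \<le> (l2norm (\<lambda>\<xi>. trunc n h \<xi> - h \<xi>))\<^sup>2 / 1"
    using pi_gt3 by (intro divide_left_mono one_le_power) auto
  finally show ?thesis by (intro power2_le_imp_le[of "l2norm (\<lambda>x. ev n h (t, x) - propagator t u x)"]) auto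
qed

lemma ev_tendsto_propagator:
  assumes u: "u \<in> L2" and s: "\<And>k. l2norm (\<lambda>\<xi>. trunc (s k) (fourier_L2 u) \<xi> - fourier_L2 u \<xi>) \<le> (1/2)^k"
  shows "AE x in lborel. (\<lambda>k. ev (s k) (fourier_L2 u) (t, x)) \<longlonglongrightarrow> propagator t u x"
  by (rule AE_tendsto_of_L2_geometric[OF ev_L2[OF fourier_L2(1)[OF u]] propagator_L2(1)[OF u], where c=1])
     (use order_trans[OF l2norm_ev_propagator[OF u] s] in simp)

text \<open>One subsequence for both functions, because \<open>Q_le\<close> approximates g and f
  simultaneously.\<close>

lemma trunc_subseq:
  assumes "g \<in> L2" "h \<in> L2"
  obtains s where "strict_mono s"
    "\<And>k. l2norm (\<lambda>\<xi>. trunc (s k) g \<xi> - g \<xi>) \<le> (1/2)^k" "\<And>k. l2norm (\<lambda>\<xi>. trunc (s k) h \<xi> - h \<xi>) \<le> (1/2)^k"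
proof -
  let ?r = "\<lambda>n. l2norm (\<lambda>\<xi>. trunc n g \<xi> - g \<xi>) + l2norm (\<lambda>\<xi>. trunc n h \<xi> - h \<xi>)"
  have "?r \<longlonglongrightarrow> 0" using tendsto_add[OF trunc_tendsto[OF assms(1)] trunc_tendsto[OF assms(2)]] by simp
  then obtain s where s: "strict_mono s" "\<And>k. ?r (s k) \<le> (1/2)^k"
    using exists_summable_subseq[of ?r] by auto
  show ?thesis
  proof (rule that[OF s(1)])
    fix k
    show "l2norm (\<lambda>\<xi>. trunc (s k) g \<xi> - g \<xi>) \<le> (1/2)^k" "l2norm (\<lambda>\<xi>. trunc (s k) h \<xi> - h \<xi>) \<le> (1/2)^k"
      using s(2)[of k] l2norm_nonneg[of "\<lambda>\<xi>. trunc (s k) g \<xi> - g \<xi>"] l2norm_nonneg[of "\<lambda>\<xi>. trunc (s k) h \<xi> - h \<xi>"]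
      by linarith+
  qed
qed

text \<open>The choice in \<open>evolution\<close> needs a witness: the pointwise limit of
  \<open>ev\<close> along one subsequence is jointly measurable and correct on every time
  slice.\<close>

lemma evolution_spec:
  assumes u: "u \<in> L2"
  shows "evolution u \<in> borel_measurable borel" "AE x in lborel. evolution u (t, x) = propagator t u x"
proof -
  define h where "h = fourier_L2 u"
  have h: "h \<in> L2" unfolding h_def by (rule fourier_L2[OF u])
  have [measurable]: "h \<in> borel_measurable borel" using h by auto
  obtain s where "strict_mono s" "\<And>k. l2norm (\<lambda>\<xi>. trunc (s k) h \<xi> - h \<xi>) \<le> (1/2)^k"
    and s: "\<And>k. l2norm (\<lambda>\<xi>. trunc (s k) h \<xi> - h \<xi>) \<le> (1/2)^k"
    by (rule trunc_subseq[OF h h], rule that)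
  define U where "U p = (if convergent (\<lambda>k. ev (s k) h p) then lim (\<lambda>k. ev (s k) h p) else 0)" for p
  have U: "U \<in> borel_measurable borel"
    unfolding U_def Cauchy_convergent_iff[symmetric] by measurable
  have "AE x in lborel. U (t, x) = propagator t u x" for t
    using ev_tendsto_propagator[OF u, folded h_def, OF s, of t]
    by eventually_elim (auto simp: U_def convergent_def limI)
  then have "\<exists>U. U \<in> borel_measurable lborel \<and> (\<forall>t. AE x in lborel. U (t, x) = propagator t u x)"
    using U by auto
  from someI_ex[OF this] show "evolution u \<in> borel_measurable borel" "AE x in lborel. evolution u (t, x) = propagator t u x"
    unfolding evolution_def by auto
qed

text \<open>Convergence almost everywhere on each slice becomes convergence almost everywhere in
  space-time by Fubini, once the set of convergence is known to be jointly measurable.\<close>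

lemma ev_tendsto_evolution:
  assumes u: "u \<in> L2" and s: "\<And>k. l2norm (\<lambda>\<xi>. trunc (s k) (fourier_L2 u) \<xi> - fourier_L2 u \<xi>) \<le> (1/2)^k"
  shows "AE p in lborel. (\<lambda>k. ev (s k) (fourier_L2 u) p) \<longlonglongrightarrow> evolution u p"
proof -
  define h where "h = fourier_L2 u"
  have [measurable]: "h \<in> borel_measurable borel" unfolding h_def by (rule L2_measurable[OF fourier_L2(1)[OF u]])
  have [measurable]: "evolution u \<in> borel_measurable borel" by (rule evolution_spec[OF u])
  \<comment> \<open>Convergence to \<open>evolution u\<close> rephrased through
    \<open>Cauchy\<close> and \<open>lim\<close>, a form in which the measurability of the set is
    derived automatically.\<close>
  let ?P = "\<lambda>p. Cauchy (\<lambda>k. ev (s k) h p) \<and> lim (\<lambda>k. ev (s k) h p) = evolution u p"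
  have iff: "?P p \<longleftrightarrow> (\<lambda>k. ev (s k) h p) \<longlonglongrightarrow> evolution u p" for p
    by (metis Cauchy_convergent_iff convergent_LIMSEQ_iff convergentI limI)
  have 1: "AE t in lborel. AE x in lborel. ?P (t, x)"
  proof (rule AE_I2)
    fix t
    show "AE x in lborel. ?P (t, x)"
      using ev_tendsto_propagator[OF u s, of t] evolution_spec(2)[OF u, of t]
      unfolding iff by eventually_elim (simp add: h_def)
  qed
  have 2: "{p \<in> space (lborel \<Otimes>\<^sub>M lborel). ?P p} \<in> sets (lborel \<Otimes>\<^sub>M lborel :: (real \<times> (real^2)) measure)"
    unfolding lborel_prod by measurable
  have "AE p in (lborel \<Otimes>\<^sub>M lborel). ?P p" by (rule lborel_pair.AE_pair_measure[OF 2 1])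
  then have "AE p in lborel. ?P p" by (simp only: lborel_prod)
  then show ?thesis unfolding iff unfolding h_def .
qed

section \<open>Level sets of the dispersion relation\<close>

text \<open>The hypothesis says that the image of Lebesgue measure on A under \<Phi> has density at
  most C. Rather than constructing that density, \<psi> is averaged over a short interval above
  \<open>\<Phi> x\<close>. After Fubini the hypothesis applies to thin strips, and continuity of
  \<psi> with Fatou's lemma removes the averaging.\<close>

lemma nn_integral_comp_le:
  fixes \<Phi> :: "'a::euclidean_space \<Rightarrow> real" and \<psi> :: "real \<Rightarrow> real"
  assumes [measurable]: "\<Phi> \<in> borel_measurable borel" "A \<in> sets borel"
    and c: "continuous_on UNIV \<psi>" and nn: "\<And>\<tau>. 0 \<le> \<psi> \<tau>" and C: "0 \<le> C"
    and b: "\<And>a b. a \<le> b \<Longrightarrow> emeasure lborel {x\<in>A. a < \<Phi> x \<and> \<Phi> x \<le> b} \<le> ennreal (C * (b - a))"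
  shows "(\<integral>\<^sup>+x. indicator A x * ennreal (\<psi> (\<Phi> x)) \<partial>lborel) \<le> ennreal C * (\<integral>\<^sup>+\<tau>. ennreal (\<psi> \<tau>) \<partial>lborel)"
proof -
  have [measurable]: "\<psi> \<in> borel_measurable borel" using c by (rule borel_measurable_continuous_onI)
  let ?d = "\<lambda>n. 1 / real (Suc n)"
  let ?F = "\<lambda>n x s. indicator A x * (indicator {0..<1} s * ennreal (\<psi> (\<Phi> x + ?d n * s)))"
  have lim: "(\<lambda>n. ?F n x s) \<longlonglongrightarrow> indicator A x * (indicator {0..<1} s * ennreal (\<psi> (\<Phi> x)))" for x and s :: real
  proof -
    have "(\<lambda>n. \<Phi> x + inverse (real (Suc n)) * s) \<longlonglongrightarrow> \<Phi> x + 0 * s"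
      by (intro tendsto_intros LIMSEQ_inverse_real_of_nat)
    then have "(\<lambda>n. \<Phi> x + ?d n * s) \<longlonglongrightarrow> \<Phi> x" by (simp add: inverse_eq_divide)
    then have "(\<lambda>n. \<psi> (\<Phi> x + ?d n * s)) \<longlonglongrightarrow> \<psi> (\<Phi> x)"
      using c by (auto simp: continuous_on_eq_continuous_at intro: isCont_tendsto_compose)
    then have "(\<lambda>n. ennreal (\<psi> (\<Phi> x + ?d n * s))) \<longlonglongrightarrow> ennreal (\<psi> (\<Phi> x))" by (rule tendsto_ennrealI)
    then show ?thesis by (auto simp: indicator_def)
  qed
  have each: "(\<integral>\<^sup>+x. \<integral>\<^sup>+s. ?F n x s \<partial>lborel \<partial>lborel) \<le> ennreal C * (\<integral>\<^sup>+\<tau>. ennreal (\<psi> \<tau>) \<partial>lborel)" for n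
  proof -
    have d: "?d n > 0" by simp
    have "(\<integral>\<^sup>+s. ?F n x s \<partial>lborel) = (\<integral>\<^sup>+\<sigma>. ennreal (real (Suc n)) * (ennreal (\<psi> \<sigma>) * indicator {x\<in>A. \<sigma> - ?d n < \<Phi> x \<and> \<Phi> x \<le> \<sigma>} x) \<partial>lborel)" for x
    proof -
      have "(\<integral>\<^sup>+\<sigma>. ennreal (\<psi> \<sigma>) * indicator {x\<in>A. \<sigma> - ?d n < \<Phi> x \<and> \<Phi> x \<le> \<sigma>} x \<partial>lborel) =
        ennreal (?d n) * (\<integral>\<^sup>+s. ennreal (\<psi> (\<Phi> x + ?d n * s)) * indicator {x\<in>A. \<Phi> x + ?d n * s - ?d n < \<Phi> x \<and> \<Phi> x \<le> \<Phi> x + ?d n * s} x \<partial>lborel)"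
        by (subst nn_integral_real_affine[where c="?d n" and t="\<Phi> x"]) (auto simp: indicator_def)
      also have "(\<lambda>s. ennreal (\<psi> (\<Phi> x + ?d n * s)) * indicator {x\<in>A. \<Phi> x + ?d n * s - ?d n < \<Phi> x \<and> \<Phi> x \<le> \<Phi> x + ?d n * s} x) = (\<lambda>s. ?F n x s)"
      proof
        fix s
        \<comment> \<open>Under \<sigma> = \<open>\<Phi> x + ?d n * s\<close> the range 0 \<le> s <
          1 is exactly the half-open strip \<sigma> - \<open>?d n\<close> < \<open>\<Phi> x\<close>
          \<le> \<sigma>, which is a level set in x once \<sigma> is fixed.\<close>
        have "t + d * s - d < t \<longleftrightarrow> s < 1" "t \<le> t + d * s \<longleftrightarrow> 0 \<le> s" if "d > 0" for d t :: real
          using that mult_less_cancel_left_pos[of d s 1] by (auto simp: zero_le_mult_iff)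
        from this[OF d] show "ennreal (\<psi> (\<Phi> x + ?d n * s)) * indicator {x\<in>A. \<Phi> x + ?d n * s - ?d n < \<Phi> x \<and> \<Phi> x \<le> \<Phi> x + ?d n * s} x = ?F n x s"
          by (auto simp: indicator_def)
      qed
      finally have "ennreal (real (Suc n)) * (\<integral>\<^sup>+\<sigma>. ennreal (\<psi> \<sigma>) * indicator {x\<in>A. \<sigma> - ?d n < \<Phi> x \<and> \<Phi> x \<le> \<sigma>} x \<partial>lborel) =
        (ennreal (real (Suc n)) * ennreal (?d n)) * (\<integral>\<^sup>+s. ?F n x s \<partial>lborel)" by (simp only: mult.assoc)
      also have "ennreal (real (Suc n)) * ennreal (?d n) = 1"
        by (subst ennreal_mult[symmetric]) (auto simp del: of_nat_Suc)
      finally show ?thesis by (subst nn_integral_cmult) (auto simp: indicator_def)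
    qed
    then have "(\<integral>\<^sup>+x. \<integral>\<^sup>+s. ?F n x s \<partial>lborel \<partial>lborel) =
      (\<integral>\<^sup>+x. \<integral>\<^sup>+\<sigma>. ennreal (real (Suc n)) * (ennreal (\<psi> \<sigma>) * indicator {x\<in>A. \<sigma> - ?d n < \<Phi> x \<and> \<Phi> x \<le> \<sigma>} x) \<partial>lborel \<partial>lborel)" by simp
    also have "\<dots> = (\<integral>\<^sup>+\<sigma>. \<integral>\<^sup>+x. ennreal (real (Suc n)) * (ennreal (\<psi> \<sigma>) * indicator {x\<in>A. \<sigma> - ?d n < \<Phi> x \<and> \<Phi> x \<le> \<sigma>} x) \<partial>lborel \<partial>lborel)"
      by (rule lborel_pair.Fubini') (simp add: indicator_def, measurable)
    also have "\<dots> = (\<integral>\<^sup>+\<sigma>. ennreal (real (Suc n)) * (ennreal (\<psi> \<sigma>) * emeasure lborel {x\<in>A. \<sigma> - ?d n < \<Phi> x \<and> \<Phi> x \<le> \<sigma>}) \<partial>lborel)"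
      by (intro nn_integral_cong) (simp add: nn_integral_cmult)
    also have "\<dots> \<le> (\<integral>\<^sup>+\<sigma>. ennreal (real (Suc n)) * (ennreal (\<psi> \<sigma>) * ennreal (C * ?d n)) \<partial>lborel)"
      using b[of "\<sigma> - ?d n" \<sigma> for \<sigma>] by (intro nn_integral_mono mult_left_mono) auto
    also have "\<dots> = (\<integral>\<^sup>+\<sigma>. ennreal C * ennreal (\<psi> \<sigma>) \<partial>lborel)"
    proof (intro nn_integral_cong)
      fix \<sigma>
      have "real (Suc n) * (\<psi> \<sigma> * (C * ?d n)) = C * \<psi> \<sigma>" by (simp add: field_simps del: of_nat_Suc)
      then have "ennreal (real (Suc n) * (\<psi> \<sigma> * (C * ?d n))) = ennreal (C * \<psi> \<sigma>)" by (rule arg_cong)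
      then show "ennreal (real (Suc n)) * (ennreal (\<psi> \<sigma>) * ennreal (C * ?d n)) = ennreal C * ennreal (\<psi> \<sigma>)"
        using C nn[of \<sigma>] by (simp only: ennreal_mult mult_nonneg_nonneg of_nat_0_le_iff zero_le_divide_1_iff)
    qed
    also have "\<dots> = ennreal C * (\<integral>\<^sup>+\<tau>. ennreal (\<psi> \<tau>) \<partial>lborel)" by (rule nn_integral_cmult) measurable
    finally show ?thesis .
  qed
  have "(\<integral>\<^sup>+x. indicator A x * ennreal (\<psi> (\<Phi> x)) \<partial>lborel) =
    (\<integral>\<^sup>+x. \<integral>\<^sup>+(s::real). indicator A x * (indicator {0..<1} s * ennreal (\<psi> (\<Phi> x))) \<partial>lborel \<partial>lborel)"
    by (intro nn_integral_cong) (simp add: nn_integral_cmult nn_integral_multc)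
  also have "\<dots> = (\<integral>\<^sup>+x. \<integral>\<^sup>+s. liminf (\<lambda>n. ?F n x s) \<partial>lborel \<partial>lborel)"
    by (intro nn_integral_cong lim_imp_Liminf[OF trivial_limit_sequentially, symmetric] lim)
  also have "\<dots> \<le> (\<integral>\<^sup>+x. liminf (\<lambda>n. \<integral>\<^sup>+s. ?F n x s \<partial>lborel) \<partial>lborel)"
    by (intro nn_integral_mono nn_integral_liminf) measurable
  also have "\<dots> \<le> liminf (\<lambda>n. \<integral>\<^sup>+x. \<integral>\<^sup>+s. ?F n x s \<partial>lborel \<partial>lborel)"
    by (intro nn_integral_liminf) measurable
  also have "\<dots> \<le> liminf (\<lambda>n. ennreal C * (\<integral>\<^sup>+\<tau>. ennreal (\<psi> \<tau>) \<partial>lborel))"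
    by (intro Liminf_mono always_eventually allI each)
  finally show ?thesis by (simp add: Liminf_const)
qed

section \<open>Convexity of the fourth power of the norm\<close>

lemma norm4_lower:
  fixes a \<eta> :: "'a::real_inner"
  shows "norm (a + \<eta>) ^ 4 \<ge> norm a ^ 4 + 4 * (norm a)\<^sup>2 * (a \<bullet> \<eta>) + norm \<eta> ^ 4 / 3"
proof -
  define p q r where "p = (norm a)\<^sup>2" and "q = a \<bullet> \<eta>" and "r = (norm \<eta>)\<^sup>2"
  have "(norm (a + \<eta>))\<^sup>2 = p + 2 * q + r"
    by (simp add: p_def q_def r_def power2_norm_eq_inner inner_add_left inner_add_right inner_commute)
  then have 1: "norm (a + \<eta>) ^ 4 = (p + 2 * q + r)\<^sup>2" by (metis numeral_Bit0_eq_double power_mult mult_2 numeral_Bit0 power2_eq_square power_add)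
  have 2: "norm a ^ 4 = p\<^sup>2" "norm \<eta> ^ 4 = r\<^sup>2" by (simp_all add: p_def r_def flip: power_mult)
  have "\<bar>q\<bar> \<le> norm a * norm \<eta>" unfolding q_def by (rule Cauchy_Schwarz_ineq2)
  then have "q\<^sup>2 \<le> p * r" unfolding p_def r_def power_mult_distrib[symmetric] using power_mono[of "\<bar>q\<bar>" "norm a * norm \<eta>" 2] by simp
  \<comment> \<open>With \<open>q\<^sup>2 \<le> p * r\<close> the difference of the two sides is at
    least \<open>6 * (q + r / 3)\<^sup>2\<close>; the constant 1/3 in the statement is what
    completes this square.\<close>
  moreover have "(q + r / 3)\<^sup>2 \<ge> 0" by simp
  ultimately have "(p + 2 * q + r)\<^sup>2 \<ge> p\<^sup>2 + 4 * p * q + r\<^sup>2 / 3"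
    by (simp add: power2_eq_square algebra_simps)
  then show ?thesis unfolding 1 2 by (simp add: p_def q_def)
qed

lemma power4_convex:
  fixes x y l :: real
  assumes "0 \<le> x" "0 \<le> y" "0 \<le> l" "l \<le> 1"
  shows "((1 - l) * x + l * y) ^ 4 \<le> (1 - l) * x ^ 4 + l * y ^ 4"
proof -
  have sq: "((1 - l) * x + l * y)\<^sup>2 \<le> (1 - l) * x\<^sup>2 + l * y\<^sup>2" for x y :: real
  proof -
    have "(1 - l) * x\<^sup>2 + l * y\<^sup>2 - ((1 - l) * x + l * y)\<^sup>2 = l * (1 - l) * (x - y)\<^sup>2"
      by (simp add: power2_eq_square algebra_simps)
    moreover have "\<dots> \<ge> 0" using assms by simp
    ultimately show ?thesis by linarith
  qed
  have "(((1 - l) * x + l * y)\<^sup>2)\<^sup>2 \<le> ((1 - l) * x\<^sup>2 + l * y\<^sup>2)\<^sup>2"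
    by (intro power_mono sq) auto
  also have "\<dots> \<le> (1 - l) * (x\<^sup>2)\<^sup>2 + l * (y\<^sup>2)\<^sup>2" by (rule sq)
  finally show ?thesis by (simp flip: power_mult)
qed

text \<open>The energy of three momenta with total momentum \<xi>, as a function of the last
  two.\<close>

definition psi3 :: "real^2 \<Rightarrow> (real^2) \<times> (real^2) \<Rightarrow> real" where
  "psi3 \<xi> q = norm (\<xi> - fst q - snd q) ^ 4 + norm (fst q) ^ 4 + norm (snd q) ^ 4"

lemma psi3_measurable [measurable]: "psi3 \<xi> \<in> borel_measurable borel"
  unfolding psi3_def by (intro borel_measurable_continuous_onI continuous_intros)


lemma emeasure_norm_le:
  assumes "0 \<le> R"
  shows "emeasure lborel {x::'a::euclidean_space. norm x \<le> R} \<le> ennreal ((2 * R) ^ DIM('a))"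
proof -
  have "emeasure lborel {x::'a. norm x \<le> R} \<le> emeasure lborel (cbox (- (R *\<^sub>R One)) (R *\<^sub>R One) :: 'a set)"
  proof (intro emeasure_mono subsetI)
    fix x :: 'a assume x: "x \<in> {x. norm x \<le> R}"
    have "\<bar>x \<bullet> b\<bar> \<le> R" if "b \<in> Basis" for b using Basis_le_norm[OF that, of x] x by simp
    then show "x \<in> cbox (- (R *\<^sub>R One)) (R *\<^sub>R One)" by (auto simp: mem_box abs_le_iff minus_le_iff)
  qed simp
  also have "\<dots> = ennreal ((2 * R) ^ DIM('a))"
  proof -
    have *: "(R *\<^sub>R One - - (R *\<^sub>R One)) \<bullet> b = 2 * R" if "b \<in> Basis" for b :: 'a
      using that by (simp add: inner_add_left)
    then have "(\<Prod>b\<in>(Basis::'a set). (R *\<^sub>R One - - (R *\<^sub>R One)) \<bullet> b) = (2 * R) ^ DIM('a)"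
      by (simp only: prod.cong[OF refl *] prod_constant)
    then show ?thesis using assms by (subst emeasure_lborel_cbox) auto
  qed
  finally show ?thesis .
qed

lemma emeasure_norm_le_prod:
  assumes "0 \<le> R" "0 \<le> R'"
  shows "emeasure lborel {q::(real^2) \<times> (real^2). norm (fst q) \<le> R \<and> norm (snd q) \<le> R'} \<le> ennreal ((2 * R)^2 * (2 * R')^2)"
proof -
  have "{q::(real^2) \<times> (real^2). norm (fst q) \<le> R \<and> norm (snd q) \<le> R'} = {x. norm x \<le> R} \<times> {x. norm x \<le> R'}" by auto
  then have "emeasure lborel {q::(real^2) \<times> (real^2). norm (fst q) \<le> R \<and> norm (snd q) \<le> R'} =
     emeasure lborel {x::real^2. norm x \<le> R} * emeasure lborel {x::real^2. norm x \<le> R'}"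
    unfolding lborel_prod[symmetric] by (simp add: lborel.emeasure_pair_measure_Times)
  also have "\<dots> \<le> ennreal ((2 * R)^2) * ennreal ((2 * R')^2)"
    using emeasure_norm_le[OF assms(1), where 'a="real^2"] emeasure_norm_le[OF assms(2), where 'a="real^2"]
    by (intro mult_mono) auto
  finally show ?thesis by (subst ennreal_mult) auto
qed

text \<open>After recentring at the minimiser, the sublevel sets scale at least like dilations of a convex
  function, so the fourfold homogeneity of the volume controls the volume between two levels.\<close>

lemma psi3_level_set:
  assumes ab: "a \<le> b"
  shows "emeasure lborel {q. a < psi3 \<xi> q \<and> psi3 \<xi> q \<le> b} \<le> ennreal (192 * (b - a))"
proof -
  \<comment> \<open>Three momenta with sum \<xi> have least energy when they are all equal to \<xi>
    / 3.\<close>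
  define c where "c = (1/3) *\<^sub>R \<xi>"
  define G where "G \<eta> = psi3 \<xi> ((c, c) + \<eta>) - 3 * norm c ^ 4" for \<eta>
  have [measurable]: "G \<in> borel_measurable borel" unfolding G_def by measurable
  have xi: "\<xi> = c + c + c" unfolding c_def by (simp flip: scaleR_left.add)
  have G: "G \<eta> = norm (c + (- fst \<eta> - snd \<eta>)) ^ 4 + norm (c + fst \<eta>) ^ 4 + norm (c + snd \<eta>) ^ 4 - 3 * norm c ^ 4" for \<eta>
    unfolding G_def psi3_def by (simp add: xi algebra_simps)
  \<comment> \<open>The three displacements from c add up to zero, so the linear terms of
    \<open>norm4_lower\<close> cancel and the quartic remainders stay.\<close>
  have lower: "G \<eta> \<ge> norm (fst \<eta>) ^ 4 / 3 + norm (snd \<eta>) ^ 4 / 3" for \<eta>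
  proof -
    have "c \<bullet> (- fst \<eta> - snd \<eta>) + c \<bullet> fst \<eta> + c \<bullet> snd \<eta> = 0" by (simp add: inner_diff_right)
    then have "4 * (norm c)\<^sup>2 * (c \<bullet> (- fst \<eta> - snd \<eta>)) + 4 * (norm c)\<^sup>2 * (c \<bullet> fst \<eta>) + 4 * (norm c)\<^sup>2 * (c \<bullet> snd \<eta>) = 0"
      by (simp only: distrib_left[symmetric])
    moreover have "0 \<le> norm (- fst \<eta> - snd \<eta>) ^ 4 / 3" by simp
    ultimately show ?thesis
      using norm4_lower[of c "- fst \<eta> - snd \<eta>"] norm4_lower[of c "fst \<eta>"] norm4_lower[of c "snd \<eta>"]
      unfolding G by linarith
  qed
  have conv: "G (l *\<^sub>R \<eta>) \<le> l * G \<eta>" if l: "0 \<le> l" "l \<le> 1" for l \<eta>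
  proof -
    have n: "norm (c + l *\<^sub>R x) ^ 4 \<le> (1 - l) * norm c ^ 4 + l * norm (c + x) ^ 4" for x :: "real^2"
    proof -
      have "c + l *\<^sub>R x = (1 - l) *\<^sub>R c + l *\<^sub>R (c + x)" by (simp add: algebra_simps)
      then have "norm (c + l *\<^sub>R x) \<le> (1 - l) * norm c + l * norm (c + x)"
        using norm_triangle_ineq[of "(1 - l) *\<^sub>R c" "l *\<^sub>R (c + x)"] l by simp
      then have "norm (c + l *\<^sub>R x) ^ 4 \<le> ((1 - l) * norm c + l * norm (c + x)) ^ 4" by (intro power_mono) auto
      also have "\<dots> \<le> (1 - l) * norm c ^ 4 + l * norm (c + x) ^ 4" using l by (intro power4_convex) auto
      finally show ?thesis .
    qed
    have "- fst (l *\<^sub>R \<eta>) - snd (l *\<^sub>R \<eta>) = l *\<^sub>R (- fst \<eta> - snd \<eta>)" by (simp add: algebra_simps)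
    then show ?thesis
      using n[of "- fst \<eta> - snd \<eta>"] n[of "fst \<eta>"] n[of "snd \<eta>"] unfolding G by (simp add: algebra_simps)
  qed
  define L where "L \<beta> = {\<eta>. G \<eta> \<le> \<beta>}" for \<beta>
  have [measurable]: "L \<beta> \<in> sets borel" for \<beta> unfolding L_def by measurable
  have G0: "0 \<le> G \<eta>" for \<eta> by (rule order_trans[OF _ lower]) simp
  \<comment> \<open>Both displacements lie in discs whose radius is the fourth root of
    \<open>3 * \<beta>\<close>. Enclosing each disc in a square gives 48 = 16 * 3.\<close>
  have vol: "emeasure lborel (L \<beta>) \<le> ennreal (48 * \<beta>)" if "0 \<le> \<beta>" for \<beta>
  proof -
    let ?R = "sqrt (sqrt (3 * \<beta>))"
    have le: "norm x \<le> ?R" if "norm x ^ 4 \<le> 3 * \<beta>" for x :: "real^2"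
      by (intro real_le_rsqrt) (use that in \<open>simp flip: power_mult\<close>)
    have "L \<beta> \<subseteq> {q. norm (fst q) \<le> ?R \<and> norm (snd q) \<le> ?R}"
    proof
      fix \<eta> assume "\<eta> \<in> L \<beta>"
      then have "norm (fst \<eta>) ^ 4 / 3 + norm (snd \<eta>) ^ 4 / 3 \<le> \<beta>" using lower[of \<eta>] by (simp add: L_def)
      moreover have "0 \<le> norm (fst \<eta>) ^ 4" "0 \<le> norm (snd \<eta>) ^ 4" by auto
      ultimately have "norm (fst \<eta>) ^ 4 \<le> 3 * \<beta>" "norm (snd \<eta>) ^ 4 \<le> 3 * \<beta>" by linarith+
      then show "\<eta> \<in> {q. norm (fst q) \<le> ?R \<and> norm (snd q) \<le> ?R}" using le by blast
    qed
    then have "emeasure lborel (L \<beta>) \<le> emeasure lborel {q::(real^2) \<times> (real^2). norm (fst q) \<le> ?R \<and> norm (snd q) \<le> ?R}"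
      by (intro emeasure_mono) auto
    also have "\<dots> \<le> ennreal ((2 * ?R)^2 * (2 * ?R)^2)" using that by (intro emeasure_norm_le_prod) auto
    also have "(2 * ?R)^2 * (2 * ?R)^2 = 48 * \<beta>" using that by (simp add: power_mult_distrib)
    finally show ?thesis .
  qed
  \<comment> \<open>By \<open>conv\<close> the dilation by l maps \<open>L \<beta>\<close> into
    \<open>L (l * \<beta>)\<close>, and in dimension four it multiplies volumes by
    \<open>l ^ 4\<close>.\<close>
  have scale: "ennreal (l ^ 4) * emeasure lborel (L \<beta>) \<le> emeasure lborel (L (l * \<beta>))" if l: "0 < l" "l \<le> 1" for l \<beta>
  proof -
    have "emeasure lborel (L (l * \<beta>)) = ennreal (l ^ 4) * (\<integral>\<^sup>+\<eta>. indicator (L (l * \<beta>)) (0 + l *\<^sub>R \<eta>) \<partial>lborel)"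
      using nn_integral_scale[of "indicator (L (l * \<beta>))" l 0] l by simp
    moreover have "(\<integral>\<^sup>+\<eta>. indicator (L \<beta>) \<eta> \<partial>lborel) \<le> (\<integral>\<^sup>+\<eta>. indicator (L (l * \<beta>)) (0 + l *\<^sub>R \<eta>) \<partial>lborel)"
    proof (intro nn_integral_mono)
      fix \<eta>
      have "\<eta> \<in> L \<beta> \<Longrightarrow> l *\<^sub>R \<eta> \<in> L (l * \<beta>)"
        unfolding L_def mem_Collect_eq using l by (intro order_trans[OF conv mult_left_mono]) auto
      then show "indicator (L \<beta>) \<eta> \<le> (indicator (L (l * \<beta>)) (0 + l *\<^sub>R \<eta>) :: ennreal)"
        by (auto simp: indicator_def)
    qed
    ultimately show ?thesis by (simp add: mult_left_mono)
  qed
  have main: "emeasure lborel {\<eta>. a < G \<eta> \<and> G \<eta> \<le> b} \<le> ennreal (192 * (b - a))" if ab: "a \<le> b" for a b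
  proof -
    \<comment> \<open>Sets at negative levels are empty because G is nonnegative. The level a = 0 is
      separated because the dilation factor a / b must be positive.\<close>
    consider "b < 0" | "a < 0" "0 \<le> b" | "0 \<le> a" "a = b" | "a = 0" "0 < b" | "0 < a" "a < b" using ab by linarith
    then show ?thesis
    proof cases
      case 1
      then have "{\<eta>. a < G \<eta> \<and> G \<eta> \<le> b} = {}" using G0 by (auto simp: not_le intro: less_le_trans)
      then show ?thesis by (simp only: emeasure_empty zero_le)
    next
      case 2
      have "emeasure lborel {\<eta>. a < G \<eta> \<and> G \<eta> \<le> b} \<le> emeasure lborel (L b)" by (intro emeasure_mono) (auto simp: L_def)
      also have "\<dots> \<le> ennreal (48 * b)" by (rule vol[OF 2(2)])
      also have "\<dots> \<le> ennreal (192 * (b - a))" using 2 by (intro ennreal_leI) auto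
      finally show ?thesis .
    next
      case 3
      then have "{\<eta>. a < G \<eta> \<and> G \<eta> \<le> b} = {}" by auto
      then show ?thesis by (simp only: emeasure_empty zero_le)
    next
      case 4
      have "emeasure lborel {\<eta>. a < G \<eta> \<and> G \<eta> \<le> b} \<le> emeasure lborel (L b)" by (intro emeasure_mono) (auto simp: L_def)
      also have "\<dots> \<le> ennreal (48 * b)" using 4 by (intro vol) auto
      also have "\<dots> \<le> ennreal (192 * (b - a))" using 4 by (intro ennreal_leI) auto
      finally show ?thesis .
    next
      case 5
      define l where "l = a / b"
      have l: "0 < l" "l \<le> 1" "l * b = a" using 5 by (auto simp: l_def)
      have vb: "emeasure lborel (L b) \<le> ennreal (48 * b)" using 5 by (intro vol) auto
      then have "emeasure lborel (L b) < \<infinity>" by (rule le_less_trans) simp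
      then obtain v where v: "emeasure lborel (L b) = ennreal v" "0 \<le> v" by (cases "emeasure lborel (L b)") auto
      have vle: "v \<le> 48 * b" using vb v 5 by (simp add: ennreal_le_iff)
      have sub: "L a \<subseteq> L b" using 5 by (auto simp: L_def)
      have "emeasure lborel (L a) \<le> ennreal v" using emeasure_mono[OF sub, of lborel] v by simp
      then have "emeasure lborel (L a) < \<infinity>" by (rule le_less_trans) simp
      then obtain w where w: "emeasure lborel (L a) = ennreal w" "0 \<le> w" by (cases "emeasure lborel (L a)") auto
      have "ennreal (l ^ 4) * ennreal v \<le> ennreal w" using scale[OF l(1,2), of b] v w l(3) by simp
      then have lw: "l ^ 4 * v \<le> w" using w l v by (simp add: ennreal_mult[symmetric] ennreal_le_iff)
      have "{\<eta>. a < G \<eta> \<and> G \<eta> \<le> b} = L b - L a" by (auto simp: L_def)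
      then have "emeasure lborel {\<eta>. a < G \<eta> \<and> G \<eta> \<le> b} = ennreal v - ennreal w"
        using emeasure_Diff[of lborel "L a" "L b"] sub v w by simp
      also have "\<dots> = ennreal (v - w)" using w by (simp add: ennreal_minus)
      also have "\<dots> \<le> ennreal (192 * (b - a))"
      proof (intro ennreal_leI)
        \<comment> \<open>Bernoulli's inequality bounds \<open>1 - l ^ 4\<close> by
          \<open>4 * (1 - l)\<close>; together with \<open>vol\<close> this yields 192 = 4 *
          48.\<close>
        have "1 + real 4 * (l - 1) \<le> (1 + (l - 1)) ^ 4" using l by (intro Bernoulli_inequality) auto
        then have "1 - 4 * (1 - l) \<le> l ^ 4" by simp
        then have "(1 - 4 * (1 - l)) * v \<le> l ^ 4 * v" using v by (intro mult_right_mono)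
        then have "v - w \<le> 4 * (1 - l) * v" using lw by (simp add: algebra_simps)
        also have "\<dots> \<le> 4 * (1 - l) * (48 * b)" using vle l by (intro mult_left_mono) auto
        also have "\<dots> = 192 * (b - l * b)" by (simp add: algebra_simps)
        finally show "v - w \<le> 192 * (b - a)" using l by simp
      qed
      finally show ?thesis .
    qed
  qed
  have "emeasure lborel {q. a < psi3 \<xi> q \<and> psi3 \<xi> q \<le> b} = (\<integral>\<^sup>+q. indicator {q. a < psi3 \<xi> q \<and> psi3 \<xi> q \<le> b} q \<partial>lborel)" by simp
  also have "\<dots> = (\<integral>\<^sup>+\<eta>. indicator {q. a < psi3 \<xi> q \<and> psi3 \<xi> q \<le> b} ((c, c) + \<eta>) \<partial>lborel)"
    by (rule nn_integral_shift[symmetric]) measurable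
  also have "\<dots> = (\<integral>\<^sup>+\<eta>. indicator {\<eta>. a - 3 * norm c ^ 4 < G \<eta> \<and> G \<eta> \<le> b - 3 * norm c ^ 4} \<eta> \<partial>lborel)"
    by (intro nn_integral_cong) (auto simp: G_def indicator_def)
  also have "\<dots> \<le> ennreal (192 * (b - a))" using main[of "a - 3 * norm c ^ 4" "b - 3 * norm c ^ 4"] ab by simp
  finally show ?thesis .
qed

text \<open>If \<open>\<xi> - p\<^sub>2 - p\<^sub>3\<close> is large while \<open>p\<^sub>2, p\<^sub>3\<close> are small, then \<open>psi3 \<xi>\<close> grows fast when \<open>p\<^sub>2\<close> is
  translated in the direction \<open>- \<xi>\<close>. Averaging over such translations bounds the volume.\<close>

lemma psi3_level_set_high:
  fixes \<xi> :: "real^2"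
  assumes s: "s \<ge> 8" and ab: "a \<le> b"
  defines "P \<equiv> {q. norm (fst q) \<le> s \<and> norm (snd q) \<le> s \<and> norm (\<xi> - fst q - snd q) \<ge> s\<^sup>2}"
  shows "emeasure lborel {q\<in>P. a < psi3 \<xi> q \<and> psi3 \<xi> q \<le> b} \<le> ennreal (128 / s ^ 3 * (b - a))"
proof (cases "{q\<in>P. a < psi3 \<xi> q \<and> psi3 \<xi> q \<le> b} = {}")
  case True
  then show ?thesis by (simp only: emeasure_empty zero_le)
next
  case False
  have s0: "s > 0" using s by simp
  define S where "S = {q\<in>P. a < psi3 \<xi> q \<and> psi3 \<xi> q \<le> b}"
  have P[measurable]: "P \<in> sets borel"
  proof -
    have "closed P" unfolding P_def by (intro closed_Collect_conj closed_Collect_le continuous_intros)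
    then show ?thesis by simp
  qed
  have S[measurable]: "S \<in> sets borel" unfolding S_def by measurable
  obtain q0 where "q0 \<in> P" using False by auto
  then have "s\<^sup>2 \<le> norm \<xi> + s + s"
    using norm_triangle_ineq4[of "\<xi> - fst q0" "snd q0"] norm_triangle_ineq4[of \<xi> "fst q0"] by (simp add: P_def)
  then have x1: "norm \<xi> \<ge> s\<^sup>2 - 2 * s" by simp
  \<comment> \<open>The place where s \<ge> 8 matters: it makes \<open>s\<^sup>2 - 4 * s\<close> at
    least half of \<open>s\<^sup>2\<close>, which is the bound needed for
    \<open>z \<bullet> e\<close>.\<close>
  have s8: "8 * s \<le> s\<^sup>2" using s by (simp add: power2_eq_square)
  have x0: "norm \<xi> > 0" using x1 s8 s0 by linarith
  define e where "e = (1 / norm \<xi>) *\<^sub>R \<xi>"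
  have e: "norm e = 1" "\<xi> \<bullet> e = norm \<xi>" using x0 by (auto simp: e_def power2_norm_eq_inner[symmetric] power2_eq_square)
  \<comment> \<open>Translation by \<tau> raises the energy by at least
    \<open>\<tau> * s ^ 6\<close>, so two translates can share a strip of height b - a only if their
    parameters differ by at most L.\<close>
  define L where "L = (b - a) / s ^ 6"
  have L0: "0 \<le> L" using ab s0 by (simp add: L_def)
  have key: "t' - t \<le> L" if "x - (t *\<^sub>R e, 0) \<in> S" "x - (t' *\<^sub>R e, 0) \<in> S" "t < t'" for x t t'
  proof -
    define q where "q = x - (t *\<^sub>R e, 0)"
    define \<tau> where "\<tau> = t' - t"
    have \<tau>: "\<tau> > 0" using that by (simp add: \<tau>_def)
    have q': "x - (t' *\<^sub>R e, 0) = (fst q - \<tau> *\<^sub>R e, snd q)"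
      by (simp add: q_def \<tau>_def prod_eq_iff algebra_simps)
    have qS: "q \<in> S" "(fst q - \<tau> *\<^sub>R e, snd q) \<in> S" using that(1) that(2)[unfolded q'] by (simp_all only: q_def)
    define z where "z = \<xi> - fst q - snd q"
    have z: "norm z \<ge> s\<^sup>2" and fq: "norm (fst q) \<le> s" and sq: "norm (snd q) \<le> s" and fq': "norm (fst q - \<tau> *\<^sub>R e) \<le> s"
      using qS by (auto simp: S_def P_def z_def)
    have "\<bar>fst q \<bullet> e\<bar> \<le> s" "\<bar>snd q \<bullet> e\<bar> \<le> s"
      using Cauchy_Schwarz_ineq2[of "fst q" e] Cauchy_Schwarz_ineq2[of "snd q" e] fq sq e by auto
    then have "z \<bullet> e \<ge> norm \<xi> - s - s" unfolding z_def inner_diff_left e(2) by linarith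
    then have ze: "2 * (z \<bullet> e) \<ge> s\<^sup>2" using x1 s8 by linarith
    have "(norm (z + \<tau> *\<^sub>R e))\<^sup>2 = (norm z)\<^sup>2 + \<tau> * (2 * (z \<bullet> e)) + \<tau>\<^sup>2 * (norm e)\<^sup>2"
      unfolding power2_norm_eq_inner
      by (simp add: inner_add_left inner_add_right inner_commute[of e z] power2_eq_square[of \<tau>] algebra_simps)
    moreover have "\<tau> * (2 * (z \<bullet> e)) \<ge> \<tau> * s\<^sup>2" using ze \<tau> by (intro mult_left_mono) auto
    moreover have "\<tau>\<^sup>2 * (norm e)\<^sup>2 \<ge> 0" by simp
    ultimately have X: "(norm (z + \<tau> *\<^sub>R e))\<^sup>2 \<ge> (norm z)\<^sup>2 + \<tau> * s\<^sup>2" by linarith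
    have Z: "(norm z)\<^sup>2 \<ge> s ^ 4" using power_mono[OF z, of 2] by (simp flip: power_mult)
    have "((norm (z + \<tau> *\<^sub>R e))\<^sup>2)\<^sup>2 \<ge> ((norm z)\<^sup>2 + \<tau> * s\<^sup>2)\<^sup>2" using \<tau> by (intro power_mono X) auto
    moreover have "((norm z)\<^sup>2 + \<tau> * s\<^sup>2)\<^sup>2 = ((norm z)\<^sup>2)\<^sup>2 + 2 * (norm z)\<^sup>2 * (\<tau> * s\<^sup>2) + (\<tau> * s\<^sup>2)\<^sup>2" unfolding power2_sum by linarith
    moreover have "(norm z)\<^sup>2 * (\<tau> * s\<^sup>2) \<ge> s ^ 4 * (\<tau> * s\<^sup>2)" using Z \<tau> by (intro mult_right_mono) auto
    moreover have "s ^ 4 * (\<tau> * s\<^sup>2) = \<tau> * s ^ 6" by (simp add: power_add[symmetric])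
    moreover have "(\<tau> * s\<^sup>2)\<^sup>2 \<ge> 0" by simp
    ultimately have "((norm (z + \<tau> *\<^sub>R e))\<^sup>2)\<^sup>2 \<ge> ((norm z)\<^sup>2)\<^sup>2 + 2 * (\<tau> * s ^ 6)" by linarith
    then have A: "norm (z + \<tau> *\<^sub>R e) ^ 4 \<ge> norm z ^ 4 + 2 * (\<tau> * s ^ 6)" by (simp flip: power_mult)
    define u v where "u = norm (fst q)" and "v = norm (fst q - \<tau> *\<^sub>R e)"
    have uv: "0 \<le> u" "u \<le> s" "0 \<le> v" "v \<le> s" using fq fq' by (auto simp: u_def v_def)
    have "u \<le> v + \<tau>" using norm_triangle_ineq[of "fst q - \<tau> *\<^sub>R e" "\<tau> *\<^sub>R e"] e \<tau> by (simp add: u_def v_def)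
    then have duv: "u - v \<le> \<tau>" by simp
    \<comment> \<open>The second momentum may lose energy under the translation, but only at a rate
      cubic in s. The first gains at twice the rate \<open>s ^ 6\<close>, which pays for the loss
      and leaves \<open>s ^ 6\<close>.\<close>
    have B: "u ^ 4 - v ^ 4 \<le> 4 * (s ^ 3 * \<tau>)"
    proof -
      have "u ^ 4 - v ^ 4 = (u - v) * ((u + v) * (u\<^sup>2 + v\<^sup>2))" by (simp add: power2_eq_square power4_eq_xxxx algebra_simps)
      also have "\<dots> \<le> \<tau> * ((u + v) * (u\<^sup>2 + v\<^sup>2))" using duv uv by (intro mult_right_mono) auto
      also have "\<dots> \<le> \<tau> * ((s + s) * (s\<^sup>2 + s\<^sup>2))" using \<tau> uv by (intro mult_left_mono mult_mono add_mono power_mono) auto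
      also have "\<dots> = 4 * (s ^ 3 * \<tau>)" by (simp add: power2_eq_square power3_eq_cube algebra_simps)
      finally show ?thesis .
    qed
    have "4 * (s ^ 3 * \<tau>) \<le> s ^ 6 * \<tau>"
    proof -
      have "4 \<le> s ^ 3" using power_mono[of 8 s 3] s by simp
      then have "4 * (s ^ 3 * \<tau>) \<le> s ^ 3 * (s ^ 3 * \<tau>)" using s0 \<tau> by (intro mult_right_mono) auto
      also have "\<dots> = s ^ 6 * \<tau>" by (simp add: power_add[symmetric] mult.assoc[symmetric])
      finally show ?thesis .
    qed
    then have C: "u ^ 4 - v ^ 4 \<le> \<tau> * s ^ 6" using B by (simp add: mult.commute)
    have z': "\<xi> - (fst q - \<tau> *\<^sub>R e) - snd q = z + \<tau> *\<^sub>R e" by (simp add: z_def algebra_simps)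
    have "psi3 \<xi> (fst q - \<tau> *\<^sub>R e, snd q) - psi3 \<xi> q = norm (z + \<tau> *\<^sub>R e) ^ 4 - norm z ^ 4 - (u ^ 4 - v ^ 4)"
      unfolding psi3_def fst_conv snd_conv z' by (simp add: z_def u_def v_def)
    then have "\<tau> * s ^ 6 \<le> psi3 \<xi> (fst q - \<tau> *\<^sub>R e, snd q) - psi3 \<xi> q" using A C by linarith
    also have "\<dots> \<le> b - a" using qS by (auto simp: S_def)
    finally show ?thesis using s0 by (simp add: L_def \<tau>_def pos_le_divide_eq)
  qed
  \<comment> \<open>W contains every x that has some translate in S with parameter t in {0..s}; the
    shift doubles the radius of the first component.\<close>
  define W where "W = {q::(real^2) \<times> (real^2). norm (fst q) \<le> 2 * s \<and> norm (snd q) \<le> s}"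
  have [measurable]: "W \<in> sets borel"
  proof -
    have "closed W" unfolding W_def by (intro closed_Collect_conj closed_Collect_le continuous_intros)
    then show ?thesis by simp
  qed
  have m[measurable]: "(\<lambda>(t, x). indicator {0..s} t * indicator S (x - (t *\<^sub>R e, 0)) :: ennreal) \<in> borel_measurable (lborel \<Otimes>\<^sub>M lborel)"
  proof -
    have "(\<lambda>p. snd p - (fst p *\<^sub>R e, 0)) \<in> borel_measurable (borel :: (real \<times> ((real^2) \<times> (real^2))) measure)"
      by (intro borel_measurable_continuous_onI continuous_intros)
    moreover have "(\<lambda>p. fst p) \<in> borel_measurable (borel :: (real \<times> ((real^2) \<times> (real^2))) measure)"
      by (intro borel_measurable_continuous_onI continuous_intros)
    ultimately have "(\<lambda>p. indicator {0..s} (fst p) * indicator S (snd p - (fst p *\<^sub>R e, 0)) :: ennreal) \<in> borel_measurable borel"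
      by measurable
    then show ?thesis by (simp add: lborel_prod case_prod_beta')
  qed
  \<comment> \<open>Average over the translates with t in {0..s}. For each x the admissible t lie in
    an interval of length 2 * L, so s times the volume is at most 2 * L times that of W, which is at
    most \<open>64 * s ^ 4\<close>; this yields \<open>128 / s ^ 3\<close>.\<close>
  have "ennreal s * emeasure lborel S = (\<integral>\<^sup>+t. indicator {0..s} t * emeasure lborel S \<partial>lborel)"
    using s0 by (simp add: nn_integral_multc)
  also have "\<dots> = (\<integral>\<^sup>+t. \<integral>\<^sup>+x. indicator {0..s} t * indicator S (x - (t *\<^sub>R e, 0)) \<partial>lborel \<partial>lborel)"
  proof (intro nn_integral_cong)
    fix t :: real
    have "(\<integral>\<^sup>+x. indicator S (x - (t *\<^sub>R e, 0)) \<partial>lborel) = (\<integral>\<^sup>+x. indicator S x \<partial>lborel)"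
      using nn_integral_shift[of "indicator S" "- (t *\<^sub>R e, 0)"] by (simp only: uminus_add_conv_diff) simp
    then show "indicator {0..s} t * emeasure lborel S = (\<integral>\<^sup>+x. indicator {0..s} t * indicator S (x - (t *\<^sub>R e, 0)) \<partial>lborel)"
      by (subst nn_integral_cmult) auto
  qed
  also have "\<dots> = (\<integral>\<^sup>+x. \<integral>\<^sup>+t. indicator {0..s} t * indicator S (x - (t *\<^sub>R e, 0)) \<partial>lborel \<partial>lborel)"
    by (rule lborel_pair.Fubini'[symmetric]) (rule m)
  also have "\<dots> \<le> (\<integral>\<^sup>+x. ennreal (2 * L) * indicator W x \<partial>lborel)"
  proof (intro nn_integral_mono)
    fix x :: "(real^2) \<times> (real^2)"
    show "(\<integral>\<^sup>+t. indicator {0..s} t * indicator S (x - (t *\<^sub>R e, 0)) \<partial>lborel) \<le> ennreal (2 * L) * indicator W x"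
    proof (cases "\<exists>t\<in>{0..s}. x - (t *\<^sub>R e, 0) \<in> S")
      case False
      then have "indicator {0..s} t * indicator S (x - (t *\<^sub>R e, 0)) = (0::ennreal)" for t by (auto simp: indicator_def)
      then show ?thesis by (simp only: nn_integral_const mult_zero_left zero_le)
    next
      case True
      then obtain t0 where t0: "t0 \<in> {0..s}" "x - (t0 *\<^sub>R e, 0) \<in> S" by blast
      have "norm (fst x) \<le> norm (fst x - t0 *\<^sub>R e) + t0"
        using norm_triangle_ineq[of "fst x - t0 *\<^sub>R e" "t0 *\<^sub>R e"] e t0 by simp
      then have "x \<in> W" using t0 by (auto simp: W_def S_def P_def)
      have "t \<in> {t0 - L .. t0 + L}" if "x - (t *\<^sub>R e, 0) \<in> S" for t
        using key[OF that t0(2)] key[OF t0(2) that] L0 by (cases t t0 rule: linorder_cases) auto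
      then have "(\<integral>\<^sup>+t. indicator {0..s} t * indicator S (x - (t *\<^sub>R e, 0)) \<partial>lborel) \<le> (\<integral>\<^sup>+t. indicator {t0 - L .. t0 + L} t \<partial>lborel)"
        by (intro nn_integral_mono) (auto simp: indicator_def)
      also have "\<dots> = ennreal (2 * L)" using L0 by simp
      finally show ?thesis using \<open>x \<in> W\<close> by simp
    qed
  qed
  also have "\<dots> = ennreal (2 * L) * emeasure lborel W" by (simp add: nn_integral_cmult)
  also have "\<dots> \<le> ennreal (2 * L) * ennreal ((2 * (2 * s))^2 * (2 * s)^2)"
    unfolding W_def using s0 by (intro mult_left_mono emeasure_norm_le_prod) auto
  also have "\<dots> = ennreal s * ennreal (128 / s ^ 3 * (b - a))"
  proof -
    have "2 * L * ((2 * (2 * s))^2 * (2 * s)^2) = s * (128 / s ^ 3 * (b - a))"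
      using s0 unfolding L_def by (simp add: field_simps) (simp add: eval_nat_numeral)
    then show ?thesis using L0 s0 ab by (simp flip: ennreal_mult)
  qed
  finally show ?thesis unfolding S_def[symmetric]
    using s0 by (simp add: ennreal_mult_le_mult_iff)
qed

section \<open>From level sets to integrals over momentum triples\<close>

definition tau3 :: "(real^2) \<times> (real^2) \<times> (real^2) \<Rightarrow> real" where
  "tau3 p = norm (fst p) ^ 4 + norm (fst (snd p)) ^ 4 + norm (snd (snd p)) ^ 4"

definition sig3 :: "(real^2) \<times> (real^2) \<times> (real^2) \<Rightarrow> real^2" where
  "sig3 p = fst p + fst (snd p) + snd (snd p)"

lemma tau3_measurable [measurable]: "tau3 \<in> borel_measurable borel"
  unfolding tau3_def[abs_def] by (intro borel_measurable_continuous_onI continuous_intros)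

lemma sig3_measurable [measurable]: "sig3 \<in> borel_measurable borel"
  unfolding sig3_def[abs_def] by (intro borel_measurable_continuous_onI continuous_intros)

text \<open>Replacing the first momentum by the total momentum \<xi> is a measure preserving shear.
  For fixed \<xi> the level sets control the integral of \<psi>, and afterwards \<xi> is integrated
  against \<phi>.\<close>

lemma kernel_bound:
  fixes \<psi> :: "real \<Rightarrow> real" and \<phi> :: "real^2 \<Rightarrow> real"
  assumes c: "continuous_on UNIV \<psi>" and nn: "\<And>\<tau>. 0 \<le> \<psi> \<tau>"
    and [measurable]: "\<phi> \<in> borel_measurable borel" "P \<in> sets borel" and C: "0 \<le> C"
    and b: "\<And>\<xi> a b. a \<le> b \<Longrightarrow> emeasure lborel {q \<in> {q. (\<xi> - fst q - snd q, q) \<in> P}. a < psi3 \<xi> q \<and> psi3 \<xi> q \<le> b} \<le> ennreal (C * (b - a))"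
  shows "(\<integral>\<^sup>+p. indicator P p * ennreal (\<psi> (\<tau>0 - tau3 p)) * ennreal (\<phi> (\<xi>0 - sig3 p)) \<partial>lborel) \<le>
    ennreal C * (\<integral>\<^sup>+\<tau>. ennreal (\<psi> \<tau>) \<partial>lborel) * (\<integral>\<^sup>+\<xi>. ennreal (\<phi> \<xi>) \<partial>lborel)"
proof -
  have [measurable]: "\<psi> \<in> borel_measurable borel" using c by (rule borel_measurable_continuous_onI)
  let ?F = "\<lambda>p. indicator P p * ennreal (\<psi> (\<tau>0 - tau3 p)) * ennreal (\<phi> (\<xi>0 - sig3 p))"
  have F[measurable]: "?F \<in> borel_measurable borel" by measurable
  have cm: "(\<lambda>p::(real^2) \<times> (real^2) \<times> (real^2). (fst p - fst (snd p) - snd (snd p), snd p)) \<in> borel_measurable borel"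
    by (intro borel_measurable_continuous_onI continuous_intros)
  have m2: "(\<lambda>(\<xi>, q). ?F (\<xi> - fst q - snd q, q)) \<in> borel_measurable (lborel \<Otimes>\<^sub>M lborel)"
    using measurable_compose[OF cm F] by (simp add: lborel_prod case_prod_beta')
  have "(\<integral>\<^sup>+p. ?F p \<partial>lborel) = (\<integral>\<^sup>+q. \<integral>\<^sup>+p1. ?F (p1, q) \<partial>lborel \<partial>lborel)"
    unfolding lborel_prod[symmetric, where 'a="real^2" and 'b="(real^2) \<times> (real^2)"]
    by (rule lborel_pair.nn_integral_snd[symmetric]) (use F in \<open>simp add: lborel_prod\<close>)
  also have "\<dots> = (\<integral>\<^sup>+q. \<integral>\<^sup>+\<xi>. ?F (\<xi> - fst q - snd q, q) \<partial>lborel \<partial>lborel)"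
  proof (rule nn_integral_cong)
    fix q :: "(real^2) \<times> (real^2)"
    have "(\<lambda>p1. (p1, q)) \<in> borel_measurable borel" by (intro borel_measurable_continuous_onI continuous_intros)
    from measurable_compose[OF this F] have "(\<lambda>p1. ?F (p1, q)) \<in> borel_measurable borel" .
    from nn_integral_shift[OF this, of "- fst q - snd q"]
    show "(\<integral>\<^sup>+p1. ?F (p1, q) \<partial>lborel) = (\<integral>\<^sup>+\<xi>. ?F (\<xi> - fst q - snd q, q) \<partial>lborel)"
      by (simp add: algebra_simps)
  qed
  also have "\<dots> = (\<integral>\<^sup>+\<xi>. \<integral>\<^sup>+q. ?F (\<xi> - fst q - snd q, q) \<partial>lborel \<partial>lborel)"
    by (rule lborel_pair.Fubini'[OF m2])
  also have "\<dots> \<le> (\<integral>\<^sup>+\<xi>. (ennreal C * (\<integral>\<^sup>+\<tau>. ennreal (\<psi> \<tau>) \<partial>lborel)) * ennreal (\<phi> (\<xi>0 - \<xi>)) \<partial>lborel)"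
  proof (rule nn_integral_mono)
    fix \<xi> :: "real^2"
    have q: "tau3 (\<xi> - fst q - snd q, q) = psi3 \<xi> q" "sig3 (\<xi> - fst q - snd q, q) = \<xi>" for q
      by (simp_all add: tau3_def psi3_def sig3_def)
    have "(\<lambda>q::(real^2) \<times> (real^2). (\<xi> - fst q - snd q, q)) \<in> borel_measurable borel" 
      by (intro borel_measurable_continuous_onI continuous_intros)
    then have [measurable]: "{q. (\<xi> - fst q - snd q, q) \<in> P} \<in> sets borel"
      using measurable_sets[of "\<lambda>q::(real^2) \<times> (real^2). (\<xi> - fst q - snd q, q)" borel borel P] by (simp add: vimage_def)
    have "(\<integral>\<^sup>+q. ?F (\<xi> - fst q - snd q, q) \<partial>lborel) =
      (\<integral>\<^sup>+q. (indicator {q. (\<xi> - fst q - snd q, q) \<in> P} q * ennreal (\<psi> (\<tau>0 - psi3 \<xi> q))) * ennreal (\<phi> (\<xi>0 - \<xi>)) \<partial>lborel)"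
      unfolding q by (intro nn_integral_cong) (auto simp: indicator_def)
    also have "\<dots> = (\<integral>\<^sup>+q. indicator {q. (\<xi> - fst q - snd q, q) \<in> P} q * ennreal (\<psi> (\<tau>0 - psi3 \<xi> q)) \<partial>lborel) * ennreal (\<phi> (\<xi>0 - \<xi>))"
      by (rule nn_integral_multc) measurable
    also have "\<dots> \<le> (ennreal C * (\<integral>\<^sup>+\<tau>. ennreal (\<psi> (\<tau>0 - \<tau>)) \<partial>lborel)) * ennreal (\<phi> (\<xi>0 - \<xi>))"
    proof (intro mult_right_mono)
      have "continuous_on UNIV (\<lambda>\<tau>. \<psi> (\<tau>0 - \<tau>))" by (intro continuous_on_compose2[OF c] continuous_intros) auto
      then show "(\<integral>\<^sup>+q. indicator {q. (\<xi> - fst q - snd q, q) \<in> P} q * ennreal (\<psi> (\<tau>0 - psi3 \<xi> q)) \<partial>lborel) \<le> ennreal C * (\<integral>\<^sup>+\<tau>. ennreal (\<psi> (\<tau>0 - \<tau>)) \<partial>lborel)"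
        by (intro nn_integral_comp_le[where \<psi>="\<lambda>\<tau>. \<psi> (\<tau>0 - \<tau>)"] b nn C) auto
    qed simp
    also have "(\<integral>\<^sup>+\<tau>. ennreal (\<psi> (\<tau>0 - \<tau>)) \<partial>lborel) = (\<integral>\<^sup>+\<tau>. ennreal (\<psi> \<tau>) \<partial>lborel)"
      by (rule nn_integral_reflect) measurable
    finally show "(\<integral>\<^sup>+q. ?F (\<xi> - fst q - snd q, q) \<partial>lborel) \<le> (ennreal C * (\<integral>\<^sup>+\<tau>. ennreal (\<psi> \<tau>) \<partial>lborel)) * ennreal (\<phi> (\<xi>0 - \<xi>))" .
  qed
  also have "\<dots> = (ennreal C * (\<integral>\<^sup>+\<tau>. ennreal (\<psi> \<tau>) \<partial>lborel)) * (\<integral>\<^sup>+\<xi>. ennreal (\<phi> (\<xi>0 - \<xi>)) \<partial>lborel)"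
    by (rule nn_integral_cmult) measurable
  also have "(\<integral>\<^sup>+\<xi>. ennreal (\<phi> (\<xi>0 - \<xi>)) \<partial>lborel) = (\<integral>\<^sup>+\<xi>. ennreal (\<phi> \<xi>) \<partial>lborel)"
    by (rule nn_integral_reflect) measurable
  finally show ?thesis .
qed

section \<open>Positive sextilinear forms\<close>

type_synonym triple = "(real^2) \<times> (real^2) \<times> (real^2)"

text \<open>The triple p collects the momenta of the three conjugated factors and q those of the
  other three. The kernel smears out conservation of energy and momentum, and values in
  \<open>ennreal\<close> keep integrability questions away.\<close>

definition form :: "(real \<Rightarrow> real) \<Rightarrow> (real^2 \<Rightarrow> real) \<Rightarrow> (triple \<Rightarrow> ennreal) \<Rightarrow> (triple \<Rightarrow> ennreal) \<Rightarrow> ennreal" where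
  "form \<psi> \<phi> A B = (\<integral>\<^sup>+p. \<integral>\<^sup>+q. A p * B q * (ennreal (\<psi> (tau3 p - tau3 q)) * ennreal (\<phi> (sig3 p - sig3 q))) \<partial>lborel \<partial>lborel)"

definition tens :: "(real^2 \<Rightarrow> ennreal) \<Rightarrow> (real^2 \<Rightarrow> ennreal) \<Rightarrow> (real^2 \<Rightarrow> ennreal) \<Rightarrow> triple \<Rightarrow> ennreal" where
  "tens a b c p = a (fst p) * (b (fst (snd p)) * c (snd (snd p)))"

text \<open>\<kappa> bounds the mass of \<psi>: 1 for the principal kernels, small for the tails.
  Continuity is required by \<open>nn_integral_comp_le\<close>, and evenness lets a bound over q
  serve as a bound over p.\<close>

definition kernel :: "(real \<Rightarrow> real) \<Rightarrow> (real^2 \<Rightarrow> real) \<Rightarrow> real \<Rightarrow> bool" where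
  "kernel \<psi> \<phi> \<kappa> \<longleftrightarrow> continuous_on UNIV \<psi> \<and> (\<forall>\<tau>. 0 \<le> \<psi> \<tau> \<and> \<psi> (- \<tau>) = \<psi> \<tau>) \<and>
     \<phi> \<in> borel_measurable borel \<and> (\<forall>\<xi>. \<phi> (- \<xi>) = \<phi> \<xi>) \<and>
     (\<integral>\<^sup>+\<tau>. ennreal (\<psi> \<tau>) \<partial>lborel) \<le> ennreal \<kappa> \<and> (\<integral>\<^sup>+\<xi>. ennreal (\<phi> \<xi>) \<partial>lborel) \<le> 1 \<and> 0 \<le> \<kappa>"

lemma kernel_measurable:
  assumes "kernel \<psi> \<phi> \<kappa>"
  shows "\<psi> \<in> borel_measurable borel" "\<phi> \<in> borel_measurable borel"
  using assms by (auto simp: kernel_def intro: borel_measurable_continuous_onI)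

lemma tens_measurable [measurable (raw)]:
  assumes [measurable]: "a \<in> borel_measurable borel" "b \<in> borel_measurable borel" "c \<in> borel_measurable borel"
  shows "tens a b c \<in> borel_measurable borel"
  unfolding tens_def[abs_def] by measurable

lemma nn_integral_tens_sq:
  assumes [measurable]: "a \<in> borel_measurable borel" "b \<in> borel_measurable borel" "c \<in> borel_measurable borel"
  shows "(\<integral>\<^sup>+p. (tens a b c p)\<^sup>2 \<partial>lborel) = (\<integral>\<^sup>+x. (a x)\<^sup>2 \<partial>lborel) * ((\<integral>\<^sup>+x. (b x)\<^sup>2 \<partial>lborel) * (\<integral>\<^sup>+x. (c x)\<^sup>2 \<partial>lborel))"
proof -
  have 1: "(\<integral>\<^sup>+p. f (fst p) * g (snd p) \<partial>lborel) = (\<integral>\<^sup>+x. f x \<partial>lborel) * (\<integral>\<^sup>+x. g x \<partial>lborel)"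
    if [measurable]: "f \<in> borel_measurable borel" "g \<in> borel_measurable borel"
    for f :: "'x::euclidean_space \<Rightarrow> ennreal" and g :: "'y::euclidean_space \<Rightarrow> ennreal"
    unfolding lborel_prod[symmetric]
    by (subst lborel.nn_integral_fst[symmetric]) (auto simp: nn_integral_cmult nn_integral_multc)
  have "(\<integral>\<^sup>+p. (tens a b c p)\<^sup>2 \<partial>lborel) = (\<integral>\<^sup>+p. (a (fst p))\<^sup>2 * (\<lambda>q. (b (fst q))\<^sup>2 * (c (snd q))\<^sup>2) (snd p) \<partial>lborel)"
    by (simp add: tens_def power_mult_distrib)
  also have "\<dots> = (\<integral>\<^sup>+x. (a x)\<^sup>2 \<partial>lborel) * (\<integral>\<^sup>+q. (b (fst q))\<^sup>2 * (c (snd q))\<^sup>2 \<partial>lborel)"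
    by (rule 1) measurable
  also have "(\<integral>\<^sup>+q. (b (fst q))\<^sup>2 * (c (snd q))\<^sup>2 \<partial>lborel) = (\<integral>\<^sup>+x. (b x)\<^sup>2 \<partial>lborel) * (\<integral>\<^sup>+x. (c x)\<^sup>2 \<partial>lborel)"
    by (rule 1) measurable
  finally show ?thesis .
qed

lemma form_mono:
  assumes "\<And>p. A p \<le> A' p" "\<And>q. B q \<le> B' q"
  shows "form \<psi> \<phi> A B \<le> form \<psi> \<phi> A' B'"
  unfolding form_def by (intro nn_integral_mono mult_right_mono mult_mono assms) auto

lemma form_integrand_measurable:
  assumes "kernel \<psi> \<phi> \<kappa>" and A: "A \<in> borel_measurable borel" and B: "B \<in> borel_measurable borel"
  shows "(\<lambda>(p, q). A p * B q * (ennreal (\<psi> (tau3 p - tau3 q)) * ennreal (\<phi> (sig3 p - sig3 q)))) \<in> borel_measurable (lborel \<Otimes>\<^sub>M lborel)"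
proof -
  note [measurable] = kernel_measurable[OF assms(1)] A B
  show ?thesis by measurable
qed

lemma form_pair:
  assumes "kernel \<psi> \<phi> \<kappa>" and A: "A \<in> borel_measurable borel" and B: "B \<in> borel_measurable borel"
  shows "form \<psi> \<phi> A B = (\<integral>\<^sup>+r. A (fst r) * B (snd r) * (ennreal (\<psi> (tau3 (fst r) - tau3 (snd r))) * ennreal (\<phi> (sig3 (fst r) - sig3 (snd r)))) \<partial>(lborel \<Otimes>\<^sub>M lborel))"
  unfolding form_def using form_integrand_measurable[OF assms]
  by (subst lborel.nn_integral_fst[symmetric]) (auto simp: case_prod_beta')

lemma form_add_left:
  assumes k: "kernel \<psi> \<phi> \<kappa>" and [measurable]: "A \<in> borel_measurable borel" "A' \<in> borel_measurable borel" "B \<in> borel_measurable borel"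
  shows "form \<psi> \<phi> (\<lambda>p. A p + A' p) B = form \<psi> \<phi> A B + form \<psi> \<phi> A' B"
proof -
  note [measurable] = kernel_measurable[OF k]
  show ?thesis
    by (simp add: form_pair[OF k] distrib_right nn_integral_add)
qed

lemma form_add_right:
  assumes k: "kernel \<psi> \<phi> \<kappa>" and [measurable]: "A \<in> borel_measurable borel" "B' \<in> borel_measurable borel" "B \<in> borel_measurable borel"
  shows "form \<psi> \<phi> A (\<lambda>p. B p + B' p) = form \<psi> \<phi> A B + form \<psi> \<phi> A B'"
proof -
  note [measurable] = kernel_measurable[OF k]
  show ?thesis
    by (simp add: form_pair[OF k] distrib_left distrib_right nn_integral_add)
qed

lemma form_add_kernel:
  assumes k: "kernel \<psi> \<phi> \<kappa>" "kernel \<psi>' \<phi> \<kappa>'" and [measurable]: "A \<in> borel_measurable borel" "B \<in> borel_measurable borel"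
  shows "form (\<lambda>\<tau>. \<psi> \<tau> + \<psi>' \<tau>) \<phi> A B = form \<psi> \<phi> A B + form \<psi>' \<phi> A B"
proof -
  note [measurable] = kernel_measurable[OF k(1)] kernel_measurable[OF k(2)]
  have nn: "\<And>\<tau>. 0 \<le> \<psi> \<tau>" "\<And>\<tau>. 0 \<le> \<psi>' \<tau>" using k by (auto simp: kernel_def)
  have "form (\<lambda>\<tau>. \<psi> \<tau> + \<psi>' \<tau>) \<phi> A B = (\<integral>\<^sup>+p. (\<integral>\<^sup>+q. A p * B q * (ennreal (\<psi> (tau3 p - tau3 q)) * ennreal (\<phi> (sig3 p - sig3 q))) \<partial>lborel) +
     (\<integral>\<^sup>+q. A p * B q * (ennreal (\<psi>' (tau3 p - tau3 q)) * ennreal (\<phi> (sig3 p - sig3 q))) \<partial>lborel) \<partial>lborel)"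
    unfolding form_def by (subst nn_integral_add[symmetric]) (auto simp: ennreal_plus nn distrib_left distrib_right)
  also have "\<dots> = form \<psi> \<phi> A B + form \<psi>' \<phi> A B"
    unfolding form_def by (rule nn_integral_add) measurable
  finally show ?thesis .
qed

section \<open>Row bounds and Schur's test\<close>

lemma kernel_row_bound:
  assumes k: "kernel \<psi> \<phi> \<kappa>"
  shows "(\<integral>\<^sup>+q. ennreal (\<psi> (\<tau> - tau3 q)) * ennreal (\<phi> (\<xi> - sig3 q)) \<partial>lborel) \<le> ennreal (192 * \<kappa>)"
proof -
  have "(\<integral>\<^sup>+q. indicator UNIV q * ennreal (\<psi> (\<tau> - tau3 q)) * ennreal (\<phi> (\<xi> - sig3 q)) \<partial>lborel) \<le>
    ennreal 192 * (\<integral>\<^sup>+\<tau>. ennreal (\<psi> \<tau>) \<partial>lborel) * (\<integral>\<^sup>+\<xi>. ennreal (\<phi> \<xi>) \<partial>lborel)"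
    using k psi3_level_set by (intro kernel_bound) (auto simp: kernel_def)
  also have "\<dots> \<le> ennreal 192 * ennreal \<kappa> * 1" using k by (intro mult_mono) (auto simp: kernel_def)
  also have "\<dots> = ennreal (192 * \<kappa>)" using k by (subst ennreal_mult) (auto simp: kernel_def)
  finally show ?thesis by simp
qed

definition high_low :: "real \<Rightarrow> triple set" where
  "high_low s = {p. s\<^sup>2 \<le> norm (fst p) \<and> norm (fst (snd p)) \<le> s \<and> norm (snd (snd p)) \<le> s}"

lemma high_low_measurable [measurable]: "high_low s \<in> sets borel"
proof -
  have "closed (high_low s)" unfolding high_low_def by (intro closed_Collect_conj closed_Collect_le continuous_intros)
  then show ?thesis by simp
qed

lemma kernel_row_bound_high_low:
  assumes k: "kernel \<psi> \<phi> 1" and s: "8 \<le> s"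
  shows "(\<integral>\<^sup>+p. indicator (high_low s) p * (ennreal (\<psi> (tau3 p - \<tau>)) * ennreal (\<phi> (sig3 p - \<xi>))) \<partial>lborel) \<le> ennreal (128 / s ^ 3)"
proof -
  have e: "\<psi> (a - b) = \<psi> (b - a)" "\<phi> (x - y) = \<phi> (y - x)" for a b x y
    using k unfolding kernel_def by (metis minus_diff_eq)+
  have "(\<integral>\<^sup>+p. indicator (high_low s) p * ennreal (\<psi> (\<tau> - tau3 p)) * ennreal (\<phi> (\<xi> - sig3 p)) \<partial>lborel) \<le>
    ennreal (128 / s ^ 3) * (\<integral>\<^sup>+\<tau>. ennreal (\<psi> \<tau>) \<partial>lborel) * (\<integral>\<^sup>+\<xi>. ennreal (\<phi> \<xi>) \<partial>lborel)"
  proof (rule kernel_bound)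
    fix \<xi> :: "real^2" and a b :: real assume "a \<le> b"
    from psi3_level_set_high[OF s this, of \<xi>]
    show "emeasure lborel {q \<in> {q. (\<xi> - fst q - snd q, q) \<in> high_low s}. a < psi3 \<xi> q \<and> psi3 \<xi> q \<le> b} \<le> ennreal (128 / s ^ 3 * (b - a))"
      by (simp add: high_low_def conj_ac)
  qed (use k s in \<open>auto simp: kernel_def\<close>)
  also have "\<dots> \<le> ennreal (128 / s ^ 3) * 1 * 1" using k by (intro mult_mono) (auto simp: kernel_def)
  finally show ?thesis by (simp add: e mult.assoc)
qed

text \<open>Cauchy-Schwarz after splitting the kernel into two square roots. Integrating over q
  always costs \<open>192 * \<kappa>\<close>, whereas the integral over p is restricted to the
  support P of A, where C may be much smaller. The result is their geometric mean.\<close>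

lemma form_schur:
  assumes k: "kernel \<psi> \<phi> \<kappa>" and A[measurable]: "A \<in> borel_measurable borel" and B[measurable]: "B \<in> borel_measurable borel"
    and P[measurable]: "P \<in> sets borel" and AP: "\<And>p. p \<notin> P \<Longrightarrow> A p = 0"
    and C: "\<And>q. (\<integral>\<^sup>+p. indicator P p * (ennreal (\<psi> (tau3 p - tau3 q)) * ennreal (\<phi> (sig3 p - sig3 q))) \<partial>lborel) \<le> ennreal C" "0 \<le> C"
    and a: "(\<integral>\<^sup>+p. (A p)\<^sup>2 \<partial>lborel) \<le> ennreal (\<alpha>\<^sup>2)" and b: "(\<integral>\<^sup>+p. (B p)\<^sup>2 \<partial>lborel) \<le> ennreal (\<beta>\<^sup>2)"
    and nn: "0 \<le> \<alpha>" "0 \<le> \<beta>"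
  shows "form \<psi> \<phi> A B \<le> ennreal (sqrt (192 * \<kappa> * C) * (\<alpha> * \<beta>))"
proof -
  note [measurable] = kernel_measurable[OF k]
  have \<kappa>: "0 \<le> \<kappa>" using k by (simp add: kernel_def)
  let ?K = "\<lambda>r. ennreal (\<psi> (tau3 (fst r) - tau3 (snd r))) * ennreal (\<phi> (sig3 (fst r) - sig3 (snd r)))"
  \<comment> \<open>\<phi> carries no sign condition and \<open>ennreal\<close> discards its
    negative part; \<open>max 0\<close> does the same under the root.\<close>
  let ?k = "\<lambda>r. ennreal (sqrt (\<psi> (tau3 (fst r) - tau3 (snd r)))) * ennreal (sqrt (max 0 (\<phi> (sig3 (fst r) - sig3 (snd r)))))"
  have kk: "?k r * ?k r = ?K r" for r
  proof -
    have 1: "ennreal (sqrt x) * ennreal (sqrt x) = ennreal x" if "0 \<le> x" for x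
      using that by (simp flip: ennreal_mult)
    have 2: "ennreal (max 0 x) = ennreal x" for x by (cases "0 \<le> x") (auto simp: max_def ennreal_neg)
    have "?k r * ?k r = (ennreal (sqrt (\<psi> (tau3 (fst r) - tau3 (snd r)))) * ennreal (sqrt (\<psi> (tau3 (fst r) - tau3 (snd r))))) *
      (ennreal (sqrt (max 0 (\<phi> (sig3 (fst r) - sig3 (snd r))))) * ennreal (sqrt (max 0 (\<phi> (sig3 (fst r) - sig3 (snd r))))))"
      by (simp only: mult_ac)
    also have "\<dots> = ?K r"
      using k by (subst 1, simp add: kernel_def, subst 1, simp, simp only: 2)
    finally show ?thesis .
  qed
  have AA: "A p * indicator P p = A p" for p using AP[of p] by (auto simp: indicator_def)
  have "form \<psi> \<phi> A B = (\<integral>\<^sup>+r. (A (fst r) * ?k r) * (indicator P (fst r) * B (snd r) * ?k r) \<partial>(lborel \<Otimes>\<^sub>M lborel))"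
  proof (subst form_pair[OF k A B], rule nn_integral_cong)
    fix r :: "triple \<times> triple"
    have "(A (fst r) * ?k r) * (indicator P (fst r) * B (snd r) * ?k r) = (A (fst r) * indicator P (fst r)) * B (snd r) * (?k r * ?k r)"
      by (simp only: mult_ac)
    then show "A (fst r) * B (snd r) * ?K r = (A (fst r) * ?k r) * (indicator P (fst r) * B (snd r) * ?k r)"
      by (simp only: kk AA)
  qed
  then have "(form \<psi> \<phi> A B)\<^sup>2 \<le> (\<integral>\<^sup>+r. (A (fst r) * ?k r)\<^sup>2 \<partial>(lborel \<Otimes>\<^sub>M lborel)) * (\<integral>\<^sup>+r. (indicator P (fst r) * B (snd r) * ?k r)\<^sup>2 \<partial>(lborel \<Otimes>\<^sub>M lborel))"
    by (simp only:) (rule Cauchy_Schwarz_nn_integral; measurable)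
  also have "\<dots> \<le> ennreal (192 * \<kappa> * \<alpha>\<^sup>2) * ennreal (C * \<beta>\<^sup>2)"
  proof (rule mult_mono)
    have "(\<integral>\<^sup>+r. (A (fst r) * ?k r)\<^sup>2 \<partial>(lborel \<Otimes>\<^sub>M lborel)) = (\<integral>\<^sup>+r. (A (fst r))\<^sup>2 * ?K r \<partial>(lborel \<Otimes>\<^sub>M lborel))"
    proof (rule nn_integral_cong)
      fix r :: "triple \<times> triple"
      show "(A (fst r) * ?k r)\<^sup>2 = (A (fst r))\<^sup>2 * ?K r"
        by (simp only: power_mult_distrib[of "A (fst r)"] power2_eq_square[of "?k r"] kk)
    qed
    also have "\<dots> = (\<integral>\<^sup>+p. (A p)\<^sup>2 * (\<integral>\<^sup>+q. ennreal (\<psi> (tau3 p - tau3 q)) * ennreal (\<phi> (sig3 p - sig3 q)) \<partial>lborel) \<partial>lborel)"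
      by (subst lborel.nn_integral_fst[symmetric]) (auto simp: nn_integral_cmult)
    also have "\<dots> \<le> (\<integral>\<^sup>+p. (A p)\<^sup>2 * ennreal (192 * \<kappa>) \<partial>lborel)"
      by (intro nn_integral_mono mult_left_mono kernel_row_bound[OF k]) simp
    also have "\<dots> \<le> ennreal (\<alpha>\<^sup>2) * ennreal (192 * \<kappa>)"
      by (subst nn_integral_multc) (auto intro!: mult_right_mono a)
    also have "\<dots> = ennreal (192 * \<kappa> * \<alpha>\<^sup>2)" using \<kappa> by (simp flip: ennreal_mult add: mult.commute)
    finally show "(\<integral>\<^sup>+r. (A (fst r) * ?k r)\<^sup>2 \<partial>(lborel \<Otimes>\<^sub>M lborel)) \<le> ennreal (192 * \<kappa> * \<alpha>\<^sup>2)" .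
    have i2: "(indicator P x)\<^sup>2 = (indicator P x :: ennreal)" for x :: triple by (simp add: indicator_def)
    have "(\<integral>\<^sup>+r. (indicator P (fst r) * B (snd r) * ?k r)\<^sup>2 \<partial>(lborel \<Otimes>\<^sub>M lborel)) = (\<integral>\<^sup>+r. (B (snd r))\<^sup>2 * (indicator P (fst r) * ?K r) \<partial>(lborel \<Otimes>\<^sub>M lborel))"
    proof (rule nn_integral_cong)
      fix r :: "triple \<times> triple"
      have g: "(i * b * k)\<^sup>2 = b\<^sup>2 * (i\<^sup>2 * (k * k))" for i b k :: ennreal by (simp only: power2_eq_square mult_ac)
      show "(indicator P (fst r) * B (snd r) * ?k r)\<^sup>2 = (B (snd r))\<^sup>2 * (indicator P (fst r) * ?K r)"
        by (simp only: g kk i2)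
    qed
    also have "\<dots> = (\<integral>\<^sup>+q. (B q)\<^sup>2 * (\<integral>\<^sup>+p. indicator P p * (ennreal (\<psi> (tau3 p - tau3 q)) * ennreal (\<phi> (sig3 p - sig3 q))) \<partial>lborel) \<partial>lborel)"
      by (subst lborel_pair.nn_integral_snd[symmetric]) (auto simp: nn_integral_cmult)
    also have "\<dots> \<le> (\<integral>\<^sup>+q. (B q)\<^sup>2 * ennreal C \<partial>lborel)"
      by (intro nn_integral_mono mult_left_mono C) simp
    also have "\<dots> \<le> ennreal (\<beta>\<^sup>2) * ennreal C"
      by (subst nn_integral_multc) (auto intro!: mult_right_mono b)
    also have "\<dots> = ennreal (C * \<beta>\<^sup>2)" using C by (simp flip: ennreal_mult add: mult.commute)
    finally show "(\<integral>\<^sup>+r. (indicator P (fst r) * B (snd r) * ?k r)\<^sup>2 \<partial>(lborel \<Otimes>\<^sub>M lborel)) \<le> ennreal (C * \<beta>\<^sup>2)" .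
  qed auto
  also have "\<dots> = ennreal ((sqrt (192 * \<kappa> * C) * (\<alpha> * \<beta>))\<^sup>2)"
    using C \<kappa> by (simp add: power_mult_distrib mult_ac flip: ennreal_mult)
  finally have *: "(form \<psi> \<phi> A B)\<^sup>2 \<le> ennreal ((sqrt (192 * \<kappa> * C) * (\<alpha> * \<beta>))\<^sup>2)" .
  then have "form \<psi> \<phi> A B \<noteq> top" by (auto simp: top_power_ennreal top_unique)
  then obtain r where r: "0 \<le> r" "form \<psi> \<phi> A B = ennreal r" by (cases "form \<psi> \<phi> A B") auto
  have "r\<^sup>2 \<le> (sqrt (192 * \<kappa> * C) * (\<alpha> * \<beta>))\<^sup>2" using * r by (simp add: ennreal_power)
  then have "r \<le> sqrt (192 * \<kappa> * C) * (\<alpha> * \<beta>)" by (rule power2_le_imp_le) (use nn C(2) \<kappa> in simp)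
  then show ?thesis using r by (simp add: ennreal_leI)
qed

lemma form_bound:
  assumes k: "kernel \<psi> \<phi> \<kappa>" and A: "A \<in> borel_measurable borel" and B: "B \<in> borel_measurable borel"
    and a: "(\<integral>\<^sup>+p. (A p)\<^sup>2 \<partial>lborel) \<le> ennreal (\<alpha>\<^sup>2)" and b: "(\<integral>\<^sup>+p. (B p)\<^sup>2 \<partial>lborel) \<le> ennreal (\<beta>\<^sup>2)"
    and nn: "0 \<le> \<alpha>" "0 \<le> \<beta>"
  shows "form \<psi> \<phi> A B \<le> ennreal (192 * \<kappa> * (\<alpha> * \<beta>))"
proof -
  have \<kappa>: "0 \<le> \<kappa>" using k by (simp add: kernel_def)
  have e: "\<psi> (a - b) = \<psi> (b - a)" "\<phi> (x - y) = \<phi> (y - x)" for a b x y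
    using k unfolding kernel_def by (metis minus_diff_eq)+
  have "form \<psi> \<phi> A B \<le> ennreal (sqrt (192 * \<kappa> * (192 * \<kappa>)) * (\<alpha> * \<beta>))"
  proof (rule form_schur[OF k A B _ _ _ _ a b nn, where P=UNIV])
    fix q :: triple
    have "(\<integral>\<^sup>+p. indicator UNIV p * (ennreal (\<psi> (tau3 p - tau3 q)) * ennreal (\<phi> (sig3 p - sig3 q))) \<partial>lborel) =
      (\<integral>\<^sup>+p. ennreal (\<psi> (tau3 q - tau3 p)) * ennreal (\<phi> (sig3 q - sig3 p)) \<partial>lborel)"
      by (rule nn_integral_cong) (simp only: e(1)[of "tau3 q"] e(2)[of "sig3 q"] indicator_UNIV mult_1_left)
    also have "\<dots> \<le> ennreal (192 * \<kappa>)" by (rule kernel_row_bound[OF k])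
    finally show "(\<integral>\<^sup>+p. indicator UNIV p * (ennreal (\<psi> (tau3 p - tau3 q)) * ennreal (\<phi> (sig3 p - sig3 q))) \<partial>lborel) \<le> ennreal (192 * \<kappa>)" .
  qed (use \<kappa> in auto)
  also have "sqrt (192 * \<kappa> * (192 * \<kappa>)) = 192 * \<kappa>" using \<kappa> by (simp add: real_sqrt_mult)
  finally show ?thesis .
qed

section \<open>The Strichartz estimate\<close>

lemma ennreal_norm_integral_le:
  fixes f :: "'b \<Rightarrow> 'c::{banach, second_countable_topology}"
  shows "ennreal (norm (integral\<^sup>L M f)) \<le> (\<integral>\<^sup>+x. ennreal (norm (f x)) \<partial>M)"
  by (cases "integrable M f") (auto simp: not_integrable_integral_eq intro: integral_norm_bound_ennreal)

text \<open>The damping in y makes the integral over y, p and q absolutely convergent. Integrating y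
  out leaves a Gaussian in \<open>S p - S q\<close>; it is nonnegative, so passing to absolute
  values discards only the phases of A and B. Later S is \<open>S3\<close>.\<close>

lemma gauss_fubini:
  fixes A B :: "'x::euclidean_space \<Rightarrow> complex" and S :: "'x \<Rightarrow> 'y::euclidean_space"
  assumes A: "integrable lborel A" and B: "integrable lborel B" and S[measurable]: "S \<in> borel_measurable borel" and n: "n > 0"
  shows "ennreal (cmod (LINT y|lborel. complex_of_real (exp (- (norm y)\<^sup>2 / (2 * n\<^sup>2))) *
      (cnj (LINT p|lborel. exp (\<i> * complex_of_real (y \<bullet> S p)) * A p) * (LINT q|lborel. exp (\<i> * complex_of_real (y \<bullet> S q)) * B q)))) \<le>
    ennreal ((2 * pi) ^ DIM('y)) * (\<integral>\<^sup>+p. \<integral>\<^sup>+q. ennreal (cmod (A p)) * ennreal (cmod (B q)) * ennreal (gauss (1/n) (S p - S q)) \<partial>lborel \<partial>lborel)"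
proof -
  have Am[measurable]: "A \<in> borel_measurable borel" and Bm[measurable]: "B \<in> borel_measurable borel" using A B by auto
  let ?t = "\<lambda>y::'y. complex_of_real (exp (- (norm y)\<^sup>2 / (2 * n\<^sup>2)))"
  let ?U = "\<lambda>r. cnj (A (fst r)) * B (snd r)"
  let ?F = "\<lambda>y r. exp (\<i> * complex_of_real (y \<bullet> (S (snd r) - S (fst r)))) * (?t y * ?U r)"
  let ?E = "\<lambda>A y. (LINT p|lborel. exp (\<i> * complex_of_real (y \<bullet> S p)) * A p)"
  have sf: "sigma_finite_measure (lborel :: 'x measure)" "sigma_finite_measure (lborel :: 'y measure)" by (rule lborel.sigma_finite_measure_axioms)+
  have it: "integrable lborel ?t" using integrable_exp_norm[OF n] by (rule integrable_of_real)
  have cA: "integrable lborel (\<lambda>x. cnj (A x))" using A by (rule Bochner_Integration.integrable_cnj)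
  have iU: "integrable (lborel \<Otimes>\<^sub>M lborel) ?U"
    using integrable_pair_mult(1)[OF sf(1) sf(1) cA B] by (simp add: case_prod_beta')
  have iU': "integrable lborel ?U" using iU by (simp only: lborel_prod)
  have "integrable (lborel \<Otimes>\<^sub>M lborel) (\<lambda>(y, r). ?t y * ?U r)"
    by (rule integrable_pair_mult(1)[OF lborel.sigma_finite_measure_axioms lborel.sigma_finite_measure_axioms it iU'])
  then have iF: "integrable (lborel \<Otimes>\<^sub>M lborel) (\<lambda>(y, r). ?F y r)"
    by (rule Bochner_Integration.integrable_bound) (auto simp: norm_mult)
  have prod: "cnj (?E A y) * ?E B y = (LINT r|lborel. exp (\<i> * complex_of_real (y \<bullet> (S (snd r) - S (fst r)))) * ?U r)" for y
  proof -
    let ?a = "\<lambda>p. exp (\<i> * complex_of_real (y \<bullet> S p)) * A p" and ?b = "\<lambda>q. exp (\<i> * complex_of_real (y \<bullet> S q)) * B q"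
    have ia: "integrable lborel ?a" by (rule Bochner_Integration.integrable_bound[OF A]) (auto simp: norm_mult)
    have ib: "integrable lborel ?b" by (rule Bochner_Integration.integrable_bound[OF B]) (auto simp: norm_mult)
    have "cnj (?E A y) * ?E B y = (LINT p|lborel. cnj (?a p)) * (LINT q|lborel. ?b q)"
      by (subst Bochner_Integration.integral_cnj) (rule refl)
    also have "\<dots> = (LINT r|(lborel \<Otimes>\<^sub>M lborel). cnj (?a (fst r)) * ?b (snd r))"
      by (rule integrable_pair_mult(2)[OF sf(1) sf(1) Bochner_Integration.integrable_cnj[OF ia] ib, symmetric])
    also have "\<dots> = (LINT r|lborel. exp (\<i> * complex_of_real (y \<bullet> (S (snd r) - S (fst r)))) * ?U r)"
      unfolding lborel_prod
    proof (intro Bochner_Integration.integral_cong refl)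
      fix r :: "'x \<times> 'x"
      have r: "(a * b) * (c * d) = (a * c) * (b * d)" for a b c d :: complex by simp
      have e: "cnj (exp (\<i> * complex_of_real a)) * exp (\<i> * complex_of_real b) = exp (\<i> * complex_of_real (b - a))" for a b
        unfolding exp_cnj exp_add[symmetric] by (simp add: algebra_simps)
      show "cnj (?a (fst r)) * ?b (snd r) = exp (\<i> * complex_of_real (y \<bullet> (S (snd r) - S (fst r)))) * ?U r"
        unfolding complex_cnj_mult inner_diff_right by (subst r) (simp only: e)
    qed
    finally show ?thesis .
  qed
  have "(LINT y|lborel. ?t y * (cnj (?E A y) * ?E B y)) = (LINT y|lborel. LINT r|lborel. ?F y r)"
  proof (intro Bochner_Integration.integral_cong refl)
    fix y
    have "?t y * (cnj (?E A y) * ?E B y) = (LINT r|lborel. ?t y * (exp (\<i> * complex_of_real (y \<bullet> (S (snd r) - S (fst r)))) * ?U r))"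
      unfolding prod by (rule integral_mult_right_zero[symmetric])
    also have "\<dots> = (LINT r|lborel. ?F y r)" by (intro Bochner_Integration.integral_cong refl mult.left_commute)
    finally show "?t y * (cnj (?E A y) * ?E B y) = (LINT r|lborel. ?F y r)" .
  qed
  also have "\<dots> = (LINT r|lborel. LINT y|lborel. ?F y r)" by (rule lborel_pair.Fubini_integral[OF iF, symmetric])
  also have "\<dots> = (LINT r|lborel. ?U r * complex_of_real ((2 * pi) ^ DIM('y) * gauss (1/n) (S (snd r) - S (fst r))))"
  proof (intro Bochner_Integration.integral_cong refl)
    fix r :: "'x \<times> 'x"
    have "(LINT y|lborel. ?F y r) = (LINT y|lborel. ?U r * (exp (\<i> * complex_of_real ((S (snd r) - S (fst r)) \<bullet> y)) * ?t y))"
      by (intro Bochner_Integration.integral_cong refl) (simp only: inner_commute mult_ac)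
    also have "\<dots> = ?U r * (LINT y|lborel. exp (\<i> * complex_of_real ((S (snd r) - S (fst r)) \<bullet> y)) * ?t y)"
      by (rule integral_mult_right_zero)
    finally show "(LINT y|lborel. ?F y r) = ?U r * complex_of_real ((2 * pi) ^ DIM('y) * gauss (1/n) (S (snd r) - S (fst r)))"
      unfolding fourier_gauss[OF n] .
  qed
  finally have "ennreal (cmod (LINT y|lborel. ?t y * (cnj (?E A y) * ?E B y))) \<le>
     (\<integral>\<^sup>+r. ennreal (cmod (?U r * complex_of_real ((2 * pi) ^ DIM('y) * gauss (1/n) (S (snd r) - S (fst r))))) \<partial>lborel)"
    by (simp only: ennreal_norm_integral_le)
  also have "\<dots> = (\<integral>\<^sup>+r. ennreal ((2 * pi) ^ DIM('y)) * (ennreal (cmod (A (fst r))) * ennreal (cmod (B (snd r))) * ennreal (gauss (1/n) (S (fst r) - S (snd r)))) \<partial>lborel)"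
  proof (rule nn_integral_cong)
    fix r :: "'x \<times> 'x"
    have "cmod (?U r * complex_of_real ((2 * pi) ^ DIM('y) * gauss (1/n) (S (snd r) - S (fst r)))) =
       (2 * pi) ^ DIM('y) * (cmod (A (fst r)) * cmod (B (snd r)) * gauss (1/n) (S (fst r) - S (snd r)))"
      by (simp add: norm_mult norm_power gauss_minus_commute[of _ "S (snd r)"])
    then show "ennreal (cmod (?U r * complex_of_real ((2 * pi) ^ DIM('y) * gauss (1/n) (S (snd r) - S (fst r))))) =
      ennreal ((2 * pi) ^ DIM('y)) * (ennreal (cmod (A (fst r))) * ennreal (cmod (B (snd r))) * ennreal (gauss (1/n) (S (fst r) - S (snd r))))"
      by (simp only: ennreal_mult gauss_nonneg norm_ge_zero mult_nonneg_nonneg zero_le_power pi_ge_zero zero_le_numeral)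
  qed
  also have "\<dots> = ennreal ((2 * pi) ^ DIM('y)) * (\<integral>\<^sup>+r. (ennreal (cmod (A (fst r))) * ennreal (cmod (B (snd r))) * ennreal (gauss (1/n) (S (fst r) - S (snd r)))) \<partial>lborel)"
    by (rule nn_integral_cmult) measurable
  also have "(\<integral>\<^sup>+r. (ennreal (cmod (A (fst r))) * ennreal (cmod (B (snd r))) * ennreal (gauss (1/n) (S (fst r) - S (snd r)))) \<partial>lborel) =
     (\<integral>\<^sup>+p. \<integral>\<^sup>+q. ennreal (cmod (A p)) * ennreal (cmod (B q)) * ennreal (gauss (1/n) (S p - S q)) \<partial>lborel \<partial>lborel)"
  proof -
    have "(\<lambda>(p, q). ennreal (cmod (A p)) * ennreal (cmod (B q)) * ennreal (gauss (1/n) (S p - S q))) \<in> borel_measurable (lborel \<Otimes>\<^sub>M lborel)"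
      by measurable
    from lborel.nn_integral_fst[OF this] show ?thesis by (simp add: lborel_prod case_prod_beta')
  qed
  finally show ?thesis .
qed

lemma gauss_pair: "\<sigma> > 0 \<Longrightarrow> gauss \<sigma> (\<tau>::real, \<xi>::real^2) = gauss \<sigma> \<tau> * gauss \<sigma> \<xi>"
  by (simp add: gauss_exp norm_Pair exp_add[symmetric] add_divide_distrib power_add[symmetric] power3_eq_cube power2_eq_square[of "inverse _"] field_simps)

lemma evI_integrable:
  assumes "integrable lborel H"
  shows "integrable lborel (\<lambda>\<xi>. exp (\<i> * complex_of_real (snd y \<bullet> \<xi> + fst y * norm \<xi> ^ 4)) * H \<xi>)"
proof -
  have [measurable]: "H \<in> borel_measurable borel" using assms by auto
  show ?thesis by (rule Bochner_Integration.integrable_bound[OF assms]) (auto simp: norm_mult)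
qed

lemma evI_diff:
  assumes "integrable lborel H" "integrable lborel H'"
  shows "evI (\<lambda>\<xi>. H \<xi> - H' \<xi>) y = evI H y - evI H' y"
  using evI_integrable[OF assms(1), of y] evI_integrable[OF assms(2), of y]
  by (simp add: evI_def right_diff_distrib diff_divide_distrib)

section \<open>A product of three waves as one oscillatory integral over triples\<close>

definition S3 :: "triple \<Rightarrow> real \<times> (real^2)" where "S3 p = (tau3 p, sig3 p)"

lemma S3_measurable [measurable]: "S3 \<in> borel_measurable borel"
  unfolding S3_def[abs_def] by (intro borel_measurable_Pair) auto

definition tri :: "(real^2 \<Rightarrow> complex) \<Rightarrow> (real^2 \<Rightarrow> complex) \<Rightarrow> (real^2 \<Rightarrow> complex) \<Rightarrow> triple \<Rightarrow> complex" where
  "tri a b c p = a (fst p) * (b (fst (snd p)) * c (snd (snd p)))"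

lemma tri_integral:
  assumes "integrable lborel a" "integrable lborel b" "integrable lborel c"
  shows "integrable lborel (tri a b c)" "(LINT p|lborel. tri a b c p) = (LINT x|lborel. a x) * ((LINT x|lborel. b x) * (LINT x|lborel. c x))"
proof -
  note sf = lborel.sigma_finite_measure_axioms
  have 1: "integrable lborel (\<lambda>q. b (fst q) * c (snd q))"
    using integrable_pair_mult(1)[OF sf sf assms(2,3)] by (simp add: lborel_prod case_prod_beta')
  have 2: "(LINT q|lborel. b (fst q) * c (snd q)) = (LINT x|lborel. b x) * (LINT x|lborel. c x)"
    using integrable_pair_mult(2)[OF sf sf assms(2,3)] by (simp add: lborel_prod)
  show "integrable lborel (tri a b c)"
    using integrable_pair_mult(1)[OF sf sf assms(1) 1] by (simp add: lborel_prod case_prod_beta' tri_def[abs_def])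
  show "(LINT p|lborel. tri a b c p) = (LINT x|lborel. a x) * ((LINT x|lborel. b x) * (LINT x|lborel. c x))"
    using integrable_pair_mult(2)[OF sf sf assms(1) 1] unfolding 2 by (simp add: lborel_prod tri_def)
qed

lemma evI_triple:
  assumes i: "integrable lborel a" "integrable lborel b" "integrable lborel c"
  shows "evI a y * (evI b y * evI c y) = complex_of_real ((1 / (2 * pi)^2)^3) * (LINT p|lborel. exp (\<i> * complex_of_real (y \<bullet> S3 p)) * tri a b c p)"
proof -
  let ?e = "\<lambda>H \<xi>. exp (\<i> * complex_of_real (snd y \<bullet> \<xi> + fst y * norm \<xi> ^ 4)) * H \<xi>"
  have ph: "exp (\<i> * complex_of_real (y \<bullet> S3 p)) = exp (\<i> * complex_of_real (snd y \<bullet> fst p + fst y * norm (fst p) ^ 4)) *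
     (exp (\<i> * complex_of_real (snd y \<bullet> fst (snd p) + fst y * norm (fst (snd p)) ^ 4)) * exp (\<i> * complex_of_real (snd y \<bullet> snd (snd p) + fst y * norm (snd (snd p)) ^ 4)))" for p
    unfolding exp_add[symmetric] distrib_left[symmetric] of_real_add[symmetric]
    by (intro arg_cong[where f=exp] arg_cong[where f="\<lambda>x. \<i> * complex_of_real x"])
       (simp add: inner_prod_def S3_def tau3_def sig3_def inner_add_right algebra_simps)
  have "(LINT p|lborel. exp (\<i> * complex_of_real (y \<bullet> S3 p)) * tri a b c p) = (LINT p|lborel. tri (?e a) (?e b) (?e c) p)"
    unfolding tri_def ph by (intro Bochner_Integration.integral_cong refl) (simp only: mult_ac)
  also have "\<dots> = (LINT x|lborel. ?e a x) * ((LINT x|lborel. ?e b x) * (LINT x|lborel. ?e c x))"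
    by (intro tri_integral evI_integrable i)
  finally show ?thesis unfolding evI_def of_real_power by (simp only: power3_eq_cube mult_ac)
qed

text \<open>Six inverse transforms contribute a factor \<open>1 / (2 * pi)^2\<close> each, and the
  transform of the Gaussian in three-dimensional space-time contributes
  \<open>(2 * pi)^3\<close>.\<close>

definition cst :: real where "cst = ((1 / (2 * pi)^2)^3)\<^sup>2 * (2 * pi)^3"

lemma cst_nonneg: "0 \<le> cst"
  by (simp add: cst_def)

abbreviation mag :: "(real^2 \<Rightarrow> complex) \<Rightarrow> real^2 \<Rightarrow> ennreal" where
  "mag H \<equiv> (\<lambda>x. ennreal (cmod (H x)))"

lemma evI_form_bound:
  assumes i: "integrable lborel a" "integrable lborel b" "integrable lborel c" "integrable lborel a'" "integrable lborel b'" "integrable lborel c'"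
    and n: "n > 0"
  shows "ennreal (cmod (LINT y|lborel. complex_of_real (exp (- (norm y)\<^sup>2 / (2 * n\<^sup>2))) *
      (cnj (evI a y * (evI b y * evI c y)) * (evI a' y * (evI b' y * evI c' y))))) \<le>
    ennreal cst * form (gauss (1/n)) (gauss (1/n)) (tens (mag a) (mag b) (mag c)) (tens (mag a') (mag b') (mag c'))"
proof -
  let ?c = "(1 / (2 * pi)^2)^3 :: real"
  let ?E = "\<lambda>A y. (LINT p|lborel. exp (\<i> * complex_of_real (y \<bullet> S3 p)) * A p)"
  let ?t = "\<lambda>y::real \<times> (real^2). complex_of_real (exp (- (norm y)\<^sup>2 / (2 * n\<^sup>2)))"
  have "(LINT y|lborel. ?t y * (cnj (evI a y * (evI b y * evI c y)) * (evI a' y * (evI b' y * evI c' y)))) =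
    (LINT y|lborel. complex_of_real (?c\<^sup>2) * (?t y * (cnj (?E (tri a b c) y) * ?E (tri a' b' c') y)))"
    unfolding evI_triple[OF i(1-3)] evI_triple[OF i(4-6)]
  proof (intro Bochner_Integration.integral_cong refl)
    fix y
    have g: "t * (cnj (complex_of_real k * u) * (complex_of_real k * v)) = complex_of_real (k\<^sup>2) * (t * (cnj u * v))" for t u v :: complex and k :: real
      by (simp add: power2_eq_square)
    show "?t y * (cnj (complex_of_real ?c * ?E (tri a b c) y) * (complex_of_real ?c * ?E (tri a' b' c') y)) =
      complex_of_real (?c\<^sup>2) * (?t y * (cnj (?E (tri a b c) y) * ?E (tri a' b' c') y))" by (rule g)
  qed
  also have "\<dots> = complex_of_real (?c\<^sup>2) * (LINT y|lborel. ?t y * (cnj (?E (tri a b c) y) * ?E (tri a' b' c') y))"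
    by (rule integral_mult_right_zero)
  finally have "ennreal (cmod (LINT y|lborel. ?t y * (cnj (evI a y * (evI b y * evI c y)) * (evI a' y * (evI b' y * evI c' y))))) =
     ennreal (?c\<^sup>2) * ennreal (cmod (LINT y|lborel. ?t y * (cnj (?E (tri a b c) y) * ?E (tri a' b' c') y)))"
    by (simp only: norm_mult norm_of_real abs_power2 ennreal_mult zero_le_power2 norm_ge_zero)
  also have "\<dots> \<le> ennreal (?c\<^sup>2) * (ennreal ((2 * pi) ^ DIM(real \<times> (real^2))) *
      (\<integral>\<^sup>+p. \<integral>\<^sup>+q. ennreal (cmod (tri a b c p)) * ennreal (cmod (tri a' b' c' q)) * ennreal (gauss (1/n) (S3 p - S3 q)) \<partial>lborel \<partial>lborel))"
    by (intro mult_left_mono gauss_fubini tri_integral i S3_measurable n) simp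
  also have "(\<integral>\<^sup>+p. \<integral>\<^sup>+q. ennreal (cmod (tri a b c p)) * ennreal (cmod (tri a' b' c' q)) * ennreal (gauss (1/n) (S3 p - S3 q)) \<partial>lborel \<partial>lborel) =
    form (gauss (1/n)) (gauss (1/n)) (tens (mag a) (mag b) (mag c)) (tens (mag a') (mag b') (mag c'))"
    unfolding form_def
  proof (intro nn_integral_cong)
    fix p q
    have 1: "ennreal (cmod (tri a b c p)) = tens (mag a) (mag b) (mag c) p" for a b c p
      by (simp add: tri_def tens_def norm_mult ennreal_mult)
    have 2: "ennreal (gauss (1/n) (S3 p - S3 q)) = ennreal (gauss (1/n) (tau3 p - tau3 q)) * ennreal (gauss (1/n) (sig3 p - sig3 q))"
      using n by (simp add: S3_def gauss_pair ennreal_mult)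
    show "ennreal (cmod (tri a b c p)) * ennreal (cmod (tri a' b' c' q)) * ennreal (gauss (1/n) (S3 p - S3 q)) =
      tens (mag a) (mag b) (mag c) p * tens (mag a') (mag b') (mag c') q * (ennreal (gauss (1/n) (tau3 p - tau3 q)) * ennreal (gauss (1/n) (sig3 p - sig3 q)))"
      by (simp only: 1 2)
  qed
  also have "ennreal (?c\<^sup>2) * (ennreal ((2 * pi) ^ DIM(real \<times> (real^2))) * form (gauss (1/n)) (gauss (1/n)) (tens (mag a) (mag b) (mag c)) (tens (mag a') (mag b') (mag c'))) =
     ennreal cst * form (gauss (1/n)) (gauss (1/n)) (tens (mag a) (mag b) (mag c)) (tens (mag a') (mag b') (mag c'))"
    unfolding mult.assoc[symmetric] by (subst ennreal_mult[symmetric]) (auto simp: cst_def power3_eq_cube)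
  finally show ?thesis .
qed

lemma gauss_real: "gauss \<sigma> (\<tau>::real) = normal_density 0 \<sigma> \<tau>"
  by (simp add: gauss_def)

lemma continuous_gauss_real: "continuous_on UNIV (gauss \<sigma> :: real \<Rightarrow> real)"
proof -
  have "continuous_on UNIV (\<lambda>\<tau>::real. normal_density 0 \<sigma> \<tau>)"
    unfolding normal_density_def divide_inverse by (intro continuous_intros)
  then show ?thesis by (simp only: gauss_real[abs_def])
qed

lemma kernel_gauss:
  assumes "\<sigma> > 0" shows "kernel (gauss \<sigma>) (gauss \<sigma>) 1"
  unfolding kernel_def using assms by (auto simp: nn_integral_gauss continuous_gauss_real)

lemma nn_mag_sq:
  assumes "H \<in> L2" shows "(\<integral>\<^sup>+x. (mag H x)\<^sup>2 \<partial>lborel) = ennreal ((l2norm H)\<^sup>2)"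
  using nn_l2norm[OF assms] by (simp add: ennreal_power)

lemma nn_tens_mag_sq:
  assumes "a \<in> L2" "b \<in> L2" "c \<in> L2"
  shows "(\<integral>\<^sup>+p. (tens (mag a) (mag b) (mag c) p)\<^sup>2 \<partial>lborel) = ennreal ((l2norm a * (l2norm b * l2norm c))\<^sup>2)"
  using assms by (subst nn_integral_tens_sq) (auto simp: nn_mag_sq power_mult_distrib ennreal_mult)

text \<open>The sixth power of the modulus is a cube times its conjugate, so its damped integral is
  a diagonal case of the form bound, and Fatou's lemma removes the damping. Integrability of H makes
  the solution bounded and the damped integral finite; the final constant depends on the
  \<open>L2\<close> norm alone and therefore survives limits in \<open>L2\<close>.\<close>

theorem strichartz:
  assumes H: "H \<in> L2" and i: "integrable lborel H"
  shows "(\<integral>\<^sup>+y. ennreal (cmod (evI H y) ^ 6) \<partial>lborel) \<le> ennreal (192 * cst * (l2norm H) ^ 6)"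
proof -
  have Hm[measurable]: "H \<in> borel_measurable borel" using H by auto
  have [measurable]: "evI H \<in> borel_measurable borel" by (rule evI_measurable[OF Hm])
  let ?\<theta> = "\<lambda>n y. exp (- (norm y)\<^sup>2 / (2 * (real (Suc n))\<^sup>2)) * cmod (evI H y) ^ 6"
  define M where "M = cmod (complex_of_real (1 / (2 * pi)^2)) * (LINT \<xi>|lborel. cmod (H \<xi>))"
  have M: "cmod (evI H y) \<le> M" for y
  proof -
    have "cmod (LINT \<xi>|lborel. exp (\<i> * complex_of_real (snd y \<bullet> \<xi> + fst y * norm \<xi> ^ 4)) * H \<xi>) \<le> (LINT \<xi>|lborel. cmod (H \<xi>))"
      using integral_norm_bound[of lborel "\<lambda>\<xi>. exp (\<i> * complex_of_real (snd y \<bullet> \<xi> + fst y * norm \<xi> ^ 4)) * H \<xi>"]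
      by (simp add: norm_mult)
    then show ?thesis unfolding evI_def M_def norm_mult[of "complex_of_real (1 / (2 * pi)^2)"] by (intro mult_left_mono) auto
  qed
  have each: "(\<integral>\<^sup>+y. ennreal (?\<theta> n y) \<partial>lborel) \<le> ennreal (192 * cst * (l2norm H) ^ 6)" for n
  proof -
    have ii: "integrable lborel (?\<theta> n)"
    proof (rule Bochner_Integration.integrable_bound)
      show "integrable lborel (\<lambda>y::real \<times> (real^2). exp (- (norm y)\<^sup>2 / (2 * (real (Suc n))\<^sup>2)) * M ^ 6)"
        by (intro integrable_mult_left integrable_exp_norm) simp
      show "AE y in lborel. norm (?\<theta> n y) \<le> norm (exp (- (norm y)\<^sup>2 / (2 * (real (Suc n))\<^sup>2)) * M ^ 6)"
        using M order_trans[OF norm_ge_zero M] by (intro AE_I2) (auto simp: abs_mult intro!: mult_left_mono power_mono)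
    qed measurable
    have eq: "complex_of_real (?\<theta> n y) = complex_of_real (exp (- (norm y)\<^sup>2 / (2 * (real (Suc n))\<^sup>2))) *
        (cnj (evI H y * (evI H y * evI H y)) * (evI H y * (evI H y * evI H y)))" for y
    proof -
      have "complex_of_real (cmod z ^ 6) = cnj (z * (z * z)) * (z * (z * z))" for z
      proof -
        have "complex_of_real (cmod z ^ 6) = (complex_of_real ((cmod z)\<^sup>2)) ^ 3" by (simp flip: power_mult)
        also have "\<dots> = (z * cnj z) ^ 3" by (simp only: complex_norm_square)
        finally show ?thesis by (simp add: power3_eq_cube mult_ac)
      qed
      then show ?thesis unfolding of_real_mult by simp
    qed
    have "(\<integral>\<^sup>+y. ennreal (?\<theta> n y) \<partial>lborel) = ennreal (LINT y|lborel. ?\<theta> n y)"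
      by (rule nn_integral_eq_integral[OF ii]) auto
    also have "\<dots> = ennreal (cmod (complex_of_real (LINT y|lborel. ?\<theta> n y)))"
      by (simp add: integral_nonneg_AE)
    also have "complex_of_real (LINT y|lborel. ?\<theta> n y) = (LINT y|lborel. complex_of_real (exp (- (norm y)\<^sup>2 / (2 * (real (Suc n))\<^sup>2))) *
        (cnj (evI H y * (evI H y * evI H y)) * (evI H y * (evI H y * evI H y))))"
      unfolding integral_complex_of_real[symmetric] by (simp only: eq)
    also have "ennreal (cmod \<dots>) \<le> ennreal cst * form (gauss (1/real (Suc n))) (gauss (1/real (Suc n))) (tens (mag H) (mag H) (mag H)) (tens (mag H) (mag H) (mag H))"
      by (rule evI_form_bound[OF i i i i i i]) simp
    also have "\<dots> \<le> ennreal cst * ennreal (192 * 1 * ((l2norm H * (l2norm H * l2norm H)) * (l2norm H * (l2norm H * l2norm H))))"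
      using nn_tens_mag_sq[OF H H H]
      by (intro mult_left_mono form_bound[OF kernel_gauss]) auto
    also have "\<dots> = ennreal (192 * cst * (l2norm H) ^ 6)"
      using cst_nonneg by (simp add: eval_nat_numeral mult_ac flip: ennreal_mult)
    finally show ?thesis .
  qed
  show ?thesis
    by (rule nn_integral_le_of_tendsto[OF _ AE_I2[OF exp_damping_mult_tendsto] always_eventually[OF allI[OF each]]]) measurable
qed

text \<open>The Strichartz bound is applied to the difference of two truncations, and Fatou's lemma
  sends the later index to infinity. The rate is the sixth power of
  \<open>(1/2) ^ m\<close>.\<close>

lemma L6_evolution_diff:
  assumes u: "u \<in> L2" and s: "strict_mono s" "\<And>k. l2norm (\<lambda>\<xi>. trunc (s k) (fourier_L2 u) \<xi> - fourier_L2 u \<xi>) \<le> (1/2)^k"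
  shows "(\<integral>\<^sup>+y. ennreal (cmod (evolution u y - ev (s m) (fourier_L2 u) y) ^ 6) \<partial>lborel) \<le> ennreal (192 * cst * (1/64) ^ m)"
proof -
  define h where "h = fourier_L2 u"
  have h: "h \<in> L2" unfolding h_def by (rule fourier_L2[OF u])
  have [measurable]: "h \<in> borel_measurable borel" using h by auto
  have [measurable]: "evolution u \<in> borel_measurable borel" by (rule evolution_spec[OF u])
  have "(\<integral>\<^sup>+y. ennreal (cmod (evolution u y - ev (s m) h y) ^ 6) \<partial>lborel) \<le> ennreal (192 * cst * (1/64) ^ m)"
  proof (rule nn_integral_le_of_tendsto[where f="\<lambda>k y. cmod (ev (s k) h y - ev (s m) h y) ^ 6"])
    show "AE y in lborel. (\<lambda>k. cmod (ev (s k) h y - ev (s m) h y) ^ 6) \<longlonglongrightarrow> cmod (evolution u y - ev (s m) h y) ^ 6"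
      using ev_tendsto_evolution[OF u s(2)] unfolding h_def by eventually_elim (intro tendsto_intros)
    show "\<forall>\<^sub>F k in sequentially. (\<integral>\<^sup>+y. ennreal (cmod (ev (s k) h y - ev (s m) h y) ^ 6) \<partial>lborel) \<le> ennreal (192 * cst * (1/64) ^ m)"
      using eventually_ge_at_top[of m]
    proof eventually_elim
      case (elim k)
      let ?H = "\<lambda>\<xi>. trunc (s k) h \<xi> - trunc (s m) h \<xi>"
      have i: "integrable lborel (trunc n h)" for n by (rule trunc_integrable[OF h])
      have sm: "s m \<le> s k" using elim s(1) by (simp add: strict_mono_less_eq)
      have "l2norm ?H \<le> (1/2)^m"
        using trunc_diff_le[OF h sm] s(2)[of m] unfolding h_def l2norm_minus_commute[of "trunc (s k) _"] by linarith
      then have "(l2norm ?H) ^ 6 \<le> ((1/2)^m) ^ 6" by (intro power_mono) auto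
      also have "((1/2::real)^m) ^ 6 = ((1/2)^6)^m" by (simp only: power_mult[symmetric] mult.commute)
      finally have b: "(l2norm ?H) ^ 6 \<le> (1/64) ^ m" by (simp add: power_divide)
      have "(\<integral>\<^sup>+y. ennreal (cmod (ev (s k) h y - ev (s m) h y) ^ 6) \<partial>lborel) = (\<integral>\<^sup>+y. ennreal (cmod (evI ?H y) ^ 6) \<partial>lborel)"
        unfolding ev_def evI_diff[OF i i] ..
      also have "\<dots> \<le> ennreal (192 * cst * (l2norm ?H) ^ 6)"
        by (rule strichartz) (use h i in auto)
      also have "\<dots> \<le> ennreal (192 * cst * (1/64) ^ m)"
        using b cst_nonneg by (intro ennreal_leI mult_left_mono) auto
      finally show ?case .
    qed
  qed measurable
  then show ?thesis by (simp only: h_def)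
qed

section \<open>Bounding Q by positive forms\<close>

text \<open>The weight can be moved between p and q only if their energies differ by less than 1.
  The cutoff \<open>ct\<close> isolates this part continuously. Its complement is dominated by
  \<open>\<tau>\<^sup>2\<close>, so the tail has mass at most the variance.\<close>

lemma gauss_real_split:
  assumes j: "\<sigma> > 0"
  defines "ct \<equiv> \<lambda>\<tau>::real. max 0 (1 - \<tau>\<^sup>2)"
  shows "kernel (\<lambda>\<tau>. gauss \<sigma> \<tau> * ct \<tau>) (gauss \<sigma>) 1" "kernel (\<lambda>\<tau>. gauss \<sigma> \<tau> * (1 - ct \<tau>)) (gauss \<sigma>) (\<sigma>\<^sup>2)"
proof -
  note k = kernel_gauss[OF j]
  have ct: "0 \<le> ct \<tau>" "ct \<tau> \<le> 1" "ct (- \<tau>) = ct \<tau>" "1 - ct \<tau> \<le> \<tau>\<^sup>2" for \<tau> by (auto simp: ct_def)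
  have c: "continuous_on UNIV ct" unfolding ct_def by (intro continuous_intros)
  have "(\<integral>\<^sup>+\<tau>. ennreal (gauss \<sigma> \<tau> * ct \<tau>) \<partial>lborel) \<le> (\<integral>\<^sup>+\<tau>. ennreal (gauss \<sigma> (\<tau>::real)) \<partial>lborel)"
    using ct by (intro nn_integral_mono ennreal_leI mult_left_le) auto
  also have "\<dots> = 1" using j by (rule nn_integral_gauss)
  finally show "kernel (\<lambda>\<tau>. gauss \<sigma> \<tau> * ct \<tau>) (gauss \<sigma>) 1"
    using k ct c unfolding kernel_def by (auto intro!: continuous_intros)
  have hb: "has_bochner_integral lborel (\<lambda>x. normal_density 0 \<sigma> x * (x - 0) ^ (2 * 1)) (fact (2 * 1) / ((2 / \<sigma>\<^sup>2)^1 * fact 1))"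
    by (rule normal_moment_even) (rule j)
  have "(\<integral>\<^sup>+\<tau>. ennreal (gauss \<sigma> \<tau> * (1 - ct \<tau>)) \<partial>lborel) \<le> (\<integral>\<^sup>+\<tau>. ennreal (normal_density 0 \<sigma> \<tau> * \<tau>\<^sup>2) \<partial>lborel)"
    unfolding gauss_real using ct by (intro nn_integral_mono ennreal_leI mult_left_mono) auto
  also have "\<dots> = ennreal (\<sigma>\<^sup>2)"
    using hb j by (subst nn_integral_eq_integral) (auto simp: has_bochner_integral_iff normal_density_nonneg)
  finally show "kernel (\<lambda>\<tau>. gauss \<sigma> \<tau> * (1 - ct \<tau>)) (gauss \<sigma>) (\<sigma>\<^sup>2)"
    using k ct c unfolding kernel_def by (auto intro!: continuous_intros)
qed

definition near :: "(real \<Rightarrow> real) \<Rightarrow> bool" where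
  "near \<psi> \<longleftrightarrow> (\<forall>\<tau>. 1 \<le> \<bar>\<tau>\<bar> \<longrightarrow> \<psi> \<tau> = 0)"

text \<open>The bound is uniform over kernels because the limit of concentrating Gaussians is taken
  only afterwards.\<close>

definition form_bounded :: "(real^2 \<Rightarrow> complex) \<Rightarrow> (real^2 \<Rightarrow> complex) \<Rightarrow> real \<Rightarrow> bool" where
  "form_bounded a h B \<longleftrightarrow> (\<forall>\<psi> \<phi>. kernel \<psi> \<phi> 1 \<longrightarrow> near \<psi> \<longrightarrow>
     form \<psi> \<phi> (tens (mag a) (mag h) (mag h)) (tens (mag h) (mag h) (mag h)) \<le> ennreal B)"

section \<open>The integrand of Q with one distinguished factor, and its perturbations in L6\<close>

definition six :: "complex \<Rightarrow> complex \<Rightarrow> complex" where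
  "six u v = (cnj u * v) * (cnj v * v) * (cnj v * v)"

lemma six_measurable [measurable (raw)]:
  assumes [measurable]: "u \<in> borel_measurable M" "v \<in> borel_measurable M"
  shows "(\<lambda>x. six (u x) (v x)) \<in> borel_measurable M"
  unfolding six_def by measurable

lemma six_bound: "cmod (six u v) \<le> (cmod u + cmod v) ^ 6"
proof -
  have "cmod (six u v) = cmod u * cmod v ^ 5" by (simp add: six_def norm_mult eval_nat_numeral mult_ac)
  also have "\<dots> \<le> (cmod u + cmod v) * (cmod u + cmod v) ^ 5" by (intro mult_mono power_mono) auto
  finally show ?thesis by (simp add: eval_nat_numeral)
qed

lemma norm_mult_diff_le:
  fixes a b a' b' :: complex
  assumes "cmod (a - a') \<le> d" "cmod (b - b') \<le> e" "cmod b \<le> z" "cmod a' \<le> y" "0 \<le> d" "0 \<le> y"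
  shows "cmod (a * b - a' * b') \<le> d * z + y * e"
proof -
  have "a * b - a' * b' = (a - a') * b + a' * (b - b')" by (simp add: algebra_simps)
  then have "cmod (a * b - a' * b') \<le> cmod (a - a') * cmod b + cmod a' * cmod (b - b')"
    by (metis norm_mult norm_triangle_ineq)
  also have "\<dots> \<le> d * z + y * e" using assms by (intro add_mono mult_mono) auto
  finally show ?thesis .
qed

text \<open>Exchanging the six factors in turn costs x each time and leaves five factors of size at
  most y. The factors are grouped in pairs so that \<open>norm_mult_diff_le\<close> can be
  iterated.\<close>

lemma six_diff:
  assumes x: "cmod (u - u') \<le> x" "cmod (v - v') \<le> x" and y: "cmod u \<le> y" "cmod v \<le> y" "cmod u' \<le> y" "cmod v' \<le> y"
  shows "cmod (six u v - six u' v') \<le> 6 * (x * y ^ 5)"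
proof -
  have nn: "0 \<le> x" "0 \<le> y" using order_trans[OF norm_ge_zero x(1)] order_trans[OF norm_ge_zero y(1)] by auto
  have c: "cmod (cnj u - cnj u') \<le> x" "cmod (cnj v - cnj v') \<le> x"
    using x by (simp_all flip: complex_cnj_diff)
  have n2: "cmod (a * b) \<le> y * y" if "cmod a \<le> y" "cmod b \<le> y" for a b
    unfolding norm_mult using that nn by (intro mult_mono) auto
  have p: "cmod (cnj u * v - cnj u' * v') \<le> x * y + y * x"
    by (rule norm_mult_diff_le[OF c(1) x(2) y(2)]) (use y nn in auto)
  have p': "cmod (cnj v * v - cnj v' * v') \<le> x * y + y * x"
    by (rule norm_mult_diff_le[OF c(2) x(2) y(2)]) (use y nn in auto)
  have q: "cmod ((cnj u * v) * (cnj v * v) - (cnj u' * v') * (cnj v' * v')) \<le> (x * y + y * x) * (y * y) + (y * y) * (x * y + y * x)"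
    by (rule norm_mult_diff_le[OF p p' n2 n2]) (use y nn in auto)
  have "cmod (six u v - six u' v') \<le> ((x * y + y * x) * (y * y) + (y * y) * (x * y + y * x)) * (y * y) + ((y * y) * (y * y)) * (x * y + y * x)"
    unfolding six_def
  proof (rule norm_mult_diff_le[OF q p'])
    show "cmod (cnj v * v) \<le> y * y" using y by (intro n2) auto
    show "cmod (cnj u' * v' * (cnj v' * v')) \<le> (y * y) * (y * y)"
      unfolding norm_mult[of "cnj u' * v'"] using y nn by (intro mult_mono n2) auto
  qed (use nn in auto)
  also have "\<dots> = 6 * (x * y ^ 5)" by (simp add: eval_nat_numeral algebra_simps)
  finally show ?thesis .
qed

text \<open>A Young inequality with a crude constant, by comparing x with \<open>\<eta> * y\<close>.
  The parameter lets a very small sixth power of x compensate a large coefficient, while the other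
  term is small through \<eta>.\<close>

lemma mult_power5_le:
  fixes x y \<eta> :: real
  assumes "0 \<le> x" "0 \<le> y" "0 < \<eta>"
  shows "x * y ^ 5 \<le> (1 / \<eta>) ^ 5 * x ^ 6 + \<eta> * y ^ 6"
proof (cases "\<eta> * y \<le> x")
  case True
  then have "y \<le> (1 / \<eta>) * x" using assms by (simp add: field_simps)
  then have "y ^ 5 \<le> ((1 / \<eta>) * x) ^ 5" using assms by (intro power_mono) auto
  then have "x * y ^ 5 \<le> x * ((1 / \<eta>) * x) ^ 5" using assms by (intro mult_left_mono)
  also have "\<dots> = (1 / \<eta>) ^ 5 * x ^ 6" by (simp only: power_mult_distrib) (simp add: eval_nat_numeral)
  finally show ?thesis using assms by (simp add: add_increasing2)
next
  case False
  then have "x * y ^ 5 \<le> (\<eta> * y) * y ^ 5" using assms by (intro mult_right_mono) auto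
  also have "\<dots> = \<eta> * y ^ 6" by (simp add: eval_nat_numeral)
  finally show ?thesis using assms by (simp add: add_increasing)
qed

lemma add_power6_le:
  fixes a b :: real
  assumes "0 \<le> a" "0 \<le> b"
  shows "(a + b) ^ 6 \<le> 64 * (a ^ 6 + b ^ 6)"
proof -
  have "(a + b) ^ 6 \<le> (2 * max a b) ^ 6" using assms by (intro power_mono) auto
  also have "\<dots> = 64 * (max a b) ^ 6" by (simp add: power_mult_distrib)
  also have "\<dots> \<le> 64 * (a ^ 6 + b ^ 6)" using assms by (simp add: max_def)
  finally show ?thesis .
qed

lemma L6_sum_finite:
  fixes a b :: "'a::euclidean_space \<Rightarrow> complex"
  assumes [measurable]: "a \<in> borel_measurable borel" "b \<in> borel_measurable borel"
    and A: "(\<integral>\<^sup>+y. ennreal (cmod (a y) ^ 6) \<partial>lborel) \<le> ennreal \<alpha>" and B: "(\<integral>\<^sup>+y. ennreal (cmod (b y) ^ 6) \<partial>lborel) \<le> ennreal \<beta>"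
    and nn: "0 \<le> \<alpha>" "0 \<le> \<beta>"
  shows "(\<integral>\<^sup>+y. ennreal ((cmod (a y) + cmod (b y)) ^ 6) \<partial>lborel) \<le> ennreal (64 * (\<alpha> + \<beta>))"
proof -
  have "(\<integral>\<^sup>+y. ennreal ((cmod (a y) + cmod (b y)) ^ 6) \<partial>lborel) \<le>
    (\<integral>\<^sup>+y. ennreal 64 * (ennreal (cmod (a y) ^ 6) + ennreal (cmod (b y) ^ 6)) \<partial>lborel)"
  proof (rule nn_integral_mono)
    fix y
    have "ennreal ((cmod (a y) + cmod (b y)) ^ 6) \<le> ennreal (64 * (cmod (a y) ^ 6 + cmod (b y) ^ 6))"
      by (intro ennreal_leI add_power6_le) auto
    then show "ennreal ((cmod (a y) + cmod (b y)) ^ 6) \<le> ennreal 64 * (ennreal (cmod (a y) ^ 6) + ennreal (cmod (b y) ^ 6))"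
      by (simp add: ennreal_mult)
  qed
  also have "\<dots> = ennreal 64 * ((\<integral>\<^sup>+y. ennreal (cmod (a y) ^ 6) \<partial>lborel) + (\<integral>\<^sup>+y. ennreal (cmod (b y) ^ 6) \<partial>lborel))"
    by (subst nn_integral_cmult, measurable) (subst nn_integral_add, auto)
  also have "\<dots> \<le> ennreal 64 * (ennreal \<alpha> + ennreal \<beta>)" by (intro mult_left_mono add_mono A B) auto
  also have "\<dots> = ennreal (64 * (\<alpha> + \<beta>))" using nn by (simp add: ennreal_mult)
  finally show ?thesis .
qed

lemma six_integrable:
  fixes a b :: "'a::euclidean_space \<Rightarrow> complex"
  assumes [measurable]: "a \<in> borel_measurable borel" "b \<in> borel_measurable borel"
    and A: "(\<integral>\<^sup>+y. ennreal (cmod (a y) ^ 6) \<partial>lborel) \<le> ennreal \<alpha>" and B: "(\<integral>\<^sup>+y. ennreal (cmod (b y) ^ 6) \<partial>lborel) \<le> ennreal \<beta>"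
    and nn: "0 \<le> \<alpha>" "0 \<le> \<beta>"
  shows "integrable lborel (\<lambda>y. six (a y) (b y))"
proof (rule integrableI_bounded)
  have "(\<integral>\<^sup>+y. ennreal (norm (six (a y) (b y))) \<partial>lborel) \<le> (\<integral>\<^sup>+y. ennreal ((cmod (a y) + cmod (b y)) ^ 6) \<partial>lborel)"
    by (intro nn_integral_mono ennreal_leI six_bound)
  also have "\<dots> \<le> ennreal (64 * (\<alpha> + \<beta>))" by (rule L6_sum_finite[OF assms])
  finally show "(\<integral>\<^sup>+y. ennreal (norm (six (a y) (b y))) \<partial>lborel) < \<infinity>" by (rule le_less_trans) simp
qed measurable

text \<open>Damping of width j + 1 in space-time yields kernels of width \<sigma> = 1 / (j + 1). The
  hypothesis controls their part near zero; the tail is of order \<open>\<sigma>\<^sup>2\<close> and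
  vanishes when the damping is removed.\<close>

lemma evI_six_bound:
  assumes a: "a \<in> L2" and h: "h \<in> L2" and B: "form_bounded a h B" "0 \<le> B"
  shows "cmod (LINT y|lborel. six (ev n a y) (ev n h y)) \<le> cst * B"
proof -
  let ?a = "trunc n a" and ?h = "trunc n h"
  have L: "?a \<in> L2" "?h \<in> L2" and i: "integrable lborel ?a" "integrable lborel ?h" using a h by auto
  have [measurable]: "evI ?a \<in> borel_measurable borel" "evI ?h \<in> borel_measurable borel"
    using L by (auto intro!: evI_measurable)
  have [measurable]: "a \<in> borel_measurable borel" "h \<in> borel_measurable borel" using a h by auto
  have si: "integrable lborel (\<lambda>y. six (evI ?a y) (evI ?h y))"
    by (rule six_integrable[OF _ _ strichartz[OF L(1) i(1)] strichartz[OF L(2) i(2)]]) (use cst_nonneg in auto)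
  define \<alpha> where "\<alpha> = l2norm a * (l2norm h * l2norm h)"
  define \<beta> where "\<beta> = l2norm h * (l2norm h * l2norm h)"
  have nn: "0 \<le> \<alpha>" "0 \<le> \<beta>" by (auto simp: \<alpha>_def \<beta>_def)
  let ?\<theta> = "\<lambda>j y. complex_of_real (exp (- (norm y)\<^sup>2 / (2 * (real (Suc j))\<^sup>2)))"
  let ?c = "\<lambda>j. 192 * (1 / real (Suc j))\<^sup>2 * (\<alpha> * \<beta>)"
  have each: "cmod (LINT y|lborel. ?\<theta> j y * six (evI ?a y) (evI ?h y)) \<le> cst * (B + ?c j)" for j
  proof -
    define \<sigma> where "\<sigma> = 1 / real (Suc j)"
    have \<sigma>: "\<sigma> > 0" by (simp add: \<sigma>_def)
    let ?ct = "\<lambda>\<tau>::real. max 0 (1 - \<tau>\<^sup>2)"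
    note k = gauss_real_split[OF \<sigma>]
    let ?T1 = "tens (mag a) (mag h) (mag h)" and ?T2 = "tens (mag h) (mag h) (mag h)"
    have tm: "mag (trunc n u) x \<le> mag u x" for u x by (simp add: trunc_apply)
    have "(LINT y|lborel. ?\<theta> j y * six (evI ?a y) (evI ?h y)) = (LINT y|lborel. ?\<theta> j y *
        (cnj (evI ?a y * (evI ?h y * evI ?h y)) * (evI ?h y * (evI ?h y * evI ?h y))))"
      by (intro Bochner_Integration.integral_cong refl) (simp add: six_def mult_ac)
    then have "ennreal (cmod (LINT y|lborel. ?\<theta> j y * six (evI ?a y) (evI ?h y))) \<le>
      ennreal cst * form (gauss \<sigma>) (gauss \<sigma>) (tens (mag ?a) (mag ?h) (mag ?h)) (tens (mag ?h) (mag ?h) (mag ?h))"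
      using evI_form_bound[OF i(1) i(2) i(2) i(2) i(2) i(2), of "real (Suc j)"] by (simp add: \<sigma>_def)
    also have "\<dots> \<le> ennreal cst * form (gauss \<sigma>) (gauss \<sigma>) ?T1 ?T2"
      by (intro mult_left_mono form_mono) (auto simp: tens_def intro!: mult_mono tm)
    also have "gauss \<sigma> = (\<lambda>\<tau>::real. gauss \<sigma> \<tau> * ?ct \<tau> + gauss \<sigma> \<tau> * (1 - ?ct \<tau>))" by (simp add: fun_eq_iff right_diff_distrib)
    also have "form (\<lambda>\<tau>. gauss \<sigma> \<tau> * ?ct \<tau> + gauss \<sigma> \<tau> * (1 - ?ct \<tau>)) (gauss \<sigma>) ?T1 ?T2 =
      form (\<lambda>\<tau>. gauss \<sigma> \<tau> * ?ct \<tau>) (gauss \<sigma>) ?T1 ?T2 + form (\<lambda>\<tau>. gauss \<sigma> \<tau> * (1 - ?ct \<tau>)) (gauss \<sigma>) ?T1 ?T2"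
      by (rule form_add_kernel[OF k]) measurable
    also have "ennreal cst * \<dots> \<le> ennreal cst * (ennreal B + ennreal (192 * \<sigma>\<^sup>2 * (\<alpha> * \<beta>)))"
    proof (intro mult_left_mono add_mono)
      have "near (\<lambda>\<tau>. gauss \<sigma> \<tau> * ?ct \<tau>)"
        unfolding near_def using abs_le_square_iff[of 1 \<tau> for \<tau> :: real] by (auto simp: max_def)
      then show "form (\<lambda>\<tau>. gauss \<sigma> \<tau> * ?ct \<tau>) (gauss \<sigma>) ?T1 ?T2 \<le> ennreal B"
        using B(1) k(1) unfolding form_bounded_def by blast
      show "form (\<lambda>\<tau>. gauss \<sigma> \<tau> * (1 - ?ct \<tau>)) (gauss \<sigma>) ?T1 ?T2 \<le> ennreal (192 * \<sigma>\<^sup>2 * (\<alpha> * \<beta>))"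
        using nn by (intro form_bound[OF k(2)]) (auto simp: nn_tens_mag_sq a h \<alpha>_def \<beta>_def)
    qed simp
    also have "\<dots> = ennreal (cst * (B + ?c j))"
      unfolding \<sigma>_def using B nn cst_nonneg by (subst ennreal_mult) auto
    finally show ?thesis using B nn cst_nonneg by (subst (asm) ennreal_le_iff) auto
  qed
  have "(\<lambda>j. LINT y|lborel. ?\<theta> j y * six (evI ?a y) (evI ?h y)) \<longlonglongrightarrow> (LINT y|lborel. six (evI ?a y) (evI ?h y))"
  proof (rule integral_dominated_convergence[where w="\<lambda>y. cmod (six (evI ?a y) (evI ?h y))"])
    show "integrable lborel (\<lambda>y. cmod (six (evI ?a y) (evI ?h y)))" using si by simp
    show "AE y in lborel. (\<lambda>j. ?\<theta> j y * six (evI ?a y) (evI ?h y)) \<longlonglongrightarrow> six (evI ?a y) (evI ?h y)"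
    proof (intro AE_I2)
      fix y
      have "(\<lambda>j. ?\<theta> j y * six (evI ?a y) (evI ?h y)) \<longlonglongrightarrow> complex_of_real 1 * six (evI ?a y) (evI ?h y)"
        by (intro tendsto_mult tendsto_of_real exp_damping_tendsto tendsto_const)
      then show "(\<lambda>j. ?\<theta> j y * six (evI ?a y) (evI ?h y)) \<longlonglongrightarrow> six (evI ?a y) (evI ?h y)" by (simp only: of_real_1 mult_1_left)
    qed
    show "AE y in lborel. norm (?\<theta> j y * six (evI ?a y) (evI ?h y)) \<le> cmod (six (evI ?a y) (evI ?h y))" for j
      by (auto simp: norm_mult intro!: mult_left_le_one_le)
  qed measurable
  from tendsto_norm[OF this]
  have l1: "(\<lambda>j. cmod (LINT y|lborel. ?\<theta> j y * six (evI ?a y) (evI ?h y))) \<longlonglongrightarrow> cmod (LINT y|lborel. six (evI ?a y) (evI ?h y))" .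
  have "(\<lambda>j. cst * (B + 192 * (inverse (real (Suc j)))\<^sup>2 * (\<alpha> * \<beta>))) \<longlonglongrightarrow> cst * (B + 192 * 0\<^sup>2 * (\<alpha> * \<beta>))"
    by (intro tendsto_intros LIMSEQ_inverse_real_of_nat)
  then have l2: "(\<lambda>j. cst * (B + ?c j)) \<longlonglongrightarrow> cst * B" by (simp add: inverse_eq_divide)
  show ?thesis unfolding ev_def using LIMSEQ_le[OF l1 l2] each by blast
qed

text \<open>The estimate holds for truncated solutions and is carried to the chosen representatives
  by convergence in L6; almost everywhere convergence alone would not control the limit of these
  integrals.\<close>

lemma Q_le:
  assumes g: "g \<in> L2" and f: "f \<in> L2" and B: "form_bounded (fourier_L2 g) (fourier_L2 f) B" "0 \<le> B"
  shows "cmod (Q g f f f f f) \<le> cst * B"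
proof -
  define a h where "a = fourier_L2 g" and "h = fourier_L2 f"
  have L: "a \<in> L2" "h \<in> L2" unfolding a_def h_def by (rule fourier_L2 g f)+
  obtain s where s: "strict_mono s" "\<And>k. l2norm (\<lambda>\<xi>. trunc (s k) a \<xi> - a \<xi>) \<le> (1/2)^k" "\<And>k. l2norm (\<lambda>\<xi>. trunc (s k) h \<xi> - h \<xi>) \<le> (1/2)^k"
    by (rule trunc_subseq[OF L], rule that)
  let ?U = "evolution g" and ?V = "evolution f"
  have [measurable]: "?U \<in> borel_measurable borel" "?V \<in> borel_measurable borel"
    using evolution_spec[OF g] evolution_spec[OF f] by auto
  have [measurable]: "ev n a \<in> borel_measurable borel" "ev n h \<in> borel_measurable borel" for n
    using L by (auto intro!: ev_measurable)
  let ?C = "192 * cst"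
  have C: "0 \<le> ?C" using cst_nonneg by simp
  define K where "K = ?C * (l2norm a) ^ 6 + ?C * (l2norm h) ^ 6"
  have K0: "0 \<le> K" "?C * (l2norm a) ^ 6 \<le> K" "?C * (l2norm h) ^ 6 \<le> K" unfolding K_def using C by (simp_all add: add_nonneg_nonneg)
  have ev6: "(\<integral>\<^sup>+y. ennreal (cmod (ev n H y) ^ 6) \<partial>lborel) \<le> ennreal (?C * (l2norm H) ^ 6)" if H: "H \<in> L2" for n H
  proof -
    have "(\<integral>\<^sup>+y. ennreal (cmod (ev n H y) ^ 6) \<partial>lborel) \<le> ennreal (?C * (l2norm (trunc n H)) ^ 6)"
      unfolding ev_def using H by (intro strichartz) auto
    also have "\<dots> \<le> ennreal (?C * (l2norm H) ^ 6)"
      using C H l2norm_mono[OF H, of "trunc n H"] by (intro ennreal_leI mult_left_mono power_mono) (auto simp: trunc_apply)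
    finally show ?thesis .
  qed
  have evK: "(\<integral>\<^sup>+y. ennreal (cmod (ev n a y) ^ 6) \<partial>lborel) \<le> ennreal K" "(\<integral>\<^sup>+y. ennreal (cmod (ev n h y) ^ 6) \<partial>lborel) \<le> ennreal K" for n
    using ev6[OF L(1), of n] ev6[OF L(2), of n] K0 by (auto intro: order_trans ennreal_leI)
  have d: "(\<integral>\<^sup>+y. ennreal (cmod (?U y - ev (s m) a y) ^ 6) \<partial>lborel) \<le> ennreal (?C * (1/64) ^ m)"
    "(\<integral>\<^sup>+y. ennreal (cmod (?V y - ev (s m) h y) ^ 6) \<partial>lborel) \<le> ennreal (?C * (1/64) ^ m)" for m
    using L6_evolution_diff[OF g s(1) s(2)[unfolded a_def], of m] L6_evolution_diff[OF f s(1) s(3)[unfolded h_def], of m]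
    by (auto simp: a_def h_def)
  \<comment> \<open>The approximant with index 0 already lies within a bounded L6 distance of
    \<open>evolution\<close>, which bounds the L6 norm of the latter.\<close>
  define K' where "K' = 64 * (?C * (1/64) ^ 0 + K)"
  have K': "0 \<le> K'" "K \<le> K'" using C K0 by (auto simp: K'_def)
  have UK: "(\<integral>\<^sup>+y. ennreal (cmod (W y) ^ 6) \<partial>lborel) \<le> ennreal K'"
    if [measurable]: "W \<in> borel_measurable borel" "V0 \<in> borel_measurable borel"
      and 1: "(\<integral>\<^sup>+y. ennreal (cmod (W y - V0 y) ^ 6) \<partial>lborel) \<le> ennreal (?C * (1/64) ^ 0)"
      and 2: "(\<integral>\<^sup>+y. ennreal (cmod (V0 y) ^ 6) \<partial>lborel) \<le> ennreal K" for W V0 :: "real \<times> (real^2) \<Rightarrow> complex"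
  proof -
    have "(\<integral>\<^sup>+y. ennreal (cmod (W y) ^ 6) \<partial>lborel) \<le> (\<integral>\<^sup>+y. ennreal ((cmod (W y - V0 y) + cmod (V0 y)) ^ 6) \<partial>lborel)"
    proof (intro nn_integral_mono ennreal_leI power_mono)
      show "cmod (W y) \<le> cmod (W y - V0 y) + cmod (V0 y)" for y using norm_triangle_ineq[of "W y - V0 y" "V0 y"] by simp
    qed simp
    also have "\<dots> \<le> ennreal K'" unfolding K'_def by (rule L6_sum_finite[OF _ _ 1 2]) (use C K0 in auto)
    finally show ?thesis .
  qed
  have UV: "(\<integral>\<^sup>+y. ennreal (cmod (?U y) ^ 6) \<partial>lborel) \<le> ennreal K'" "(\<integral>\<^sup>+y. ennreal (cmod (?V y) ^ 6) \<partial>lborel) \<le> ennreal K'"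
    by (rule UK[OF _ _ d(1)[of 0] evK(1)], measurable) (rule UK[OF _ _ d(2)[of 0] evK(2)], measurable)
  have iP: "integrable lborel (\<lambda>y. six (?U y) (?V y))" by (rule six_integrable[OF _ _ UV]) (use K' in auto)
  have iPm: "integrable lborel (\<lambda>y. six (ev n a y) (ev n h y))" for n by (rule six_integrable[OF _ _ evK]) (use K0 in auto)
  define D where "D = 6 * (128 * ?C + 16384 * K')"
  have D: "0 \<le> D" using C K' by (simp add: D_def)
  have diff: "cmod (LINT y|lborel. six (?U y) (?V y)) \<le> cst * B + D * (1/2) ^ m" for m
  proof -
    let ?A = "ev (s m) a" and ?H = "ev (s m) h"
    let ?x = "\<lambda>y. cmod (?U y - ?A y) + cmod (?V y - ?H y)"
    let ?y = "\<lambda>y. cmod (?U y) + cmod (?V y) + (cmod (?A y) + cmod (?H y))"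
    let ?R = "\<lambda>y. ennreal (6 * 32 ^ m) * ennreal ((?x y) ^ 6) + ennreal (6 * (1/2) ^ m * 64) * (ennreal ((cmod (?U y) + cmod (?V y)) ^ 6) + ennreal ((cmod (?A y) + cmod (?H y)) ^ 6))"
    have pt: "ennreal (cmod (six (?U y) (?V y) - six (?A y) (?H y))) \<le> ?R y" for y
    proof -
      have "cmod (six (?U y) (?V y) - six (?A y) (?H y)) \<le> 6 * (?x y * (?y y) ^ 5)"
        by (rule six_diff) auto
      \<comment> \<open>Here \<eta> = \<open>(1/2)^m\<close>. Its inverse fifth power
        \<open>32 ^ m\<close> meets the rate \<open>(1/64)^m\<close> of the sixth power of the
        distance, so both terms become multiples of \<open>(1/2)^m\<close>.\<close>
      also have "\<dots> \<le> 6 * ((1 / (1/2)^m) ^ 5 * (?x y) ^ 6 + (1/2)^m * (?y y) ^ 6)"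
        by (intro mult_left_mono mult_power5_le) auto
      also have "\<dots> \<le> 6 * ((1 / (1/2)^m) ^ 5 * (?x y) ^ 6 + (1/2)^m * (64 * ((cmod (?U y) + cmod (?V y)) ^ 6 + (cmod (?A y) + cmod (?H y)) ^ 6)))"
        by (intro mult_left_mono add_left_mono add_power6_le) auto
      also have "(1 / (1/2)^m) ^ 5 = (32::real) ^ m"
      proof -
        have "(1 / (1/2)^m) ^ 5 = ((2::real) ^ m) ^ 5" by (simp add: power_divide)
        also have "\<dots> = (2 ^ 5) ^ m" by (simp only: power_mult[symmetric] mult.commute)
        finally show ?thesis by simp
      qed
      finally have "cmod (six (?U y) (?V y) - six (?A y) (?H y)) \<le> 6 * 32 ^ m * (?x y) ^ 6 + 6 * (1/2)^m * 64 * ((cmod (?U y) + cmod (?V y)) ^ 6 + (cmod (?A y) + cmod (?H y)) ^ 6)"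
        by (simp only: distrib_left mult.assoc)
      then have "ennreal (cmod (six (?U y) (?V y) - six (?A y) (?H y))) \<le> ennreal (6 * 32 ^ m * (?x y) ^ 6 + 6 * (1/2)^m * 64 * ((cmod (?U y) + cmod (?V y)) ^ 6 + (cmod (?A y) + cmod (?H y)) ^ 6))"
        by (rule ennreal_leI)
      also have "\<dots> = ?R y"
        by (subst ennreal_plus) (auto simp: ennreal_mult simp del: ennreal_plus intro!: arg_cong2[where f="(+)"] arg_cong2[where f="(*)"] ennreal_plus)
      finally show ?thesis .
    qed
    have I1: "(\<integral>\<^sup>+y. ennreal ((?x y) ^ 6) \<partial>lborel) \<le> ennreal (64 * (?C * (1/64)^m + ?C * (1/64)^m))"
      by (rule L6_sum_finite[OF _ _ d(1) d(2)]) (use C in auto)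
    have I2: "(\<integral>\<^sup>+y. ennreal ((cmod (?U y) + cmod (?V y)) ^ 6) \<partial>lborel) \<le> ennreal (64 * (K' + K'))"
      by (rule L6_sum_finite[OF _ _ UV]) (use K' in auto)
    have I3: "(\<integral>\<^sup>+y. ennreal ((cmod (?A y) + cmod (?H y)) ^ 6) \<partial>lborel) \<le> ennreal (64 * (K' + K'))"
      by (rule L6_sum_finite[OF _ _ order_trans[OF evK(1) ennreal_leI[OF K'(2)]] order_trans[OF evK(2) ennreal_leI[OF K'(2)]]]) (use K' in auto)
    have "(\<integral>\<^sup>+y. ennreal (cmod (six (?U y) (?V y) - six (?A y) (?H y))) \<partial>lborel) \<le> (\<integral>\<^sup>+y. ?R y \<partial>lborel)"
      by (intro nn_integral_mono pt)
    also have "\<dots> = ennreal (6 * 32 ^ m) * (\<integral>\<^sup>+y. ennreal ((?x y) ^ 6) \<partial>lborel) + ennreal (6 * (1/2) ^ m * 64) *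
       ((\<integral>\<^sup>+y. ennreal ((cmod (?U y) + cmod (?V y)) ^ 6) \<partial>lborel) + (\<integral>\<^sup>+y. ennreal ((cmod (?A y) + cmod (?H y)) ^ 6) \<partial>lborel))"
      by (simp add: nn_integral_add nn_integral_cmult)
    also have "\<dots> \<le> ennreal (6 * 32 ^ m) * ennreal (64 * (?C * (1/64)^m + ?C * (1/64)^m)) + ennreal (6 * (1/2) ^ m * 64) * (ennreal (64 * (K' + K')) + ennreal (64 * (K' + K')))"
      by (intro add_mono mult_left_mono I1 I2 I3) auto
    also have "\<dots> = ennreal (6 * 32 ^ m * (64 * (?C * (1/64)^m + ?C * (1/64)^m)) + 6 * (1/2) ^ m * 64 * (64 * (K' + K') + 64 * (K' + K')))"
    proof -
      have "ennreal a * ennreal b + ennreal c * (ennreal d + ennreal e) = ennreal (a * b + c * (d + e))"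
        if "0 \<le> a" "0 \<le> b" "0 \<le> c" "0 \<le> d" "0 \<le> e" for a b c d e
        using that by (simp add: ennreal_mult ennreal_plus)
      then show ?thesis by this (use C K' in auto)
    qed
    also have "6 * 32 ^ m * (64 * (?C * (1/64)^m + ?C * (1/64)^m)) + 6 * (1/2) ^ m * 64 * (64 * (K' + K') + 64 * (K' + K')) = D * (1/2)^m"
    proof -
      have "(32::real) ^ m * (1/64) ^ m = (1/2) ^ m" by (simp flip: power_mult_distrib)
      then have "6 * 32 ^ m * (64 * (?C * (1/64)^m + ?C * (1/64)^m)) = 6 * (128 * ?C) * (1/2)^m" by (simp add: algebra_simps)
      then show ?thesis by (simp add: D_def algebra_simps)
    qed
    finally have e: "(\<integral>\<^sup>+y. ennreal (cmod (six (?U y) (?V y) - six (?A y) (?H y))) \<partial>lborel) \<le> ennreal (D * (1/2)^m)" .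
    have "ennreal (cmod (LINT y|lborel. six (?U y) (?V y) - six (?A y) (?H y))) \<le> ennreal (D * (1/2)^m)"
      by (rule order_trans[OF ennreal_norm_integral_le e])
    then have "cmod ((LINT y|lborel. six (?U y) (?V y)) - (LINT y|lborel. six (?A y) (?H y))) \<le> D * (1/2)^m"
      using D iP iPm by (simp add: ennreal_le_iff)
    moreover have "cmod (LINT y|lborel. six (?A y) (?H y)) \<le> cst * B"
      by (rule evI_six_bound[OF L B[folded a_def h_def]])
    ultimately show ?thesis
      using norm_triangle_sub[of "LINT y|lborel. six (?U y) (?V y)" "LINT y|lborel. six (?A y) (?H y)"] by linarith
  qed
  have "(\<lambda>m. cst * B + D * (1/2) ^ m) \<longlonglongrightarrow> cst * B + D * 0"
    by (intro tendsto_intros LIMSEQ_power_zero) auto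
  then have "cmod (LINT y|lborel. six (?U y) (?V y)) \<le> cst * B + D * 0"
    by (rule LIMSEQ_le_const) (use diff in auto)
  then show ?thesis by (simp add: Q_def six_def)
qed

section \<open>The bootstrap\<close>

text \<open>The exponential is capped at \<open>exp R\<close>, which keeps weighted functions in
  \<open>L2\<close> before any decay is known.\<close>

definition wt :: "real \<Rightarrow> real \<Rightarrow> real \<Rightarrow> real" where
  "wt \<mu> R \<tau> = exp (min (\<mu> * \<tau>) R)"

definition wf :: "real \<Rightarrow> real \<Rightarrow> (real^2 \<Rightarrow> complex) \<Rightarrow> real^2 \<Rightarrow> complex" where
  "wf \<mu> R u = (\<lambda>\<xi>. complex_of_real (wt \<mu> R (norm \<xi> ^ 4)) * u \<xi>)"

text \<open>The threshold is \<open>s\<^sup>2\<close>, whereas \<open>low\<close> and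
  \<open>rest\<close> are cut at s. Both \<open>form_zero_of_low\<close> and the high-low level set
  bound rely on this gap.\<close>

definition high :: "real \<Rightarrow> (real^2 \<Rightarrow> complex) \<Rightarrow> real^2 \<Rightarrow> complex" where
  "high s u = (\<lambda>\<xi>. if s\<^sup>2 \<le> norm \<xi> then u \<xi> else 0)"

definition low :: "real \<Rightarrow> (real^2 \<Rightarrow> complex) \<Rightarrow> real^2 \<Rightarrow> complex" where
  "low s u = (\<lambda>\<xi>. if norm \<xi> \<le> s then u \<xi> else 0)"

definition rest :: "real \<Rightarrow> (real^2 \<Rightarrow> complex) \<Rightarrow> real^2 \<Rightarrow> complex" where
  "rest s u = (\<lambda>\<xi>. if norm \<xi> \<le> s then 0 else u \<xi>)"

lemma cut_measurable [measurable (raw)]: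
  assumes [measurable]: "u \<in> borel_measurable borel"
  shows "high s u \<in> borel_measurable borel" "low s u \<in> borel_measurable borel" "rest s u \<in> borel_measurable borel" "wf \<mu> R u \<in> borel_measurable borel"
  unfolding high_def low_def rest_def wf_def wt_def by measurable

lemma cut_L2:
  assumes u: "u \<in> L2"
  shows "high s u \<in> L2" "low s u \<in> L2" "rest s u \<in> L2"
    and "l2norm (high s u) \<le> l2norm u" "l2norm (low s u) \<le> l2norm u" "l2norm (rest s u) \<le> l2norm u"
proof -
  have [measurable]: "u \<in> borel_measurable borel" using u by auto
  note m = cut_measurable[OF L2_measurable[OF u]]
  show "high s u \<in> L2" by (rule L2_mono(1)[OF u m(1), where C=1]) (auto simp: high_def)
  show "low s u \<in> L2" by (rule L2_mono(1)[OF u m(2), where C=1]) (auto simp: low_def)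
  show "rest s u \<in> L2" by (rule L2_mono(1)[OF u m(3), where C=1]) (auto simp: rest_def)
  show "l2norm (high s u) \<le> l2norm u" by (rule l2norm_mono[OF u m(1)]) (auto simp: high_def)
  show "l2norm (low s u) \<le> l2norm u" by (rule l2norm_mono[OF u m(2)]) (auto simp: low_def)
  show "l2norm (rest s u) \<le> l2norm u" by (rule l2norm_mono[OF u m(3)]) (auto simp: rest_def)
qed

lemma wt_bounds:
  assumes "0 \<le> \<mu>" "0 \<le> R" "0 \<le> \<tau>"
  shows "1 \<le> wt \<mu> R \<tau>" "wt \<mu> R \<tau> \<le> exp R" "wt \<mu> R \<tau> \<le> exp (\<mu> * \<tau>)" "0 < wt \<mu> R \<tau>"
  using assms by (auto simp: wt_def)

lemma wt_mono: "0 \<le> \<mu> \<Longrightarrow> \<tau> \<le> \<tau>' \<Longrightarrow> wt \<mu> R \<tau> \<le> wt \<mu> R \<tau>'"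
  using mult_left_mono[of \<tau> \<tau>' \<mu>] by (auto simp: wt_def)

text \<open>The capped exponent is subadditive: once one of the two terms reaches the cap R, the
  right side is at least R.\<close>

lemma wt_add:
  assumes "0 \<le> \<mu>" "0 \<le> R" "0 \<le> \<tau>" "0 \<le> \<tau>'"
  shows "wt \<mu> R (\<tau> + \<tau>') \<le> wt \<mu> R \<tau> * wt \<mu> R \<tau>'"
proof -
  have "0 \<le> \<mu> * \<tau>" "0 \<le> \<mu> * \<tau>'" using assms by auto
  then have "min (\<mu> * (\<tau> + \<tau>')) R \<le> min (\<mu> * \<tau>) R + min (\<mu> * \<tau>') R"
    using assms unfolding distrib_left by linarith
  then show ?thesis by (simp add: wt_def exp_add[symmetric])
qed

lemma wf_L2:
  assumes u: "u \<in> L2" and "0 \<le> \<mu>" "0 \<le> R"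
  shows "wf \<mu> R u \<in> L2"
  by (rule L2_mono(1)[OF u cut_measurable(4)[OF L2_measurable[OF u]], where C="exp R"])
     (use assms wt_bounds(2,4)[of \<mu> R] in \<open>auto simp: wf_def norm_mult less_imp_le intro!: mult_right_mono\<close>)

lemma tau3_nonneg: "0 \<le> tau3 p" by (simp add: tau3_def)

text \<open>A single momentum of p has at most the energy of p, hence less than that of q plus 1.
  The extra 1 costs \<open>exp 1 \<le> 3\<close>, and \<open>wt_add\<close> distributes the
  rest.\<close>

lemma wt_tau3:
  assumes "0 \<le> \<mu>" "\<mu> \<le> 1" "0 \<le> R" and pq: "\<bar>tau3 p - tau3 q\<bar> < 1"
  shows "wt \<mu> R (norm (fst p) ^ 4) \<le> 3 * (wt \<mu> R (norm (fst q) ^ 4) * (wt \<mu> R (norm (fst (snd q)) ^ 4) * wt \<mu> R (norm (snd (snd q)) ^ 4)))"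
proof -
  have pos: "0 \<le> wt \<mu> R \<tau>" for \<tau> by (simp add: wt_def)
  have "norm (fst p) ^ 4 \<le> tau3 p" by (simp add: tau3_def)
  also have "\<dots> \<le> 1 + tau3 q" using pq by linarith
  finally have "wt \<mu> R (norm (fst p) ^ 4) \<le> wt \<mu> R (1 + tau3 q)" using assms by (intro wt_mono)
  also have "\<dots> \<le> wt \<mu> R 1 * wt \<mu> R (tau3 q)" using assms tau3_nonneg by (intro wt_add) auto
  also have "\<dots> \<le> 3 * wt \<mu> R (tau3 q)"
  proof (rule mult_right_mono)
    have "wt \<mu> R 1 \<le> exp (\<mu> * 1)" using assms by (intro wt_bounds) auto
    also have "\<dots> \<le> exp 1" using assms by simp
    also have "\<dots> \<le> 3" by (rule exp_le)
    finally show "wt \<mu> R 1 \<le> 3" .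
  qed (rule pos)
  also have "wt \<mu> R (tau3 q) \<le> wt \<mu> R (norm (fst q) ^ 4) * (wt \<mu> R (norm (fst (snd q)) ^ 4) * wt \<mu> R (norm (snd (snd q)) ^ 4))"
  proof -
    have "wt \<mu> R (tau3 q) \<le> wt \<mu> R (norm (fst q) ^ 4) * wt \<mu> R (norm (fst (snd q)) ^ 4 + norm (snd (snd q)) ^ 4)"
      unfolding tau3_def add.assoc using assms by (intro wt_add) auto
    also have "\<dots> \<le> wt \<mu> R (norm (fst q) ^ 4) * (wt \<mu> R (norm (fst (snd q)) ^ 4) * wt \<mu> R (norm (snd (snd q)) ^ 4))"
      using assms pos by (intro mult_left_mono wt_add) auto
    finally show ?thesis .
  qed
  finally show ?thesis by simp
qed

section \<open>Form estimates with frequency cutoffs\<close>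

lemma form_mono_near:
  assumes near: "near \<psi>" and le: "\<And>p q. \<bar>tau3 p - tau3 q\<bar> < 1 \<Longrightarrow> A p * B q \<le> A' p * B' q"
  shows "form \<psi> \<phi> A B \<le> form \<psi> \<phi> A' B'"
  unfolding form_def
proof (intro nn_integral_mono)
  fix p q
  show "A p * B q * (ennreal (\<psi> (tau3 p - tau3 q)) * ennreal (\<phi> (sig3 p - sig3 q))) \<le>
    A' p * B' q * (ennreal (\<psi> (tau3 p - tau3 q)) * ennreal (\<phi> (sig3 p - sig3 q)))"
  proof (cases "\<bar>tau3 p - tau3 q\<bar> < 1")
    case True
    then show ?thesis by (intro mult_right_mono le) auto
  next
    case False
    then have "\<psi> (tau3 p - tau3 q) = 0" using near by (simp add: near_def)
    then show ?thesis by simp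
  qed
qed

lemma form_cmult:
  assumes k: "kernel \<psi> \<phi> \<kappa>" and [measurable]: "A \<in> borel_measurable borel" "B \<in> borel_measurable borel"
  shows "form \<psi> \<phi> (\<lambda>p. c * A p) B = c * form \<psi> \<phi> A B"
proof -
  note [measurable] = kernel_measurable[OF k]
  show ?thesis by (simp add: form_pair[OF k] nn_integral_cmult mult.assoc)
qed

text \<open>Three momenta of size at most s have energy at most \<open>3 * s ^ 4\<close>, while one
  of size at least \<open>s\<^sup>2\<close> already has \<open>s ^ 8\<close>. The gap exceeds 1,
  where a near kernel vanishes.\<close>

lemma form_zero_of_low:
  assumes near: "near \<psi>" and s: "8 \<le> s"
  shows "form \<psi> \<phi> (tens (mag (high s u)) b c) (tens (mag (low s a1)) (mag (low s a2)) (mag (low s a3))) = 0"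
proof -
  have "form \<psi> \<phi> (tens (mag (high s u)) b c) (tens (mag (low s a1)) (mag (low s a2)) (mag (low s a3))) \<le> form \<psi> \<phi> (\<lambda>p. 0) (\<lambda>q. 0)"
  proof (rule form_mono_near[OF near])
    fix p q :: triple assume pq: "\<bar>tau3 p - tau3 q\<bar> < 1"
    have "\<not> (s\<^sup>2 \<le> norm (fst p) \<and> norm (fst q) \<le> s \<and> norm (fst (snd q)) \<le> s \<and> norm (snd (snd q)) \<le> s)"
    proof
      assume *: "s\<^sup>2 \<le> norm (fst p) \<and> norm (fst q) \<le> s \<and> norm (fst (snd q)) \<le> s \<and> norm (snd (snd q)) \<le> s"
      then have "(s\<^sup>2) ^ 4 \<le> norm (fst p) ^ 4" by (intro power_mono) auto
      then have 1: "(s\<^sup>2) ^ 4 \<le> tau3 p" unfolding tau3_def by (simp add: add.assoc add_increasing2)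
      have "norm (fst q) ^ 4 \<le> s ^ 4" "norm (fst (snd q)) ^ 4 \<le> s ^ 4" "norm (snd (snd q)) ^ 4 \<le> s ^ 4"
        using * by (auto intro!: power_mono)
      then have 2: "tau3 q \<le> 3 * s ^ 4" by (simp add: tau3_def)
      have 3: "4 \<le> s ^ 4" using power_mono[of 8 s 4] s by simp
      then have "4 * s ^ 4 \<le> s ^ 4 * s ^ 4" by (intro mult_right_mono) auto
      also have "\<dots> = (s\<^sup>2) ^ 4" by (simp add: power_mult[symmetric] power_add[symmetric])
      finally show False using 1 2 3 pq by linarith
    qed
    then have "tens (mag (high s u)) b c p * tens (mag (low s a1)) (mag (low s a2)) (mag (low s a3)) q = 0"
      by (auto simp: tens_def high_def low_def)
    then show "tens (mag (high s u)) b c p * tens (mag (low s a1)) (mag (low s a2)) (mag (low s a3)) q \<le> 0 * 0" by simp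
  qed
  also have "\<dots> = 0" by (simp add: form_def)
  finally show ?thesis by simp
qed

lemma mag_split: "mag a x = mag (low s a) x + mag (rest s a) x"
  by (simp add: low_def rest_def)

text \<open>If the other two momenta of p are both low, Schur's test combines 192 with the refined
  bound \<open>128 / s ^ 3\<close>, whence 24576 = 192 * 128. Otherwise one of them lies above s and
  contributes \<rho>; the two positions give 384 = 2 * 192. B is arbitrary because q is decomposed
  separately.\<close>

lemma form_V_bound:
  assumes k: "kernel \<psi> \<phi> 1" and s: "8 \<le> s"
    and v: "v \<in> L2" and a: "a \<in> L2" and vs: "\<And>\<xi>. norm \<xi> < s\<^sup>2 \<Longrightarrow> v \<xi> = 0"
    and H: "l2norm v \<le> H" and N: "l2norm a \<le> N" and \<rho>: "l2norm (rest s a) \<le> \<rho>"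
    and B[measurable]: "B \<in> borel_measurable borel" and b: "(\<integral>\<^sup>+p. (B p)\<^sup>2 \<partial>lborel) \<le> ennreal (\<beta>\<^sup>2)" "0 \<le> \<beta>"
  shows "form \<psi> \<phi> (tens (mag v) (mag a) (mag a)) B \<le> ennreal ((sqrt (24576 / s ^ 3) * (H * N\<^sup>2) + 384 * (H * \<rho> * N)) * \<beta>)"
proof -
  have nn: "0 \<le> H" "0 \<le> N" "0 \<le> \<rho>" using order_trans[OF l2norm_nonneg] H N \<rho> by auto
  have [measurable]: "v \<in> borel_measurable borel" "a \<in> borel_measurable borel" using v a by auto
  note cL = cut_L2[OF a, of s]
  have sqb: "(\<integral>\<^sup>+p. (tens (mag x) (mag y) (mag z) p)\<^sup>2 \<partial>lborel) \<le> ennreal ((X * (Y * Z))\<^sup>2)"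
    if "x \<in> L2" "y \<in> L2" "z \<in> L2" "l2norm x \<le> X" "l2norm y \<le> Y" "l2norm z \<le> Z" for x y z X Y Z
  proof -
    have "0 \<le> Y" using order_trans[OF l2norm_nonneg] that by blast
    moreover have "0 \<le> X" using order_trans[OF l2norm_nonneg] that by blast
    ultimately show ?thesis unfolding nn_tens_mag_sq[OF that(1-3)] using that by (intro ennreal_leI power_mono mult_mono) auto
  qed
  have "form \<psi> \<phi> (tens (mag v) (mag a) (mag a)) B \<le> form \<psi> \<phi> (\<lambda>p. tens (mag v) (mag (low s a)) (mag (low s a)) p +
     (tens (mag v) (mag (rest s a)) (mag a) p + tens (mag v) (mag a) (mag (rest s a)) p)) B"
  proof (rule form_mono)
    fix p
    have "(x + y) * (x' + y') \<le> x * x' + (y * (x' + y') + (x + y) * y')" for x y x' y' :: ennreal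
      unfolding distrib_left distrib_right by (simp add: add_ac add_left_mono)
    then have "mag v (fst p) * (mag a (fst (snd p)) * mag a (snd (snd p))) \<le> mag v (fst p) * (mag (low s a) (fst (snd p)) * mag (low s a) (snd (snd p)) +
       (mag (rest s a) (fst (snd p)) * mag a (snd (snd p)) + mag a (fst (snd p)) * mag (rest s a) (snd (snd p))))"
      unfolding mag_split[of a _ s] by (intro mult_left_mono) auto
    then show "tens (mag v) (mag a) (mag a) p \<le> tens (mag v) (mag (low s a)) (mag (low s a)) p +
     (tens (mag v) (mag (rest s a)) (mag a) p + tens (mag v) (mag a) (mag (rest s a)) p)"
      by (simp only: tens_def distrib_left)
  qed simp
  also have "\<dots> = form \<psi> \<phi> (tens (mag v) (mag (low s a)) (mag (low s a))) B +
     (form \<psi> \<phi> (tens (mag v) (mag (rest s a)) (mag a)) B + form \<psi> \<phi> (tens (mag v) (mag a) (mag (rest s a))) B)"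
    by (subst form_add_left[OF k], measurable) (subst form_add_left[OF k], measurable)
  also have "\<dots> \<le> ennreal (sqrt (192 * 1 * (128 / s ^ 3)) * ((H * (N * N)) * \<beta>)) +
     (ennreal (192 * 1 * ((H * (\<rho> * N)) * \<beta>)) + ennreal (192 * 1 * ((H * (N * \<rho>)) * \<beta>)))"
  proof (intro add_mono)
    show "form \<psi> \<phi> (tens (mag v) (mag (low s a)) (mag (low s a))) B \<le> ennreal (sqrt (192 * 1 * (128 / s ^ 3)) * ((H * (N * N)) * \<beta>))"
    proof (rule form_schur[OF k _ B high_low_measurable _ kernel_row_bound_high_low[OF k s] _ _ b(1) _ b(2)])
      show "tens (mag v) (mag (low s a)) (mag (low s a)) \<in> borel_measurable borel" by measurable
      show "tens (mag v) (mag (low s a)) (mag (low s a)) p = 0" if "p \<notin> high_low s" for p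
        using that vs by (auto simp: tens_def high_low_def low_def not_le)
      show "(\<integral>\<^sup>+p. (tens (mag v) (mag (low s a)) (mag (low s a)) p)\<^sup>2 \<partial>lborel) \<le> ennreal ((H * (N * N))\<^sup>2)"
        using v cL H N by (intro sqb) auto
    qed (use s nn in auto)
    show "form \<psi> \<phi> (tens (mag v) (mag (rest s a)) (mag a)) B \<le> ennreal (192 * 1 * ((H * (\<rho> * N)) * \<beta>))"
      by (rule form_bound[OF k _ B sqb b(1) _ b(2)]) (use v a cL H N \<rho> nn in auto)
    show "form \<psi> \<phi> (tens (mag v) (mag a) (mag (rest s a))) B \<le> ennreal (192 * 1 * ((H * (N * \<rho>)) * \<beta>))"
      by (rule form_bound[OF k _ B sqb b(1) _ b(2)]) (use v a cL H N \<rho> nn in auto)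
  qed
  also have "\<dots> = ennreal (sqrt (192 * 1 * (128 / s ^ 3)) * ((H * (N * N)) * \<beta>) + (192 * 1 * ((H * (\<rho> * N)) * \<beta>) + 192 * 1 * ((H * (N * \<rho>)) * \<beta>)))"
  proof -
    have "ennreal x + (ennreal y + ennreal z) = ennreal (x + (y + z))" if "0 \<le> x" "0 \<le> y" "0 \<le> z" for x y z
      using that by (simp add: ennreal_plus)
    then show ?thesis by this (use nn b s in auto)
  qed
  also have "sqrt (192 * 1 * (128 / s ^ 3)) * ((H * (N * N)) * \<beta>) + (192 * 1 * ((H * (\<rho> * N)) * \<beta>) + 192 * 1 * ((H * (N * \<rho>)) * \<beta>)) =
     (sqrt (24576 / s ^ 3) * (H * N\<^sup>2) + 384 * (H * \<rho> * N)) * \<beta>"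
    by (simp add: power2_eq_square algebra_simps)
  finally show ?thesis .
qed

text \<open>The term with three low momenta in q vanishes, so each of the three others carries a
  factor \<rho>. Multiplied by \<open>form_V_bound\<close>, every contribution has two small
  factors.\<close>

lemma form_bootstrap:
  assumes k: "kernel \<psi> \<phi> 1" and near: "near \<psi>" and s: "8 \<le> s"
    and a: "a \<in> L2" and H: "l2norm (high s a) \<le> H" and N: "l2norm a \<le> N" and \<rho>: "l2norm (rest s a) \<le> \<rho>"
  shows "form \<psi> \<phi> (tens (mag (high s a)) (mag a) (mag a)) (tens (mag a) (mag a) (mag a)) \<le>
    ennreal (3 * ((sqrt (24576 / s ^ 3) * (H * N\<^sup>2) + 384 * (H * \<rho> * N)) * (\<rho> * N\<^sup>2)))"
proof -
  have nn: "0 \<le> H" "0 \<le> N" "0 \<le> \<rho>" using order_trans[OF l2norm_nonneg] H N \<rho> by auto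
  have [measurable]: "a \<in> borel_measurable borel" using a by auto
  note cL = cut_L2[OF a, of s]
  let ?V = "tens (mag (high s a)) (mag a) (mag a)"
  let ?r = "mag (rest s a)"
  let ?X = "(sqrt (24576 / s ^ 3) * (H * N\<^sup>2) + 384 * (H * \<rho> * N)) * (\<rho> * N\<^sup>2)"
  have X0: "0 \<le> ?X" using nn s by simp
  have V: "form \<psi> \<phi> ?V B \<le> ennreal ?X" if "B \<in> borel_measurable borel" "(\<integral>\<^sup>+p. (B p)\<^sup>2 \<partial>lborel) \<le> ennreal ((\<rho> * N\<^sup>2)\<^sup>2)" for B
    by (rule form_V_bound[OF k s cL(1) a _ H N \<rho> that]) (use nn in \<open>auto simp: high_def\<close>)
  have sq: "l2norm x * (l2norm y * l2norm z) \<le> \<rho> * N\<^sup>2" if "l2norm x \<le> X" "l2norm y \<le> Y" "l2norm z \<le> Z" "X * (Y * Z) = \<rho> * N\<^sup>2"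
     for x y z :: "real^2 \<Rightarrow> complex" and X Y Z
  proof -
    have "0 \<le> X" "0 \<le> Y" using order_trans[OF l2norm_nonneg] that by blast+
    then have "l2norm x * (l2norm y * l2norm z) \<le> X * (Y * Z)" using that by (intro mult_mono) auto
    then show ?thesis using that by simp
  qed
  have B1: "(\<integral>\<^sup>+p. (tens ?r (mag a) (mag a) p)\<^sup>2 \<partial>lborel) \<le> ennreal ((\<rho> * N\<^sup>2)\<^sup>2)"
    unfolding nn_tens_mag_sq[OF cL(3) a a] using \<rho> N by (intro ennreal_leI power_mono sq[of _ \<rho> _ N _ N]) (auto simp: power2_eq_square)
  have B2: "(\<integral>\<^sup>+p. (tens (mag a) ?r (mag a) p)\<^sup>2 \<partial>lborel) \<le> ennreal ((\<rho> * N\<^sup>2)\<^sup>2)"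
    unfolding nn_tens_mag_sq[OF a cL(3) a] using \<rho> N by (intro ennreal_leI power_mono sq[of _ N _ \<rho> _ N]) (auto simp: power2_eq_square)
  have B3: "(\<integral>\<^sup>+p. (tens (mag a) (mag a) ?r p)\<^sup>2 \<partial>lborel) \<le> ennreal ((\<rho> * N\<^sup>2)\<^sup>2)"
    unfolding nn_tens_mag_sq[OF a a cL(3)] using \<rho> N by (intro ennreal_leI power_mono sq[of _ N _ N _ \<rho>]) (auto simp: power2_eq_square)
  have "form \<psi> \<phi> ?V (tens (mag a) (mag a) (mag a)) \<le> form \<psi> \<phi> ?V (\<lambda>q. tens (mag (low s a)) (mag (low s a)) (mag (low s a)) q +
     (tens ?r (mag a) (mag a) q + (tens (mag a) ?r (mag a) q + tens (mag a) (mag a) ?r q)))"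
  proof (rule form_mono)
    fix q
    have e1: "(x + y) * (x' + y') \<le> x * x' + (y * (x' + y') + (x + y) * y')" for x y x' y' :: ennreal
      unfolding distrib_left distrib_right by (simp add: add_ac add_left_mono)
    \<comment> \<open>Mixed terms are counted more than once. This is harmless for an upper bound
      and leaves the remaining factors undivided, so that each of them contributes N.\<close>
    have "(x1 + y1) * ((x2 + y2) * (x3 + y3)) \<le> x1 * (x2 * x3) + (y1 * ((x2 + y2) * (x3 + y3)) + ((x1 + y1) * (y2 * (x3 + y3)) + (x1 + y1) * ((x2 + y2) * y3)))"
      for x1 y1 x2 y2 x3 y3 :: ennreal
    proof -
      have "(x1 + y1) * ((x2 + y2) * (x3 + y3)) = x1 * ((x2 + y2) * (x3 + y3)) + y1 * ((x2 + y2) * (x3 + y3))" by (rule distrib_right)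
      also have "\<dots> \<le> x1 * (x2 * x3 + (y2 * (x3 + y3) + (x2 + y2) * y3)) + y1 * ((x2 + y2) * (x3 + y3))"
        by (intro add_right_mono mult_left_mono e1) simp
      also have "\<dots> = x1 * (x2 * x3) + (y1 * ((x2 + y2) * (x3 + y3)) + (x1 * (y2 * (x3 + y3)) + x1 * ((x2 + y2) * y3)))"
        unfolding distrib_left[of x1] by (simp only: add_ac)
      also have "\<dots> \<le> x1 * (x2 * x3) + (y1 * ((x2 + y2) * (x3 + y3)) + ((x1 + y1) * (y2 * (x3 + y3)) + (x1 + y1) * ((x2 + y2) * y3)))"
        by (intro add_left_mono add_mono mult_right_mono) auto
      finally show ?thesis .
    qed
    then show "tens (mag a) (mag a) (mag a) q \<le> tens (mag (low s a)) (mag (low s a)) (mag (low s a)) q +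
     (tens ?r (mag a) (mag a) q + (tens (mag a) ?r (mag a) q + tens (mag a) (mag a) ?r q))"
      unfolding tens_def mag_split[of a _ s] .
  qed simp
  also have "\<dots> = form \<psi> \<phi> ?V (tens (mag (low s a)) (mag (low s a)) (mag (low s a))) +
     (form \<psi> \<phi> ?V (tens ?r (mag a) (mag a)) + (form \<psi> \<phi> ?V (tens (mag a) ?r (mag a)) + form \<psi> \<phi> ?V (tens (mag a) (mag a) ?r)))"
    by (subst form_add_right[OF k], measurable) (subst form_add_right[OF k], measurable, subst form_add_right[OF k], measurable)
  also have "\<dots> \<le> 0 + (ennreal ?X + (ennreal ?X + ennreal ?X))"
    using B1 B2 B3 by (intro add_mono V) (auto simp: form_zero_of_low[OF near s])
  also have "\<dots> = ennreal (3 * ?X)"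
  proof -
    have "0 + (ennreal x + (ennreal x + ennreal x)) = ennreal (3 * x)" if "0 \<le> x" for x
      using that by (simp flip: ennreal_plus)
    then show ?thesis using X0 by blast
  qed
  finally show ?thesis .
qed

lemma tens_mag: "tens (mag a) (mag b) (mag c) p = ennreal (cmod (a (fst p)) * (cmod (b (fst (snd p))) * cmod (c (snd (snd p)))))"
  by (simp add: tens_def ennreal_mult)

text \<open>The transform of a test function is prescribed only up to a null set. Instead of
  tracking null sets in the space of triples, the difference, which has norm zero, is put into
  \<open>form_bound\<close>.\<close>

lemma form_bounded_AE:
  assumes G: "G \<in> L2" and G': "G' \<in> L2" and h: "h \<in> L2" and e: "AE \<xi> in lborel. G' \<xi> = G \<xi>"
    and B: "form_bounded G h B"
  shows "form_bounded G' h B"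
  unfolding form_bounded_def
proof (intro allI impI)
  fix \<psi> \<phi> assume k: "kernel \<psi> \<phi> 1" and near: "near \<psi>"
  let ?d = "\<lambda>\<xi>. G' \<xi> - G \<xi>"
  have d: "?d \<in> L2" using G G' by simp
  have [measurable]: "G \<in> borel_measurable borel" "G' \<in> borel_measurable borel" "h \<in> borel_measurable borel" using G G' h by auto
  have "l2norm ?d = l2norm (\<lambda>\<xi>::real^2. 0)" by (rule l2norm_cong_AE) (use e in auto)
  then have d0: "l2norm ?d = 0" by (simp add: l2norm_def)
  let ?T = "tens (mag h) (mag h) (mag h)"
  have "form \<psi> \<phi> (tens (mag G') (mag h) (mag h)) ?T \<le> form \<psi> \<phi> (\<lambda>p. tens (mag G) (mag h) (mag h) p + tens (mag ?d) (mag h) (mag h) p) ?T"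
  proof (rule form_mono)
    fix p
    have "mag G' x \<le> mag G x + mag ?d x" for x
      using norm_triangle_sub[of "G' x" "G x"] by (simp flip: ennreal_plus)
    then show "tens (mag G') (mag h) (mag h) p \<le> tens (mag G) (mag h) (mag h) p + tens (mag ?d) (mag h) (mag h) p"
      unfolding tens_def distrib_right[symmetric] by (intro mult_right_mono) auto
  qed simp
  also have "\<dots> = form \<psi> \<phi> (tens (mag G) (mag h) (mag h)) ?T + form \<psi> \<phi> (tens (mag ?d) (mag h) (mag h)) ?T"
    by (subst form_add_left[OF k], measurable)
  also have "\<dots> \<le> ennreal B + ennreal (192 * 1 * (0 * (l2norm h * (l2norm h * l2norm h))))"
  proof (intro add_mono)
    show "form \<psi> \<phi> (tens (mag G) (mag h) (mag h)) ?T \<le> ennreal B" using B k near by (simp add: form_bounded_def)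
    show "form \<psi> \<phi> (tens (mag ?d) (mag h) (mag h)) ?T \<le> ennreal (192 * 1 * (0 * (l2norm h * (l2norm h * l2norm h))))"
      by (rule form_bound[OF k]) (auto simp: nn_tens_mag_sq[OF d h h] nn_tens_mag_sq[OF h h h] d0)
  qed
  finally show "form \<psi> \<phi> (tens (mag G') (mag h) (mag h)) ?T \<le> ennreal B" by simp
qed

text \<open>In the inner product the two weights of the test function are shared by both entries and
  give exactly \<open>H\<^sup>2\<close>. In \<open>Q\<close> one weight stays on the first momentum
  and the other is moved to q. The resulting bound is linear in H, so one factor H cancels.\<close>

lemma bootstrap_step:
  fixes f :: "real^2 \<Rightarrow> complex"
  assumes f: "f \<in> L2" and \<omega>: "\<omega> > 0"
    and eq: "\<And>g. g \<in> L2 \<Longrightarrow> complex_of_real \<omega> * inner_L2 g f = Q g f f f f f"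
    and s: "8 \<le> s" and R: "0 \<le> R" and \<mu>: "0 \<le> \<mu>" "\<mu> \<le> 1"
  defines "a \<equiv> wf \<mu> R (fourier_L2 f)"
  assumes N: "l2norm a \<le> N" and \<rho>: "l2norm (rest s a) \<le> \<rho>"
  shows "\<omega> * l2norm (high s a) \<le> (2 * pi)\<^sup>2 * cst * (9 * ((sqrt (24576 / s ^ 3) * N\<^sup>2 + 384 * (\<rho> * N)) * (\<rho> * N\<^sup>2)))"
proof -
  define h where "h = fourier_L2 f"
  have h: "h \<in> L2" unfolding h_def by (rule fourier_L2[OF f])
  have a_def': "a = wf \<mu> R h" by (simp add: a_def h_def)
  have a: "a \<in> L2" unfolding a_def' by (rule wf_L2[OF h \<mu>(1) R])
  define v where "v = high s a"
  have v: "v \<in> L2" unfolding v_def by (rule cut_L2[OF a])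
  define G where "G = wf \<mu> R v"
  have G: "G \<in> L2" unfolding G_def by (rule wf_L2[OF v \<mu>(1) R])
  define H where "H = l2norm v"
  have nn: "0 \<le> N" "0 \<le> \<rho>" "0 \<le> H" using order_trans[OF l2norm_nonneg] N \<rho> by (auto simp: H_def)
  have [measurable]: "h \<in> borel_measurable borel" "a \<in> borel_measurable borel" "v \<in> borel_measurable borel" "G \<in> borel_measurable borel"
    using h a v G by auto
  have pos: "0 < wt \<mu> R \<tau>" for \<tau> by (simp add: wt_def)
  have cw: "cmod (wf \<mu> R u x) = wt \<mu> R (norm x ^ 4) * cmod (u x)" for u x
    using pos by (simp add: wf_def norm_mult less_imp_le)
  define g where "g = inv_fourier_L2 G"
  have g: "g \<in> L2" and gG: "AE \<xi> in lborel. fourier_L2 g \<xi> = G \<xi>" unfolding g_def using inv_fourier_L2[OF G] by auto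
  define X where "X = (sqrt (24576 / s ^ 3) * (H * N\<^sup>2) + 384 * (H * \<rho> * N)) * (\<rho> * N\<^sup>2)"
  have X0: "0 \<le> X" unfolding X_def using nn s by simp
  have fb: "form_bounded G h (9 * X)"
    unfolding form_bounded_def
  proof (intro allI impI)
    fix \<psi> \<phi> assume k: "kernel \<psi> \<phi> 1" and near: "near \<psi>"
    have "form \<psi> \<phi> (tens (mag G) (mag h) (mag h)) (tens (mag h) (mag h) (mag h)) \<le>
      form \<psi> \<phi> (\<lambda>p. ennreal 3 * tens (mag v) (mag a) (mag a) p) (tens (mag a) (mag a) (mag a))"
    proof (rule form_mono_near[OF near])
      fix p q :: triple assume pq: "\<bar>tau3 p - tau3 q\<bar> < 1"
      define w where "w x = wt \<mu> R (norm x ^ 4)" for x :: "real^2"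
      have w1: "1 \<le> w x" for x unfolding w_def using \<mu> R by (intro wt_bounds) auto
      have w3: "w (fst p) \<le> 3 * (w (fst q) * (w (fst (snd q)) * w (snd (snd q))))" unfolding w_def by (rule wt_tau3[OF \<mu> R pq])
      \<comment> \<open>The second and third momenta of p acquire weights for free, since weights
        are at least 1.\<close>
      have ha: "cmod (h x) \<le> cmod (a x)" for x
        unfolding a_def' cw w_def[symmetric] using mult_right_mono[OF w1[of x], of "cmod (h x)"] by simp
      have "cmod (G (fst p)) * (cmod (h (fst (snd p))) * cmod (h (snd (snd p)))) * (cmod (h (fst q)) * (cmod (h (fst (snd q))) * cmod (h (snd (snd q))))) \<le>
         (w (fst p) * cmod (v (fst p))) * (cmod (a (fst (snd p))) * cmod (a (snd (snd p)))) * (cmod (h (fst q)) * (cmod (h (fst (snd q))) * cmod (h (snd (snd q)))))"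
        unfolding G_def cw w_def[symmetric] using order_trans[OF zero_le_one w1] by (intro mult_right_mono mult_left_mono mult_mono ha) auto
      also have "\<dots> \<le> (3 * (w (fst q) * (w (fst (snd q)) * w (snd (snd q)))) * cmod (v (fst p))) * (cmod (a (fst (snd p))) * cmod (a (snd (snd p)))) * (cmod (h (fst q)) * (cmod (h (fst (snd q))) * cmod (h (snd (snd q)))))"
        by (intro mult_right_mono w3) auto
      also have "\<dots> = (3 * (cmod (v (fst p)) * (cmod (a (fst (snd p))) * cmod (a (snd (snd p)))))) * (cmod (a (fst q)) * (cmod (a (fst (snd q))) * cmod (a (snd (snd q)))))"
        unfolding a_def' cw w_def[symmetric] by (simp only: mult_ac)
      finally have "ennreal (cmod (G (fst p)) * (cmod (h (fst (snd p))) * cmod (h (snd (snd p)))) * (cmod (h (fst q)) * (cmod (h (fst (snd q))) * cmod (h (snd (snd q))))))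
        \<le> ennreal ((3 * (cmod (v (fst p)) * (cmod (a (fst (snd p))) * cmod (a (snd (snd p)))))) * (cmod (a (fst q)) * (cmod (a (fst (snd q))) * cmod (a (snd (snd q))))))"
        by (rule ennreal_leI)
      moreover have em: "ennreal ((x * (y * z)) * (x' * (y' * z'))) = ennreal (x * (y * z)) * ennreal (x' * (y' * z'))"
        "ennreal ((3 * (x * (y * z))) * (x' * (y' * z'))) = ennreal 3 * ennreal (x * (y * z)) * ennreal (x' * (y' * z'))"
        if "0 \<le> x" "0 \<le> y" "0 \<le> z" "0 \<le> x'" "0 \<le> y'" "0 \<le> z'" for x y z x' y' z' :: real
        using that by (simp_all add: ennreal_mult mult_ac)
      ultimately show "tens (mag G) (mag h) (mag h) p * tens (mag h) (mag h) (mag h) q \<le> ennreal 3 * tens (mag v) (mag a) (mag a) p * tens (mag a) (mag a) (mag a) q"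
        unfolding tens_mag by (simp only: em norm_ge_zero)
    qed
    also have "\<dots> = ennreal 3 * form \<psi> \<phi> (tens (mag v) (mag a) (mag a)) (tens (mag a) (mag a) (mag a))"
      by (rule form_cmult[OF k]) measurable
    \<comment> \<open>One factor 3 is the price of moving the weight, the other counts the terms in
      \<open>form_bootstrap\<close>.\<close>
    also have "\<dots> \<le> ennreal 3 * ennreal (3 * X)"
      unfolding v_def X_def by (intro mult_left_mono form_bootstrap[OF k near s a _ N \<rho>]) (auto simp: H_def v_def)
    also have "\<dots> = ennreal (9 * X)" using X0 by (simp add: ennreal_mult[symmetric] flip: ennreal_numeral)
    finally show "form \<psi> \<phi> (tens (mag G) (mag h) (mag h)) (tens (mag h) (mag h) (mag h)) \<le> ennreal (9 * X)" .
  qed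
  have "form_bounded (fourier_L2 g) h (9 * X)" by (rule form_bounded_AE[OF G fourier_L2(1)[OF g] h gG fb])
  then have Ql: "cmod (Q g f f f f f) \<le> cst * (9 * X)" using X0 unfolding h_def by (intro Q_le[OF g f]) auto
  have "inner_L2 (fourier_L2 g) h = complex_of_real (H\<^sup>2)"
  proof -
    have "inner_L2 (fourier_L2 g) h = inner_L2 G h"
      unfolding inner_L2_def by (intro integral_cong_AE) (use gG L2_measurable[OF fourier_L2(1)[OF g]] in auto)
    also have "\<dots> = inner_L2 v v"
      unfolding inner_L2_def
    proof (intro Bochner_Integration.integral_cong refl)
      fix \<xi>
      show "cnj (G \<xi>) * h \<xi> = cnj (v \<xi>) * v \<xi>"
        by (simp add: G_def v_def a_def' wf_def high_def)
    qed
    finally show ?thesis unfolding H_def inner_L2_self .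
  qed
  then have "complex_of_real (H\<^sup>2) = complex_of_real ((2 * pi)\<^sup>2) * inner_L2 g f"
    using parseval[OF g f] by (simp add: h_def)
  then have "H\<^sup>2 = (2 * pi)\<^sup>2 * cmod (inner_L2 g f)"
    by (metis (no_types) abs_power2 norm_mult norm_of_real)
  moreover have "\<omega> * cmod (inner_L2 g f) = cmod (Q g f f f f f)"
    using \<omega> by (simp add: eq[OF g, symmetric] norm_mult)
  ultimately have "\<omega> * H\<^sup>2 = (2 * pi)\<^sup>2 * cmod (Q g f f f f f)" by (simp add: mult.left_commute)
  also have "\<dots> \<le> (2 * pi)\<^sup>2 * (cst * (9 * X))" by (intro mult_left_mono Ql) simp
  finally have *: "\<omega> * H * H \<le> ((2 * pi)\<^sup>2 * cst * (9 * ((sqrt (24576 / s ^ 3) * N\<^sup>2 + 384 * (\<rho> * N)) * (\<rho> * N\<^sup>2)))) * H"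
    unfolding X_def by (simp add: power2_eq_square algebra_simps)
  show ?thesis
  proof (cases "H = 0")
    case True
    then show ?thesis using nn s cst_nonneg unfolding H_def v_def by simp
  next
    case False
    then have "H > 0" using nn by simp
    then have "\<omega> * H \<le> (2 * pi)\<^sup>2 * cst * (9 * ((sqrt (24576 / s ^ 3) * N\<^sup>2 + 384 * (\<rho> * N)) * (\<rho> * N\<^sup>2)))"
      using * by (simp only: mult_le_cancel_right_pos)
    then show ?thesis by (simp only: H_def v_def)
  qed
qed

theorem exponential_decay:
  fixes f :: "real^2 \<Rightarrow> complex"
  assumes f: "f \<in> L2" and \<omega>: "\<omega> > 0"
    and eq: "\<And>g. g \<in> L2 \<Longrightarrow> complex_of_real \<omega> * inner_L2 g f = Q g f f f f f"
  shows "\<exists>\<mu>>0. (\<lambda>\<xi>. complex_of_real (exp (\<mu> * norm \<xi> ^ 4)) * fourier_L2 f \<xi>) \<in> L2"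
proof -
  define h where "h = fourier_L2 f"
  have h: "h \<in> L2" unfolding h_def by (rule fourier_L2[OF f])
  have [measurable]: "h \<in> borel_measurable borel" using h by auto
  \<comment> \<open>The weight will be at most 3 below \<open>s\<^sup>2\<close>, and the summand 1
    leaves room for the high part, whose norm is at most \<open>2 * \<eta> \<le> 1\<close>.\<close>
  define N where "N = 3 * l2norm h + 1"
  have N: "1 \<le> N" by (simp add: N_def)
  \<comment> \<open>Everything in \<open>bootstrap_step\<close> except the two small factors,
    increased by 1 so that A can serve as a divisor.\<close>
  define A where "A = (2 * pi)\<^sup>2 * cst * 9 * N ^ 3 / \<omega> + 1"
  have A: "1 \<le> A" using \<omega> N cst_nonneg by (simp add: A_def)
  \<comment> \<open>6912 = 2 * 3 * 1152 with 1152 = 3 * 384. With this choice the quadratic term in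
    the trapping estimate is at most \<eta> / 2, the same as the linear one.\<close>
  define \<eta> where "\<eta> = min (1/2) (1 / (6912 * A))"
  have \<eta>: "0 < \<eta>" "\<eta> \<le> 1/2" "6912 * A * \<eta> \<le> 1"
  proof -
    show "0 < \<eta>" "\<eta> \<le> 1/2" using A by (auto simp: \<eta>_def)
    have "6912 * A * \<eta> \<le> 6912 * A * (1 / (6912 * A))" using A by (intro mult_left_mono) (auto simp: \<eta>_def)
    then show "6912 * A * \<eta> \<le> 1" using A by simp
  qed
  have rest0: "l2norm (rest (real n) h) \<le> l2norm (\<lambda>\<xi>. trunc n h \<xi> - h \<xi>)" for n
    by (rule l2norm_mono[OF L2_diff[OF trunc_L2[OF h] h]]) (auto simp: rest_def trunc_apply)
  have "\<forall>\<^sub>F n in sequentially. l2norm (\<lambda>\<xi>. trunc n h \<xi> - h \<xi>) < \<eta> / 3"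
    by (rule order_tendstoD(2)[OF trunc_tendsto[OF h]]) (use \<eta> in simp)
  moreover have "\<forall>\<^sub>F n in sequentially. sqrt (24576 / real n ^ 3) * N < 1 / (6 * A)"
  proof (rule order_tendstoD(2))
    show "(\<lambda>n. sqrt (24576 / real n ^ 3) * N) \<longlonglongrightarrow> 0" by real_asymp
  qed (use A in simp)
  ultimately have "\<forall>\<^sub>F n in sequentially. l2norm (\<lambda>\<xi>. trunc n h \<xi> - h \<xi>) < \<eta> / 3 \<and> sqrt (24576 / real n ^ 3) * N < 1 / (6 * A) \<and> 8 \<le> n"
    using eventually_ge_at_top[of "8::nat"] by eventually_elim auto
  then obtain n where n: "l2norm (\<lambda>\<xi>. trunc n h \<xi> - h \<xi>) < \<eta> / 3" "sqrt (24576 / real n ^ 3) * N < 1 / (6 * A)" "8 \<le> n"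
    by (auto simp: eventually_sequentially)
  define s where "s = real n"
  have s: "8 \<le> s" using n by (simp add: s_def)
  have \<kappa>: "sqrt (24576 / s ^ 3) * N \<le> 1 / (6 * A)" using n by (simp add: s_def)
  have resth: "l2norm (rest s h) \<le> \<eta> / 3" using rest0[of n] n by (simp add: s_def)
  have ss: "s < s\<^sup>2" using s by (simp add: power2_eq_square)
  \<comment> \<open>Below \<open>s\<^sup>2\<close> the exponent
    \<open>\<mu> * norm \<xi> ^ 4\<close> is then at most 1, so the weight there is at most 3
    whatever the cap. The threshold s is fixed before \<mu>, from the unweighted h alone.\<close>
  define \<mu> where "\<mu> = 1 / s ^ 8"
  have \<mu>: "0 < \<mu>" "\<mu> \<le> 1" using s one_le_power[of s 8] by (auto simp: \<mu>_def)
  have w3: "exp (\<mu> * norm \<xi> ^ 4) \<le> 3" if "norm \<xi> < s\<^sup>2" for \<xi> :: "real^2"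
  proof -
    have "norm \<xi> ^ 4 \<le> (s\<^sup>2) ^ 4" using that by (intro power_mono) auto
    then have "\<mu> * norm \<xi> ^ 4 \<le> \<mu> * s ^ 8" using \<mu> by (intro mult_left_mono) (auto simp flip: power_mult)
    also have "\<dots> = 1" using s by (simp add: \<mu>_def)
    finally have "exp (\<mu> * norm \<xi> ^ 4) \<le> exp 1" by simp
    then show ?thesis using exp_le by linarith
  qed
  have cw: "cmod (wf \<mu> R u \<xi>) = wt \<mu> R (norm \<xi> ^ 4) * cmod (u \<xi>)" for R u \<xi>
    by (simp add: wf_def norm_mult wt_def)
  have low3: "cmod (wf \<mu> R h \<xi>) \<le> 3 * cmod (h \<xi>)" if "0 \<le> R" "norm \<xi> < s\<^sup>2" for R \<xi>
    unfolding cw using wt_bounds(3)[of \<mu> R "norm \<xi> ^ 4"] w3[OF that(2)] \<mu> that by (intro mult_right_mono) auto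
  have trap: "l2norm (high s (wf \<mu> R h)) \<le> \<eta>" if R: "0 \<le> R" and H: "l2norm (high s (wf \<mu> R h)) \<le> 2 * \<eta>" for R
  proof -
    let ?a = "wf \<mu> R h"
    have a: "?a \<in> L2" using \<mu> R by (intro wf_L2 h) auto
    have ha: "high s ?a \<in> L2" "rest s ?a \<in> L2" using cut_L2[OF a] by auto
    have "l2norm (\<lambda>\<xi>. ?a \<xi> - high s ?a \<xi>) \<le> 3 * l2norm h"
      by (rule L2_mono(2)[OF h L2_measurable[OF L2_diff[OF a ha(1)]]]) (use low3[OF R] in \<open>auto simp: high_def\<close>)
    moreover have "l2norm (\<lambda>\<xi>. (?a \<xi> - high s ?a \<xi>) + high s ?a \<xi>) \<le> l2norm (\<lambda>\<xi>. ?a \<xi> - high s ?a \<xi>) + l2norm (high s ?a)"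
      by (rule l2norm_triangle[OF L2_diff[OF a ha(1)] ha(1)])
    ultimately have Na: "l2norm ?a \<le> N" using H \<eta> by (simp add: N_def)
    \<comment> \<open>Between s and \<open>s\<^sup>2\<close> the weighted norm is at most 3 *
      (\<eta> / 3); adding the high part, at most 2 * \<eta>, gives \<rho> = 3 * \<eta>.\<close>
    have "l2norm (\<lambda>\<xi>. rest s ?a \<xi> - high s ?a \<xi>) \<le> 3 * l2norm (rest s h)"
      by (rule L2_mono(2)[OF cut_L2(3)[OF h] L2_measurable[OF L2_diff[OF ha(2,1)]]])
         (use low3[OF R] ss in \<open>auto simp: high_def rest_def\<close>)
    moreover have "l2norm (\<lambda>\<xi>. (rest s ?a \<xi> - high s ?a \<xi>) + high s ?a \<xi>) \<le> l2norm (\<lambda>\<xi>. rest s ?a \<xi> - high s ?a \<xi>) + l2norm (high s ?a)"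
      by (rule l2norm_triangle[OF L2_diff[OF ha(2,1)] ha(1)])
    ultimately have \<rho>: "l2norm (rest s ?a) \<le> 3 * \<eta>" using H resth by simp
    have "\<omega> * l2norm (high s ?a) \<le> (2 * pi)\<^sup>2 * cst * (9 * ((sqrt (24576 / s ^ 3) * N\<^sup>2 + 384 * ((3 * \<eta>) * N)) * ((3 * \<eta>) * N\<^sup>2)))"
      unfolding h_def by (rule bootstrap_step[OF f \<omega> eq s R less_imp_le[OF \<mu>(1)] \<mu>(2)]) (use Na \<rho> in \<open>simp_all add: h_def\<close>)
    also have "\<dots> = ((2 * pi)\<^sup>2 * cst * 9 * N ^ 3) * ((sqrt (24576 / s ^ 3) * N + 1152 * \<eta>) * (3 * \<eta>))"
      by (simp add: power2_eq_square power3_eq_cube algebra_simps)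
    finally have "l2norm (high s ?a) \<le> ((2 * pi)\<^sup>2 * cst * 9 * N ^ 3 / \<omega>) * ((sqrt (24576 / s ^ 3) * N + 1152 * \<eta>) * (3 * \<eta>))"
      using \<omega> by (simp add: field_simps)
    also have "\<dots> \<le> A * ((1 / (6 * A) + 1152 * \<eta>) * (3 * \<eta>))"
      using \<kappa> \<eta> N A s by (intro mult_mono mult_right_mono add_right_mono) (auto simp: A_def)
    also have "\<dots> = \<eta> / 2 + (6912 * A * \<eta>) * \<eta> / 2" using A by (simp add: field_simps)
    also have "\<dots> \<le> \<eta> / 2 + 1 * \<eta> / 2" using \<eta> by (intro add_left_mono divide_right_mono mult_right_mono) auto
    finally show ?thesis by simp
  qed
  have bound: "l2norm (high s (wf \<mu> (real k * ln 2) h)) \<le> \<eta>" for k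
  proof (induction k)
    case 0
    \<comment> \<open>With cap 0 the weight is constantly 1, so the induction starts from the small
      tail of h itself.\<close>
    have "wf \<mu> (real 0 * ln 2) h = h" using \<mu> by (simp add: wf_def wt_def fun_eq_iff min_absorb2)
    moreover have "l2norm (high s h) \<le> l2norm (rest s h)"
      by (rule l2norm_mono[OF cut_L2(3)[OF h] cut_measurable(1)]) (use ss in \<open>auto simp: high_def rest_def\<close>)
    ultimately show ?case using resth \<eta> by simp
  next
    case (Suc k)
    have a: "wf \<mu> (real k * ln 2) h \<in> L2" using \<mu> by (intro wf_L2 h) auto
    have "l2norm (high s (wf \<mu> (real (Suc k) * ln 2) h)) \<le> 2 * l2norm (high s (wf \<mu> (real k * ln 2) h))"
    proof (rule L2_mono(2)[OF cut_L2(1)[OF a]])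
      show "high s (wf \<mu> (real (Suc k) * ln 2) h) \<in> borel_measurable borel" by measurable
      fix \<xi> :: "real^2"
      have "min x (real (Suc k) * ln 2) \<le> ln 2 + min x (real k * ln 2)" for x
      proof -
        have "min x (r + l) \<le> l + min x r" if "0 \<le> l" for r l :: real using that by (auto simp: min_def)
        from this[of "ln 2" "real k * ln 2"] show ?thesis by (simp add: distrib_right add.commute)
      qed
      then have "wt \<mu> (real (Suc k) * ln 2) (norm \<xi> ^ 4) \<le> exp (ln 2 + min (\<mu> * norm \<xi> ^ 4) (real k * ln 2))"
        unfolding wt_def by (simp only: exp_le_cancel_iff)
      also have "\<dots> = 2 * wt \<mu> (real k * ln 2) (norm \<xi> ^ 4)" by (simp add: exp_add wt_def)
      finally have "wt \<mu> (real (Suc k) * ln 2) (norm \<xi> ^ 4) * cmod (h \<xi>) \<le> (2 * wt \<mu> (real k * ln 2) (norm \<xi> ^ 4)) * cmod (h \<xi>)"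
        by (rule mult_right_mono) simp
      then show "cmod (high s (wf \<mu> (real (Suc k) * ln 2) h) \<xi>) \<le> 2 * cmod (high s (wf \<mu> (real k * ln 2) h) \<xi>)"
        by (simp add: high_def cw)
    qed simp
    then show ?case using Suc by (intro trap) auto
  qed
  define u where "u \<xi> = complex_of_real (exp (\<mu> * norm \<xi> ^ 4)) * h \<xi>" for \<xi>
  have [measurable]: "u \<in> borel_measurable borel" unfolding u_def by measurable
  have "(\<integral>\<^sup>+\<xi>. ennreal ((cmod (high s u \<xi>))\<^sup>2) \<partial>lborel) \<le> ennreal (\<eta>\<^sup>2)"
  proof (rule nn_integral_le_of_tendsto[where f="\<lambda>k \<xi>. (cmod (high s (wf \<mu> (real k * ln 2) h) \<xi>))\<^sup>2"])
    show "AE \<xi> in lborel. (\<lambda>k. (cmod (high s (wf \<mu> (real k * ln 2) h) \<xi>))\<^sup>2) \<longlonglongrightarrow> (cmod (high s u \<xi>))\<^sup>2"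
    proof (intro AE_I2 tendsto_eventually)
      fix \<xi> :: "real^2"
      \<comment> \<open>From index m on the cap is inactive at this frequency, so the approximants
        are eventually constant and Fatou's lemma applies with the uniform bound.\<close>
      obtain m where m: "\<mu> * norm \<xi> ^ 4 / ln 2 \<le> real m" using real_arch_simple by blast
      show "\<forall>\<^sub>F k in sequentially. (cmod (high s (wf \<mu> (real k * ln 2) h) \<xi>))\<^sup>2 = (cmod (high s u \<xi>))\<^sup>2"
        using eventually_ge_at_top[of m]
      proof eventually_elim
        case (elim k)
        have "\<mu> * norm \<xi> ^ 4 / ln 2 \<le> real k" using m elim by linarith
        then have "\<mu> * norm \<xi> ^ 4 \<le> real k * ln 2" using ln_gt_zero[of 2] by (simp add: pos_divide_le_eq)
        then have "wf \<mu> (real k * ln 2) h \<xi> = u \<xi>" by (simp add: wf_def wt_def u_def min_absorb1)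
        then show ?case by (simp add: high_def)
      qed
    qed
    have "(\<integral>\<^sup>+\<xi>. ennreal ((cmod (high s (wf \<mu> (real k * ln 2) h) \<xi>))\<^sup>2) \<partial>lborel) \<le> ennreal (\<eta>\<^sup>2)" for k
    proof -
      have "high s (wf \<mu> (real k * ln 2) h) \<in> L2" using \<mu> by (intro cut_L2 wf_L2 h) auto
      then show ?thesis using bound[of k] by (simp add: nn_l2norm ennreal_leI power_mono)
    qed
    then show "\<forall>\<^sub>F k in sequentially. (\<integral>\<^sup>+\<xi>. ennreal ((cmod (high s (wf \<mu> (real k * ln 2) h) \<xi>))\<^sup>2) \<partial>lborel) \<le> ennreal (\<eta>\<^sup>2)"
      by simp
  qed measurable
  then have hu: "high s u \<in> L2" using \<eta> by (intro L2_I_nn(1)[of _ \<eta>]) auto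
  have lu: "(\<lambda>\<xi>. u \<xi> - high s u \<xi>) \<in> L2"
  proof (rule L2_mono(1)[OF h, where C=3])
    show "cmod (u \<xi> - high s u \<xi>) \<le> 3 * cmod (h \<xi>)" for \<xi>
      using w3[of \<xi>] by (auto simp: high_def u_def norm_mult not_le intro!: mult_right_mono)
  qed auto
  have "(\<lambda>\<xi>. (u \<xi> - high s u \<xi>) + high s u \<xi>) \<in> L2" by (rule L2_add[OF lu hu])
  then have "u \<in> L2" by simp
  then show ?thesis using \<mu>(1) unfolding u_def[abs_def] h_def by blast
qed

section \<open>Entire extension\<close>

text \<open>Cauchy-Schwarz: compensating the quartic weight leaves the factor
  \<open>exp (c * norm \<xi> - \<mu> * norm \<xi> ^ 4)\<close>, which is square integrable because
  the quartic term beats the linear one.\<close>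

lemma exp_weight_integrable:
  fixes h :: "real^2 \<Rightarrow> complex"
  assumes \<mu>: "\<mu> > 0" and L: "(\<lambda>\<xi>. complex_of_real (exp (\<mu> * norm \<xi> ^ 4)) * h \<xi>) \<in> L2" and h: "h \<in> L2"
  shows "integrable lborel (\<lambda>\<xi>. complex_of_real (exp (c * norm \<xi>)) * h \<xi>)"
proof -
  \<comment> \<open>Two completed squares: \<open>2 * (c * r) \<le> c\<^sup>2 + r\<^sup>2\<close>,
    and \<open>2 * (\<mu> * r ^ 4)\<close> is at least \<open>(3 / 2) * r\<^sup>2\<close> minus 9 /
    (32 \<mu>). What remains is \<open>- r\<^sup>2 / 2\<close>, the exponent of
    \<open>integrable_exp_norm\<close> at n = 1.\<close>
  define K where "K = c\<^sup>2 + 9 / (32 * \<mu>)"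
  define u where "u \<xi> = complex_of_real (exp (c * norm \<xi> - \<mu> * norm \<xi> ^ 4))" for \<xi> :: "real^2"
  have m[measurable]: "u \<in> borel_measurable borel" unfolding u_def by measurable
  have b: "2 * (c * r - \<mu> * r ^ 4) \<le> K - r\<^sup>2 / 2" for r :: real
  proof -
    have "0 \<le> (c - r)\<^sup>2" by simp
    then have 1: "2 * (c * r) \<le> c\<^sup>2 + r\<^sup>2" by (simp add: power2_diff)
    have "0 \<le> 2 * \<mu> * (r\<^sup>2 - 3 / (8 * \<mu>))\<^sup>2" using \<mu> by simp
    also have "\<dots> = 2 * (\<mu> * r ^ 4) - (3 / 2) * r\<^sup>2 + 9 / (32 * \<mu>)"
      using \<mu> by (simp add: power2_diff field_simps power2_eq_square power4_eq_xxxx)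
    finally show ?thesis using 1 by (simp add: K_def)
  qed
  have "u \<in> L2"
    unfolding L2_def
  proof (intro CollectI conjI)
    have "integrable lborel (\<lambda>\<xi>::real^2. exp K * exp (- (norm \<xi>)\<^sup>2 / (2 * 1\<^sup>2)))"
      by (intro integrable_mult_right integrable_exp_norm) simp
    then show "integrable lborel (\<lambda>\<xi>. (cmod (u \<xi>))\<^sup>2)"
    proof (rule Bochner_Integration.integrable_bound)
      show "AE \<xi> in lborel. norm ((cmod (u \<xi>))\<^sup>2) \<le> norm (exp K * exp (- (norm \<xi>)\<^sup>2 / (2 * 1\<^sup>2)))"
      proof (rule AE_I2)
        fix \<xi> :: "real^2"
        have "(cmod (u \<xi>))\<^sup>2 = exp (2 * (c * norm \<xi> - \<mu> * norm \<xi> ^ 4))"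
        proof -
          have "cmod (u \<xi>) = exp (c * norm \<xi> - \<mu> * norm \<xi> ^ 4)" by (simp add: u_def)
          then show ?thesis by (simp only: exp_double)
        qed
        also have "\<dots> \<le> exp (K - (norm \<xi>)\<^sup>2 / 2)" using b[of "norm \<xi>"] by simp
        also have "\<dots> = exp K * exp (- (norm \<xi>)\<^sup>2 / (2 * 1\<^sup>2))" by (simp add: exp_add[symmetric])
        finally show "norm ((cmod (u \<xi>))\<^sup>2) \<le> norm (exp K * exp (- (norm \<xi>)\<^sup>2 / (2 * 1\<^sup>2)))" by simp
      qed
    qed measurable
  qed (use m in simp)
  from L2_mult_integrable[OF this L]
  have "integrable lborel (\<lambda>\<xi>. u \<xi> * (complex_of_real (exp (\<mu> * norm \<xi> ^ 4)) * h \<xi>))" .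
  also have "(\<lambda>\<xi>. u \<xi> * (complex_of_real (exp (\<mu> * norm \<xi> ^ 4)) * h \<xi>)) = (\<lambda>\<xi>. complex_of_real (exp (c * norm \<xi>)) * h \<xi>)"
    by (simp add: u_def fun_eq_iff mult.assoc[symmetric] exp_add[symmetric] flip: of_real_mult)
  finally show ?thesis .
qed

text \<open>The complex bilinear extension of the inner product; a Hermitian one would conjugate z
  and destroy holomorphy.\<close>

definition cdot :: "complex^2 \<Rightarrow> real^2 \<Rightarrow> complex" where
  "cdot z \<xi> = (\<Sum>j\<in>UNIV. z $ j * complex_of_real (\<xi> $ j))"

lemma cdot_bound: "cmod (cdot z \<xi>) \<le> 2 * norm z * norm \<xi>"
proof -
  have "cmod (cdot z \<xi>) \<le> (\<Sum>j\<in>(UNIV::2 set). norm z * norm \<xi>)"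
    unfolding cdot_def
  proof (rule sum_norm_le)
    fix j :: 2
    show "cmod (z $ j * complex_of_real (\<xi> $ j)) \<le> norm z * norm \<xi>"
      unfolding norm_mult norm_of_real
      by (intro mult_mono Finite_Cartesian_Product.norm_nth_le component_le_norm_cart) auto
  qed
  then show ?thesis by simp
qed

lemma cdot_add: "cdot (z + w) \<xi> = cdot z \<xi> + cdot w \<xi>"
  by (simp add: cdot_def distrib_right sum.distrib)

lemma cdot_scale: "cdot (c *s w) \<xi> = c * cdot w \<xi>"
  by (simp add: cdot_def sum_distrib_left mult.assoc)

lemma cdot_measurable [measurable]: "cdot z \<in> borel_measurable borel"
  unfolding cdot_def[abs_def] by (intro borel_measurable_continuous_onI continuous_intros)

lemma exp_remainder: "cmod (exp \<zeta> - 1 - \<zeta>) \<le> exp (cmod \<zeta>) * (cmod \<zeta>)\<^sup>2" for \<zeta> :: complex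
proof -
  have "cmod (exp \<zeta> - (\<Sum>i\<le>1. \<zeta> ^ i / fact i)) \<le> exp \<bar>Re \<zeta>\<bar> * cmod \<zeta> ^ Suc 1 / fact 1"
    by (rule Taylor_exp)
  also have "\<dots> \<le> exp (cmod \<zeta>) * (cmod \<zeta>)\<^sup>2"
    using abs_Re_le_cmod[of \<zeta>] by (simp add: power2_eq_square mult_right_mono)
  finally show ?thesis by (simp add: algebra_simps)
qed

lemma sq_le_exp: "0 \<le> r \<Longrightarrow> r\<^sup>2 \<le> exp (2 * r)" for r :: real
proof -
  assume "0 \<le> r"
  moreover have "r \<le> exp r" using exp_ge_add_one_self[of r] by linarith
  ultimately have "r\<^sup>2 \<le> (exp r)\<^sup>2" by (intro power_mono)
  then show ?thesis by (simp add: exp_double)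
qed

text \<open>Differentiation under the integral with an explicit quadratic remainder. Exponential
  weights of every rate are available, and they absorb the growth of the exponential as well as the
  powers of \<xi>.\<close>

lemma entire_fourier:
  fixes h :: "real^2 \<Rightarrow> complex"
  assumes i: "\<And>c. integrable lborel (\<lambda>\<xi>. complex_of_real (exp (c * norm \<xi>)) * h \<xi>)" and hm[measurable]: "h \<in> borel_measurable borel"
  shows "entire (\<lambda>z. LINT \<xi>|lborel. exp (\<i> * cdot z \<xi>) * h \<xi>)"
  unfolding entire_def
proof (intro allI)
  fix z :: "complex^2"
  define F where "F z = (LINT \<xi>|lborel. exp (\<i> * cdot z \<xi>) * h \<xi>)" for z
  define D where "D w = (LINT \<xi>|lborel. (\<i> * cdot w \<xi>) * (exp (\<i> * cdot z \<xi>) * h \<xi>))" for w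
  have ir: "integrable lborel (\<lambda>\<xi>. exp (c * norm \<xi>) * cmod (h \<xi>))" for c
    using Bochner_Integration.integrable_norm[OF i[of c]] by (simp add: norm_mult)
  have ez: "cmod (exp (\<i> * cdot z \<xi>)) \<le> exp (2 * norm z * norm \<xi>)" for z \<xi>
  proof -
    have "cmod (exp (\<i> * cdot z \<xi>)) \<le> exp (cmod (\<i> * cdot z \<xi>))" by (rule norm_exp)
    also have "\<dots> \<le> exp (2 * norm z * norm \<xi>)" using cdot_bound[of z \<xi>] by (simp add: norm_mult)
    finally show ?thesis .
  qed
  have iF: "integrable lborel (\<lambda>\<xi>. exp (\<i> * cdot z \<xi>) * h \<xi>)" for z
  proof (rule Bochner_Integration.integrable_bound[OF ir[of "2 * norm z"]])
    show "AE \<xi> in lborel. norm (exp (\<i> * cdot z \<xi>) * h \<xi>) \<le> norm (exp (2 * norm z * norm \<xi>) * cmod (h \<xi>))"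
    proof (rule AE_I2)
      fix \<xi> :: "real^2"
      have "cmod (exp (\<i> * cdot z \<xi>)) * cmod (h \<xi>) \<le> exp (2 * norm z * norm \<xi>) * cmod (h \<xi>)"
        by (intro mult_right_mono ez) simp
      then show "norm (exp (\<i> * cdot z \<xi>) * h \<xi>) \<le> norm (exp (2 * norm z * norm \<xi>) * cmod (h \<xi>))"
        by (simp add: norm_mult del: norm_exp_eq_Re)
    qed
  qed measurable
  have iD: "integrable lborel (\<lambda>\<xi>. (\<i> * cdot w \<xi>) * (exp (\<i> * cdot z \<xi>) * h \<xi>))" for w
  proof (rule Bochner_Integration.integrable_bound)
    show "integrable lborel (\<lambda>\<xi>. (2 * norm w) * (exp ((1 + 2 * norm z) * norm \<xi>) * cmod (h \<xi>)))"
      by (intro integrable_mult_right ir)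
    show "AE \<xi> in lborel. norm ((\<i> * cdot w \<xi>) * (exp (\<i> * cdot z \<xi>) * h \<xi>)) \<le> norm ((2 * norm w) * (exp ((1 + 2 * norm z) * norm \<xi>) * cmod (h \<xi>)))"
    proof (rule AE_I2)
      fix \<xi> :: "real^2"
      have "norm \<xi> \<le> exp (norm \<xi>)" using exp_ge_add_one_self[of "norm \<xi>"] by linarith
      then have "2 * norm w * norm \<xi> \<le> 2 * norm w * exp (norm \<xi>)" by (intro mult_left_mono) auto
      then have "cmod (cdot w \<xi>) \<le> 2 * norm w * exp (norm \<xi>)"
        using cdot_bound[of w \<xi>] by linarith
      then have "cmod (cdot w \<xi>) * (cmod (exp (\<i> * cdot z \<xi>)) * cmod (h \<xi>)) \<le> (2 * norm w * exp (norm \<xi>)) * (exp (2 * norm z * norm \<xi>) * cmod (h \<xi>))"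
        using ez by (intro mult_mono mult_right_mono) auto
      also have "\<dots> = (2 * norm w) * (exp ((1 + 2 * norm z) * norm \<xi>) * cmod (h \<xi>))"
        by (simp add: distrib_right exp_add)
      finally show "norm ((\<i> * cdot w \<xi>) * (exp (\<i> * cdot z \<xi>) * h \<xi>)) \<le> norm ((2 * norm w) * (exp ((1 + 2 * norm z) * norm \<xi>) * cmod (h \<xi>)))"
        by (simp add: norm_mult)
    qed
  qed measurable
  have Dadd: "D (v + w) = D v + D w" for v w
    unfolding D_def cdot_add using iD[of v] iD[of w] by (simp add: distrib_left distrib_right)
  have Dscale: "D (c *s w) = c * D w" for c w
    unfolding D_def cdot_scale by (simp add: mult.left_commute mult.assoc flip: integral_mult_right_zero)
  have Dlin: "linear D"
  proof (rule linearI[OF Dadd])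
    fix r :: real and w :: "complex^2"
    have "r *\<^sub>R w = complex_of_real r *s w"
      by (simp only: vec_eq_iff vector_scaleR_component vector_smult_component) (simp add: scaleR_conv_of_real)
    then show "D (r *\<^sub>R w) = r *\<^sub>R D w" using Dscale[of "complex_of_real r" w] by (simp add: scaleR_conv_of_real)
  qed
  \<comment> \<open>In the rate, \<open>2 * norm z\<close> comes from the exponential at z, 2 from
    the increment with \<open>norm w \<le> 1\<close>, and 2 from \<open>sq_le_exp\<close>. The
    leading 4 is the square of the constant in \<open>cdot_bound\<close>.\<close>
  define K where "K = 4 * (LINT \<xi>|lborel. exp ((2 * norm z + 4) * norm \<xi>) * cmod (h \<xi>))"
  have rem: "cmod (F (z + w) - F z - D w) \<le> K * (norm w)\<^sup>2" if w: "norm w \<le> 1" for w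
  proof -
    have e: "F (z + w) - F z - D w = (LINT \<xi>|lborel. exp (\<i> * cdot (z + w) \<xi>) * h \<xi> - exp (\<i> * cdot z \<xi>) * h \<xi> - (\<i> * cdot w \<xi>) * (exp (\<i> * cdot z \<xi>) * h \<xi>))"
      unfolding F_def D_def using iF[of "z + w"] iF[of z] iD[of w] by simp
    have "cmod (F (z + w) - F z - D w) \<le> (LINT \<xi>|lborel. (4 * (norm w)\<^sup>2) * (exp ((2 * norm z + 4) * norm \<xi>) * cmod (h \<xi>)))"
      unfolding e
    proof (rule Bochner_Integration.integral_norm_bound_integral)
      show "integrable lborel (\<lambda>\<xi>. exp (\<i> * cdot (z + w) \<xi>) * h \<xi> - exp (\<i> * cdot z \<xi>) * h \<xi> - (\<i> * cdot w \<xi>) * (exp (\<i> * cdot z \<xi>) * h \<xi>))"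
        by (intro Bochner_Integration.integrable_diff iF iD)
      show "integrable lborel (\<lambda>\<xi>. (4 * (norm w)\<^sup>2) * (exp ((2 * norm z + 4) * norm \<xi>) * cmod (h \<xi>)))"
        by (intro integrable_mult_right ir)
      fix \<xi> :: "real^2"
      let ?\<zeta> = "\<i> * cdot w \<xi>"
      have z1: "cmod ?\<zeta> \<le> 2 * norm w * norm \<xi>" using cdot_bound[of w \<xi>] by (simp add: norm_mult)
      also have "\<dots> \<le> 2 * norm \<xi>" using mult_right_mono[OF w, of "norm \<xi>"] by simp
      finally have z2: "cmod ?\<zeta> \<le> 2 * norm \<xi>" .
      have "cmod (exp ?\<zeta> - 1 - ?\<zeta>) \<le> exp (cmod ?\<zeta>) * (cmod ?\<zeta>)\<^sup>2" by (rule exp_remainder)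
      also have "\<dots> \<le> exp (2 * norm \<xi>) * (2 * norm w * norm \<xi>)\<^sup>2"
        using z1 z2 by (intro mult_mono power_mono) auto
      also have "\<dots> = exp (2 * norm \<xi>) * (4 * (norm w)\<^sup>2 * (norm \<xi>)\<^sup>2)" by (simp add: power_mult_distrib)
      also have "\<dots> \<le> exp (2 * norm \<xi>) * (4 * (norm w)\<^sup>2 * exp (2 * norm \<xi>))"
        by (intro mult_left_mono sq_le_exp) auto
      finally have r: "cmod (exp ?\<zeta> - 1 - ?\<zeta>) \<le> exp (2 * norm \<xi>) * (4 * (norm w)\<^sup>2 * exp (2 * norm \<xi>))" .
      have "exp (\<i> * cdot (z + w) \<xi>) * h \<xi> - exp (\<i> * cdot z \<xi>) * h \<xi> - ?\<zeta> * (exp (\<i> * cdot z \<xi>) * h \<xi>) = (exp ?\<zeta> - 1 - ?\<zeta>) * (exp (\<i> * cdot z \<xi>) * h \<xi>)"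
        by (simp add: cdot_add distrib_left exp_add algebra_simps)
      then have "cmod (exp (\<i> * cdot (z + w) \<xi>) * h \<xi> - exp (\<i> * cdot z \<xi>) * h \<xi> - ?\<zeta> * (exp (\<i> * cdot z \<xi>) * h \<xi>)) = cmod (exp ?\<zeta> - 1 - ?\<zeta>) * (cmod (exp (\<i> * cdot z \<xi>)) * cmod (h \<xi>))"
        by (simp only: norm_mult)
      also have "\<dots> \<le> (exp (2 * norm \<xi>) * (4 * (norm w)\<^sup>2 * exp (2 * norm \<xi>))) * (exp (2 * norm z * norm \<xi>) * cmod (h \<xi>))"
        by (intro mult_mono mult_right_mono r ez) auto
      also have "\<dots> = (4 * (norm w)\<^sup>2) * ((exp (2 * norm z * norm \<xi>) * exp (2 * norm \<xi>) * exp (2 * norm \<xi>)) * cmod (h \<xi>))"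
        by (simp only: mult_ac)
      also have "exp (2 * norm z * norm \<xi>) * exp (2 * norm \<xi>) * exp (2 * norm \<xi>) = exp ((2 * norm z + 4) * norm \<xi>)"
        unfolding exp_add[symmetric] by (simp add: algebra_simps)
      finally show "cmod (exp (\<i> * cdot (z + w) \<xi>) * h \<xi> - exp (\<i> * cdot z \<xi>) * h \<xi> - ?\<zeta> * (exp (\<i> * cdot z \<xi>) * h \<xi>)) \<le> (4 * (norm w)\<^sup>2) * (exp ((2 * norm z + 4) * norm \<xi>) * cmod (h \<xi>))" .
    qed
    also have "\<dots> = K * (norm w)\<^sup>2" by (simp add: K_def)
    finally show ?thesis .
  qed
  have "(F has_derivative D) (at z)"
  proof (rule has_derivativeI_sandwich[where e=1 and H="\<lambda>y. K * norm (y - z)"])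
    show "bounded_linear D" using Dlin by (simp add: linear_conv_bounded_linear)
    show "((\<lambda>y. K * norm (y - z)) \<longlongrightarrow> 0) (at z)"
    proof -
      have "((\<lambda>y. K * norm (y - z)) \<longlongrightarrow> K * norm (z - z)) (at z)" by (intro tendsto_intros)
      then show ?thesis by simp
    qed
    fix y assume y: "y \<noteq> z" "dist y z < 1"
    then have "cmod (F (z + (y - z)) - F z - D (y - z)) \<le> K * (norm (y - z))\<^sup>2"
      by (intro rem) (simp add: dist_norm)
    then show "norm (F y - F z - D (y - z)) / norm (y - z) \<le> K * norm (y - z)"
      using y by (simp add: pos_divide_le_eq power2_eq_square mult.assoc)
  qed simp
  then show "\<exists>D. ((\<lambda>z. LINT \<xi>|lborel. exp (\<i> * cdot z \<xi>) * h \<xi>) has_derivative D) (at z) \<and> (\<forall>c w. D (c *s w) = c * D w)"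
    using Dscale unfolding F_def by blast
qed

lemma entire_cmult: "entire F \<Longrightarrow> entire (\<lambda>z. c * F z)"
  unfolding entire_def
proof (intro allI)
  fix z assume "\<forall>z. \<exists>D. (F has_derivative D) (at z) \<and> (\<forall>c w. D (c *s w) = c * D w)"
  then obtain D where D: "(F has_derivative D) (at z)" "\<And>c w. D (c *s w) = c * D w" by blast
  show "\<exists>D. ((\<lambda>z. c * F z) has_derivative D) (at z) \<and> (\<forall>c w. D (c *s w) = c * D w)"
    by (rule exI[of _ "\<lambda>w. c * D w"]) (use D in \<open>auto intro!: derivative_eq_intros simp: mult.left_commute\<close>)
qed

text \<open>The truncated inverse transforms at time 0 have two limits: F at every real point, by
  dominated convergence because h is integrable, and f almost everywhere, because the propagator at
  time 0 is the identity. Comparing them identifies f with F on the real plane.\<close>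

lemma extends_to_entire_of_decay:
  fixes f :: "real^2 \<Rightarrow> complex"
  assumes f: "f \<in> L2" and \<mu>: "\<mu> > 0" and L: "(\<lambda>\<xi>. complex_of_real (exp (\<mu> * norm \<xi> ^ 4)) * fourier_L2 f \<xi>) \<in> L2"
  shows "extends_to_entire f"
proof -
  define h where "h = fourier_L2 f"
  have h: "h \<in> L2" unfolding h_def by (rule fourier_L2[OF f])
  have [measurable]: "h \<in> borel_measurable borel" using h by auto
  have i: "integrable lborel (\<lambda>\<xi>. complex_of_real (exp (c * norm \<xi>)) * h \<xi>)" for c
    by (rule exp_weight_integrable[OF \<mu> L[folded h_def] h])
  have ih: "integrable lborel (\<lambda>\<xi>. cmod (h \<xi>))" using i[of 0] by simp
  define F where "F z = complex_of_real (1 / (2 * pi)^2) * (LINT \<xi>|lborel. exp (\<i> * cdot z \<xi>) * h \<xi>)" for z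
  have eF: "entire F" unfolding F_def[abs_def] by (intro entire_cmult entire_fourier i) measurable
  obtain s where s: "strict_mono s" "\<And>k. l2norm (\<lambda>\<xi>. trunc (s k) h \<xi> - h \<xi>) \<le> (1/2)^k" "\<And>k. l2norm (\<lambda>\<xi>. trunc (s k) h \<xi> - h \<xi>) \<le> (1/2)^k"
    by (rule trunc_subseq[OF h h], rule that)
  have lim: "(\<lambda>k. ev (s k) h (0, x)) \<longlonglongrightarrow> F (\<chi> i. complex_of_real (x $ i))" for x
  proof -
    have cd: "cdot (\<chi> i. complex_of_real (x $ i)) \<xi> = complex_of_real (x \<bullet> \<xi>)" for \<xi>
      by (simp add: cdot_def inner_vec_def)
    have "(\<lambda>k. LINT \<xi>|lborel. exp (\<i> * complex_of_real (x \<bullet> \<xi>)) * trunc (s k) h \<xi>) \<longlonglongrightarrow> (LINT \<xi>|lborel. exp (\<i> * complex_of_real (x \<bullet> \<xi>)) * h \<xi>)"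
    proof (rule integral_dominated_convergence[OF _ _ ih])
      show "AE \<xi> in lborel. (\<lambda>k. exp (\<i> * complex_of_real (x \<bullet> \<xi>)) * trunc (s k) h \<xi>) \<longlonglongrightarrow> exp (\<i> * complex_of_real (x \<bullet> \<xi>)) * h \<xi>"
      proof (intro AE_I2 tendsto_mult tendsto_const tendsto_eventually)
        fix \<xi> :: "real^2"
        obtain m :: nat where m: "norm \<xi> < real m" using reals_Archimedean2 by blast
        show "\<forall>\<^sub>F k in sequentially. trunc (s k) h \<xi> = h \<xi>"
          using eventually_ge_at_top[of m]
        proof eventually_elim
          case (elim k)
          then have "m \<le> s k" using strict_mono_imp_increasing[OF s(1), of k] by simp
          then show ?case using m by (simp add: trunc_apply)
        qed
      qed
      show "AE \<xi> in lborel. norm (exp (\<i> * complex_of_real (x \<bullet> \<xi>)) * trunc (s k) h \<xi>) \<le> cmod (h \<xi>)" for k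
        by (auto simp: norm_mult trunc_apply)
      have [measurable]: "trunc n h \<in> borel_measurable borel" for n by (rule trunc_measurable) measurable
      show "(\<lambda>\<xi>. exp (\<i> * complex_of_real (x \<bullet> \<xi>)) * trunc (s k) h \<xi>) \<in> borel_measurable lborel" for k by measurable
    qed measurable
    then show ?thesis unfolding ev_def evI_def F_def cd by (intro tendsto_mult tendsto_const) simp
  qed
  have p0: "phase 0 h = h" by (simp add: phase_def)
  have "AE x in lborel. f x = F (\<chi> i. complex_of_real (x $ i))"
    using ev_tendsto_propagator[OF f s(2)[unfolded h_def], of 0] propagator_L2(2)[OF f, of 0] invf_fourier[OF f]
  proof eventually_elim
    case (elim x)
    then have "propagator 0 f x = f x" using p0 by (simp add: h_def)
    then have "(\<lambda>k. ev (s k) h (0, x)) \<longlonglongrightarrow> f x" using elim(1) by (simp add: h_def)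
    then show ?case using lim[of x] by (rule LIMSEQ_unique)
  qed
  then show ?thesis unfolding extends_to_entire_def using eF by blast
qed

theorem theorem3p1:
  fixes f :: "real^2 \<Rightarrow> complex" and \<omega> :: real
  assumes "f \<in> L2"
    and "\<omega> > 0"
    and "\<And>g. g \<in> L2 \<Longrightarrow> complex_of_real \<omega> * inner_L2 g f = Q g f f f f f"
  shows "(\<exists>\<mu>>0. (\<lambda>\<xi>. complex_of_real (exp (\<mu> * norm \<xi> ^ 4)) * fourier_L2 f \<xi>) \<in> L2) \<and>
    extends_to_entire f"
  using exponential_decay[OF assms] extends_to_entire_of_decay[OF assms(1)] by blast

end
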